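(* There is a randomized Monte Carlo algorithm that, given an undirected multigraph with $n$ vertices and $m$ edges, each edge $e$ carrying a non-negative integer weight $w(e)$, and an integer $t$, decides whether the multigraph has a perfect matching of total weight exactly $t$, in time $\widetilde O(t\cdot n^8+m)$.
   Context: A multigraph may have multiple parallel edges between the same pair of vertices. A perfect matching is a set of edges covering every vertex exactly once; its total weight is the sum of the weights of its edges. $\widetilde O$ hides polylogarithmic factors.
   Formalization: In the time bound, t is replaced by max(1,t), since t·n^8+m is negative or degenerate for t ≤ 0 (e.g. t=-1, n=2, m=0); correctness is still proved for every integer t, and for t ≥ 1 the bound is as stated. *)

theory Defs
  imports "HOL-Probability.Probability"
begin

section \<open>Weighted multigraphs and perfect matchings\<close>

text \<open>
  An instance consists of a multigraph on the vertices 0, ..., n - 1 and a target weight.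
  An edge is a triple of its two end vertices (in either order) and its weight.
  The identity of an edge is its position in the list, so that parallel edges, even those of
  equal weight, are distinct.
\<close>

type_synonym wedge = "nat \<times> nat \<times> nat"

record exact_matching_instance =
  num_verts :: nat
  edges :: "wedge list"
  target :: int

definition ends :: "wedge \<Rightarrow> nat set" where
  "ends e = (case e of (u, v, w) \<Rightarrow> {u, v})"

definition weight :: "wedge \<Rightarrow> nat" where
  "weight e = (case e of (u, v, w) \<Rightarrow> w)"

abbreviation num_edges :: "exact_matching_instance \<Rightarrow> nat" where
  "num_edges x \<equiv> length (edges x)"

definition valid_instance :: "exact_matching_instance \<Rightarrow> bool" where
  "valid_instance x \<longleftrightarrow>
     (\<forall>(u, v, w) \<in> set (edges x). u < num_verts x \<and> v < num_verts x \<and> u \<noteq> v)"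

definition perfect_matching :: "exact_matching_instance \<Rightarrow> nat set \<Rightarrow> bool" where
  "perfect_matching x M \<longleftrightarrow>
     M \<subseteq> {..<num_edges x} \<and> (\<forall>v<num_verts x. \<exists>!i. i \<in> M \<and> v \<in> ends (edges x ! i))"

definition total_weight :: "exact_matching_instance \<Rightarrow> nat set \<Rightarrow> nat" where
  "total_weight x M = (\<Sum>i\<in>M. weight (edges x ! i))"

definition has_exact_matching :: "exact_matching_instance \<Rightarrow> bool" where
  "has_exact_matching x \<longleftrightarrow>
     (\<exists>M. perfect_matching x M \<and> int (total_weight x M) = target x)"


section \<open>Randomized word RAM\<close>

text \<open>
  Words are the natural numbers below \<open>2 ^ b\<close>, where \<open>b\<close> is the word length, and arithmetic
  is modulo \<open>2 ^ b\<close>. A program is a finite piece of syntax and does not depend on \<open>b\<close>. It uses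
  finitely many registers and a random access memory addressed by words; each small step
  takes unit time.
\<close>

datatype operand = Reg nat | Const nat

datatype arith_op = Add | Sub | Mul | Div | Mod

datatype cond = Less operand operand | Equal operand operand

datatype program =
    Skip
  | Arith nat arith_op operand operand
  | Load nat operand
  | Store operand operand
  | Coin nat
  | Seq program program
  | Cond cond program program
  | While cond program

record ram_state =
  regs :: "nat \<Rightarrow> nat"
  mem :: "nat \<Rightarrow> nat"

fun operand_val :: "nat \<Rightarrow> operand \<Rightarrow> ram_state \<Rightarrow> nat" where
  "operand_val b (Reg r) s = regs s r"
| "operand_val b (Const k) s = k mod 2 ^ b"

text \<open>Division by zero follows the conventions for \<open>nat\<close>.\<close>

fun arith_val :: "nat \<Rightarrow> arith_op \<Rightarrow> nat \<Rightarrow> nat \<Rightarrow> nat" where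
  "arith_val b Add i j = (i + j) mod 2 ^ b"
| "arith_val b Sub i j = nat ((int i - int j) mod 2 ^ b)"
| "arith_val b Mul i j = (i * j) mod 2 ^ b"
| "arith_val b Div i j = i div j"
| "arith_val b Mod i j = i mod j"

fun cond_val :: "nat \<Rightarrow> cond \<Rightarrow> ram_state \<Rightarrow> bool" where
  "cond_val b (Less p q) s \<longleftrightarrow> operand_val b p s < operand_val b q s"
| "cond_val b (Equal p q) s \<longleftrightarrow> operand_val b p s = operand_val b q s"

definition set_reg :: "nat \<Rightarrow> nat \<Rightarrow> ram_state \<Rightarrow> ram_state" where
  "set_reg r k s = s\<lparr>regs := (regs s)(r := k)\<rparr>"

definition set_mem :: "nat \<Rightarrow> nat \<Rightarrow> ram_state \<Rightarrow> ram_state" where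
  "set_mem a k s = s\<lparr>mem := (mem s)(a := k)\<rparr>"

text \<open>
  A configuration is the program that remains to be executed together with the current state.
  Halted configurations, those whose remaining program is \<open>Skip\<close>, are stationary.
\<close>

fun step :: "nat \<Rightarrow> program \<Rightarrow> ram_state \<Rightarrow> (program \<times> ram_state) pmf" where
  "step b Skip s = return_pmf (Skip, s)"
| "step b (Arith r f p q) s =
     return_pmf (Skip, set_reg r (arith_val b f (operand_val b p s) (operand_val b q s)) s)"
| "step b (Load r p) s = return_pmf (Skip, set_reg r (mem s (operand_val b p s)) s)"
| "step b (Store p q) s =
     return_pmf (Skip, set_mem (operand_val b p s) (operand_val b q s) s)"
| "step b (Coin r) s = map_pmf (\<lambda>k. (Skip, set_reg r k s)) (pmf_of_set {0, 1})"
| "step b (Seq P Q) s =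
     (if P = Skip then return_pmf (Q, s)
      else map_pmf (\<lambda>(P', s'). (Seq P' Q, s')) (step b P s))"
| "step b (Cond c P Q) s = return_pmf (if cond_val b c s then P else Q, s)"
| "step b (While c P) s =
     return_pmf (if cond_val b c s then Seq P (While c P) else Skip, s)"

primrec run :: "nat \<Rightarrow> nat \<Rightarrow> program \<times> ram_state \<Rightarrow> (program \<times> ram_state) pmf" where
  "run b 0 cfg = return_pmf cfg"
| "run b (Suc k) cfg = bind_pmf (step b (fst cfg) (snd cfg)) (run b k)"


section \<open>Monte Carlo decision algorithms for exact matching\<close>

text \<open>The target is given by a sign word and its absolute value.\<close>

definition input_words :: "exact_matching_instance \<Rightarrow> nat list" where
  "input_words x =
     [num_verts x, num_edges x, if target x < 0 then 1 else 0, nat \<bar>target x\<bar>]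
     @ concat (map (\<lambda>(u, v, w). [u, v, w]) (edges x))"

definition input_state :: "exact_matching_instance \<Rightarrow> ram_state" where
  "input_state x =
     \<lparr>regs = (\<lambda>_. 0),
      mem = (\<lambda>a. if a < length (input_words x) then input_words x ! a else 0)\<rparr>"

definition max_number :: "exact_matching_instance \<Rightarrow> nat" where
  "max_number x = Max ({num_verts x, num_edges x, nat \<bar>target x\<bar>} \<union> weight ` set (edges x))"

text \<open>
  The usual word RAM convention: the word length is at least a constant multiple \<open>c\<close> of the
  logarithm of the largest number in the input.
\<close>

definition admissible_word_length :: "nat \<Rightarrow> exact_matching_instance \<Rightarrow> nat \<Rightarrow> bool" where
  "admissible_word_length c x b \<longleftrightarrow> (max_number x + 2) ^ c \<le> 2 ^ b"

text \<open>
  The time bound holds for every outcome of the coin tosses; the answer, found in register 0,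
  is correct with probability at least \<open>2/3\<close> on every input.
\<close>

definition monte_carlo_decides_exact_matching ::
    "program \<Rightarrow> nat \<Rightarrow> (exact_matching_instance \<Rightarrow> nat) \<Rightarrow> bool" where
  "monte_carlo_decides_exact_matching P c T \<longleftrightarrow>
     (\<forall>x b. valid_instance x \<longrightarrow> admissible_word_length c x b \<longrightarrow>
        (\<forall>(Q, s) \<in> set_pmf (run b (T x) (P, input_state x)). Q = Skip) \<and>
        measure_pmf.prob (run b (T x) (P, input_state x))
          {(Q, s). regs s 0 = (if has_exact_matching x then 1 else 0)} \<ge> 2 / 3)"

text \<open>
  \<open>T\<close> is at most \<open>f\<close> up to a factor polylogarithmic in \<open>f\<close>. The summands 1 and 2 only
  matter where \<open>f\<close> is close to 0.
\<close>

definition soft_O :: "('a \<Rightarrow> real) \<Rightarrow> ('a \<Rightarrow> nat) set" where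
  "soft_O f = {T. \<exists>C k. \<forall>x. real (T x) \<le> C * (f x + 1) * ln (f x + 2) ^ k}"

end

theory Submission
  imports Defs "HOL-Algebra.Algebraic_Closure_Type" "HOL-Library.Z2"
begin

text \<open>
  Give every pair of end vertices and weight at most \<open>t\<close> an independent random scalar. The number
  of perfect matchings of weight \<open>t\<close> is then replaced by the coefficient of \<open>y ^ t\<close> in the hafnian of
  a matrix of polynomials in \<open>y\<close>, a multilinear polynomial in the scalars which vanishes
  identically iff there is no such matching. In characteristic 2 the hafnian is invariant under the
  congruence transformations of Gaussian elimination, so it can be evaluated at a point in cubic time.
  Since a word RAM program must not search for an irreducible polynomial, we use
  \<open>x ^ (2 * 3 ^ l) + x ^ 3 ^ l + 1\<close>, which is irreducible over the field with two elements. Field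
  elements are words. The evaluation points form the additive subgroup of the words below a power
  \<open>N\<close> of 2, with \<open>n * t < N\<close>; this allows an additive fast Fourier transform for the entries of the
  matrix, and, as the vanishing polynomial of the subgroup is linearized, the coefficient of
  \<open>y ^ t\<close> is a combination of the values with weights that are cheap to compute. The Schwartz--Zippel
  lemma bounds the probability of error by a quarter because \<open>4 * n < N\<close>.
\<close>


text \<open>2 is a primitive root modulo every power of 3: a root of the trinomial has order a
  multiple of \<open>3 ^ Suc l\<close>, and \<open>3 ^ Suc l\<close> divides
  \<open>2 ^ k - 1\<close> only if \<open>2 * 3 ^ l\<close> divides \<open>k\<close>. Irreducibility
  enters in the form that distinct words give distinct field elements. The field exists only in the
  proof, inside the algebraic closure of the field with two elements, and programs are specified
  through the map \<open>phi\<close> from words into it. Working modulo 2 loses nothing: different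
  matchings formed from cells (ends and weight) give different squarefree monomials with coefficient
  1, which cannot cancel. Duplicate edges share a cell, so the number of edges enters only through
  one pass over the input. The transform keeps the time linear in \<open>t\<close> up to logarithms:
  evaluating polynomials of degree up to \<open>t\<close> point by point at more than
  \<open>n * t\<close> points would cost a factor \<open>t * t\<close>. Cosets of an additive
  subgroup take the place of roots of unity, as characteristic 2 has no nontrivial roots of unity
  whose order is a power of 2.\<close>

section \<open>Roots of the trinomial in characteristic 2\<close>

lemma exists_root_trinomial:
  assumes "H > 0"
  shows "\<exists>z :: bit alg_closure. z ^ (2 * H) + z ^ H + 1 = 0"
proof -
  let ?p = "Polynomial.monom 1 (2 * H) + (Polynomial.monom 1 H + 1) :: bit alg_closure poly"
  have "Polynomial.coeff ?p (2 * H) \<noteq> 0" using assms by (simp add: coeff_eq_0)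
  then have "Polynomial.degree ?p > 0" using assms le_degree[of ?p "2*H"] by linarith
  then obtain z where "poly ?p z = 0" using alg_closed_imp_poly_has_root by blast
  then show ?thesis by (auto simp: poly_monom add.assoc)
qed

lemma bit_alg_closure_two: "(1 :: bit alg_closure) + 1 = 0"
proof -
  have "to_ac (1 + 1 :: bit) = 0" by (metis add_bit_eq_xor to_ac_0 xor_self_eq)
  then show ?thesis by (simp only: to_ac_add to_ac_1)
qed

text \<open>Cubing \<open>1 + 3 * a\<close> gives \<open>1 + 9 * a\<close> up to multiples of
  \<open>27 * a ^ 2\<close>, hence exactly one more factor 3. Exactness,
  \<open>\<not> 3 dvd u\<close>, is what makes 2 a primitive root modulo the powers of 3.\<close>

lemma two_power_double_three_power:
  "\<exists>u. 2 ^ (2 * 3 ^ l) = 1 + 3 ^ Suc l * u \<and> \<not> 3 dvd (u :: nat)"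
proof (induction l)
  case 0
  show ?case by (rule exI[of _ 1]) simp
next
  case (Suc l)
  then obtain u :: nat where u: "2 ^ (2 * 3 ^ l) = 1 + 3 ^ Suc l * u" "\<not> 3 dvd u" by blast
  define a where "a = (3 :: nat) ^ l * u"
  have "(2 :: nat) ^ (2 * 3 ^ Suc l) = (2 ^ (2 * 3 ^ l)) ^ 3"
    by (simp flip: power_mult add: ac_simps)
  also have "\<dots> = (1 + 3 * a) ^ 3" unfolding u(1) by (simp only: a_def power_Suc mult.assoc)
  also have "\<dots> = 1 + 9 * (a + 3 * a\<^sup>2 + 3 * a ^ 3)"
    by (simp add: power2_eq_square power3_eq_cube algebra_simps)
  also have "\<dots> = 1 + 3 ^ Suc (Suc l) * (u + 3 * (a * u + a\<^sup>2 * u))"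
    by (simp add: a_def power2_eq_square power3_eq_cube algebra_simps)
  finally have "2 ^ (2 * 3 ^ Suc l) = 1 + 3 ^ Suc (Suc l) * (u + 3 * (a * u + a\<^sup>2 * u))" .
  moreover have "\<not> 3 dvd u + 3 * (a * u + a\<^sup>2 * u)"
    using u(2) by (metis dvd_add_left_iff dvd_triv_left)
  ultimately show ?case by blast
qed

text \<open>The binomial theorem modulo \<open>x ^ 2\<close>, just precise enough to isolate one
  more factor 3 in the next induction.\<close>

lemma power_one_plus_mult_expand: "\<exists>v. (1 + x) ^ q = 1 + q * x + x\<^sup>2 * (v :: nat)" for x :: nat
proof (induction q)
  case 0
  show ?case by (rule exI[of _ 0]) simp
next
  case (Suc q)
  then obtain v where v: "(1 + x) ^ q = 1 + q * x + x\<^sup>2 * v" by blast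
  show ?case
    by (rule exI[of _ "q + v + x * v"]) (unfold power_Suc v, simp add: power2_eq_square algebra_simps)
qed

text \<open>The order of 2 modulo \<open>3 ^ Suc l\<close> is \<open>2 * 3 ^ l\<close>. In the
  induction step \<open>k = 2 * 3 ^ l * q\<close>, and the \<open>q\<close>-th power of
  \<open>1 + 3 ^ Suc l * u\<close> is \<open>1 + 3 ^ Suc l * (q * u)\<close> up to a multiple of a
  higher power of 3. As 3 does not divide \<open>u\<close>, the missing factor 3 must come from
  \<open>q\<close>.\<close>

lemma three_power_dvd_two_power_minus_one:
  assumes "3 ^ Suc l dvd (2 :: nat) ^ k - 1"
  shows "2 * 3 ^ l dvd k"
  using assms
proof (induction l)
  case 0
  show ?case
  proof (rule ccontr)
    assume "\<not> 2 * 3 ^ 0 dvd k"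
    then have "odd k" by simp
    then obtain j where "k = 2 * j + 1" by (auto elim: oddE)
    then have "(2 :: nat) ^ k - 1 = 2 * (4 ^ j) - 1" by (simp add: power_mult)
    moreover have "(4 :: nat) ^ j mod 3 = 1"
      using power_mod[of "4 :: nat" 3 j] by simp
    then have "\<not> (3 :: nat) dvd 2 * 4 ^ j - 1" by presburger
    ultimately show False using 0 by simp
  qed
next
  case (Suc l)
  have "(3 :: nat) ^ Suc l dvd 3 ^ Suc (Suc l)" by (simp add: le_imp_power_dvd)
  then obtain q where q: "k = 2 * 3 ^ l * q" using Suc dvd_trans by blast
  obtain u :: nat where u: "2 ^ (2 * 3 ^ l) = 1 + 3 ^ Suc l * u" "\<not> 3 dvd u"
    using two_power_double_three_power by blast
  obtain v where v: "(1 + 3 ^ Suc l * u) ^ q = 1 + q * (3 ^ Suc l * u) + (3 ^ Suc l * u)\<^sup>2 * v"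
    using power_one_plus_mult_expand by blast
  have "(2 :: nat) ^ k - 1 = (1 + 3 ^ Suc l * u) ^ q - 1" unfolding q by (subst power_mult) (simp only: u(1))
  also have "\<dots> = 3 ^ Suc l * (q * u + 3 * (3 ^ l * u\<^sup>2 * v))"
    unfolding v by (simp add: power2_eq_square algebra_simps)
  finally have "3 ^ Suc l * 3 dvd 3 ^ Suc l * (q * u + 3 * (3 ^ l * u\<^sup>2 * v))"
    using Suc.prems by (simp add: mult.commute)
  then have "3 dvd q * u + 3 * (3 ^ l * u\<^sup>2 * v)" by (subst (asm) nat_mult_dvd_cancel1) simp_all
  then have "3 dvd q * u" by (metis dvd_add_left_iff dvd_triv_left)
  then have "3 dvd q" using u(2) prime_dvd_mult_iff[of 3 q u] by simp
  then show ?case by (auto simp: q)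
qed

lemma power_gcd_eq_one:
  fixes z :: "'a :: field"
  assumes "z ^ i = 1" "z ^ j = 1" "z \<noteq> 0"
  shows "z ^ gcd i j = 1"
  using assms
proof (induction i j rule: gcd_nat_induct)
  case (step m n)
  have "z ^ m = z ^ (n * (m div n) + m mod n)" by simp
  also have "\<dots> = (z ^ n) ^ (m div n) * z ^ (m mod n)" by (simp only: power_add power_mult)
  finally have "z ^ (m mod n) = 1" using step by simp
  then show ?case using step by (simp add: gcd_red_nat[of m n])
qed simp

text \<open>The power \<open>y = z ^ 3 ^ l\<close> is a primitive cube root of unity: it is a root
  of \<open>y ^ 2 + y + 1\<close>, and \<open>y = 1\<close> would give
  \<open>1 + 1 + 1 = 1 = 0\<close>. If the gcd of \<open>3 ^ Suc l\<close> and \<open>k\<close> were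
  a smaller power of 3, it would divide \<open>3 ^ l\<close> and force \<open>y = 1\<close>.\<close>

lemma order_of_trinomial_root:
  fixes z :: "'a :: field"
  assumes two: "(1 :: 'a) + 1 = 0" and z: "z ^ (2 * 3 ^ l) + z ^ (3 ^ l) + 1 = 0"
    and k: "z ^ k = 1"
  shows "3 ^ Suc l dvd k"
proof -
  define y where "y = z ^ (3 ^ l)"
  have y: "y\<^sup>2 + y + 1 = 0" using z by (simp add: y_def flip: power_mult add: mult.commute)
  have "y \<noteq> 1" using y two by (auto simp: add.assoc)
  have "y ^ 3 - 1 = (y - 1) * (y\<^sup>2 + y + 1)" by (simp add: power2_eq_square power3_eq_cube algebra_simps)
  then have "y ^ 3 = 1" using y by simp
  then have *: "z ^ (3 ^ Suc l) = 1" by (simp add: y_def flip: power_mult add: mult.commute)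
  have "z \<noteq> 0" using z by (auto simp: power_0_left)
  then have g: "z ^ gcd (3 ^ Suc l) k = 1" by (intro power_gcd_eq_one * k)
  obtain j where j: "j \<le> Suc l" "gcd (3 ^ Suc l) k = 3 ^ j"
    using divides_primepow_nat[of 3 "gcd (3 ^ Suc l) k" "Suc l"] by auto
  have "j = Suc l"
  proof (rule ccontr)
    assume "j \<noteq> Suc l"
    then have "(3 :: nat) ^ l = 3 ^ j * 3 ^ (l - j)" using j by (simp flip: power_add)
    then have "y = (z ^ 3 ^ j) ^ 3 ^ (l - j)" by (simp add: y_def power_mult)
    then show False using g j \<open>y \<noteq> 1\<close> by simp
  qed
  then show ?thesis using j by (metis gcd_dvd2)
qed

text \<open>Fermat's argument: multiplication by \<open>a\<close> permutes \<open>L - {0}\<close>,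
  so comparing the products over this set gives the power. Stability under the single factor
  \<open>a\<close> suffices; this matters when \<open>L\<close> is a span of powers of
  \<open>z\<close> not yet known to be a field.\<close>

lemma finite_stable_set_power_eq_one:
  fixes a :: "'a :: field"
  assumes "finite L" "0 \<in> L" "a \<noteq> 0" "\<And>x. x \<in> L \<Longrightarrow> a * x \<in> L"
  shows "a ^ (card L - 1) = 1"
proof -
  let ?M = "L - {0}"
  have "(\<lambda>x. a * x) ` ?M = ?M"
    by (rule endo_inj_surj) (use assms in \<open>auto simp: inj_on_def\<close>)
  then have "bij_betw (\<lambda>x. a * x) ?M ?M" using assms by (auto simp: bij_betw_def inj_on_def)
  then have "\<Prod>?M = (\<Prod>x\<in>?M. a * x)" by (rule prod.reindex_bij_betw[symmetric])
  also have "\<dots> = a ^ card ?M * \<Prod>?M" by (simp add: prod.distrib)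
  finally have "a ^ card ?M = 1" using assms by auto
  then show ?thesis using assms by simp
qed

section \<open>Words as field elements\<close>

text \<open>The binary digits of a word are the coefficients of a polynomial over the field with two
  elements, evaluated at \<open>z\<close>. Doubling a word multiplies by \<open>z\<close>, and
  bitwise exclusive or becomes addition.\<close>

fun phi :: "'a :: comm_ring_1 \<Rightarrow> nat \<Rightarrow> 'a" where
  "phi z x = (if x = 0 then 0 else of_nat (x mod 2) + z * phi z (x div 2))"

declare phi.simps [simp del]

lemma phi_0 [simp]: "phi z 0 = 0" by (simp add: phi.simps)

lemma phi_rec: "phi z x = of_nat (x mod 2) + z * phi z (x div 2)"
  by (cases "x = 0") (simp_all add: phi.simps[of z x])

lemma phi_1 [simp]: "phi z (Suc 0) = 1" by (simp add: phi_rec[of z "Suc 0"])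

lemma phi_double: "phi z (2 * x) = z * phi z x"
  by (simp add: phi_rec[of z "2 * x"])

lemma phi_add_high:
  assumes "r < 2 ^ i"
  shows "phi z (r + 2 ^ i * q) = phi z r + z ^ i * phi z q"
  using assms
proof (induction i arbitrary: r)
  case (Suc i)
  have "r div 2 < 2 ^ i" using Suc.prems by auto
  have m: "(r + 2 ^ Suc i * q) mod 2 = r mod 2" by (simp add: mult.assoc)
  have d: "(r + 2 ^ Suc i * q) div 2 = r div 2 + 2 ^ i * q" by (simp add: mult.assoc)
  show ?case
    unfolding phi_rec[of z "r + 2 ^ Suc i * q"] phi_rec[of z r] m d Suc.IH[OF \<open>r div 2 < 2 ^ i\<close>]
    by (simp add: algebra_simps)
qed simp

lemma phi_power_two: "phi z (2 ^ i) = z ^ i"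
  using phi_add_high[of 0 i z 1] by simp

locale char_two =
  fixes z :: "'a :: field"
  assumes two: "(1 :: 'a) + 1 = 0"
begin

lemma two_eq_0 [simp]: "(2 :: 'a) = 0"
  using two by (simp only: one_add_one)

lemma add_self [simp]: "x + x = (0 :: 'a)"
  by (metis mult_2 mult_zero_left two_eq_0)

lemma add_self_left [simp]: "x + (x + y) = (y :: 'a)"
  by (simp flip: add.assoc)

lemma uminus_eq [simp]: "- x = (x :: 'a)"
  by (metis add_eq_0_iff add_self)

lemma minus_eq [simp]: "x - y = (x + y :: 'a)"
  by (metis uminus_eq diff_conv_add_uminus)

lemma add_eq_0: "x + y = 0 \<longleftrightarrow> x = (y :: 'a)"
  by (metis add_self add_self_left add.right_neutral)

lemma of_nat_parity: "(of_nat n :: 'a) = of_nat (n mod 2)"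
proof -
  have "(of_nat n :: 'a) = of_nat (2 * (n div 2) + n mod 2)" by simp
  also have "\<dots> = of_nat (n mod 2)" by (simp only: of_nat_add of_nat_mult) simp
  finally show ?thesis .
qed

text \<open>The witness is the bitwise exclusive or, built digit by digit. Existence is enough to
  make the image of the \<open>k\<close>-bit words an additive group.\<close>

lemma phi_add_closed:
  assumes "x < 2 ^ k" "y < 2 ^ k"
  shows "\<exists>w<2 ^ k. phi z w = phi z x + phi z y"
  using assms
proof (induction k arbitrary: x y)
  case (Suc k)
  have "x div 2 < 2 ^ k" "y div 2 < 2 ^ k" using Suc.prems by auto
  then obtain w where w: "w < 2 ^ k" "phi z w = phi z (x div 2) + phi z (y div 2)"
    using Suc.IH by blast
  let ?b = "(x + y) mod 2"
  have "phi z (?b + 2 * w) = of_nat ?b + z * phi z w"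
    by (subst phi_rec) (simp add: mod_mult_self2)
  also have "(of_nat ?b :: 'a) = of_nat (x mod 2) + of_nat (y mod 2)"
    by (metis of_nat_parity of_nat_add)
  finally have "phi z (?b + 2 * w) = phi z x + phi z y"
    by (simp add: w phi_rec[of z x] phi_rec[of z y] algebra_simps)
  moreover have "?b + 2 * w < 2 ^ Suc k"
    using w(1) by (simp add: mod2_eq_if)
  ultimately show ?case by blast
qed simp

text \<open>If the doubled word overflows, its top bit contributes \<open>z ^ k\<close>, which the
  relation \<open>rel\<close> rewrites into a \<open>k\<close>-bit word; the sum is again in the
  image.\<close>

lemma phi_image_stable:
  assumes rel: "z ^ k \<in> phi z ` {..<2 ^ k}" and "a \<in> phi z ` {..<2 ^ k}"
  shows "z * a \<in> phi z ` {..<2 ^ k}"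
proof -
  obtain x where x: "x < 2 ^ k" "a = phi z x" using assms by auto
  obtain r where r: "r < 2 ^ k" "z ^ k = phi z r" using rel by auto
  show ?thesis
  proof (cases "2 * x < 2 ^ k")
    case True
    then show ?thesis using x by (auto simp flip: phi_double)
  next
    case False
    define w where "w = 2 * x - 2 ^ k"
    have w: "w < 2 ^ k" "2 * x = w + 2 ^ k * 1" using x False by (auto simp: w_def)
    have "z * a = phi z w + phi z r"
      using phi_add_high[OF w(1), of z 1] w(2) x r by (simp flip: phi_double)
    then show ?thesis using phi_add_closed[OF w(1) r(1)] by (metis imageI lessThan_iff)
  qed
qed

text \<open>Horner's rule over the bits of \<open>y\<close>, using only stability under
  \<open>z\<close> and under addition.\<close>

lemma phi_image_mult_closed:
  assumes rel: "z ^ k \<in> phi z ` {..<2 ^ k}"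
    and a: "a \<in> phi z ` {..<2 ^ k}"
  shows "phi z y * a \<in> phi z ` {..<2 ^ k}"
proof (induction y rule: less_induct)
  case (less y)
  show ?case
  proof (cases "y = 0")
    case True
    then show ?thesis by (auto intro: image_eqI[of _ _ 0])
  next
    case False
    then have "z * (phi z (y div 2) * a) \<in> phi z ` {..<2 ^ k}"
      by (intro phi_image_stable[OF rel] less) simp
    then obtain v where v: "v < 2 ^ k" "z * (phi z (y div 2) * a) = phi z v" by auto
    have "of_nat (y mod 2) * a \<in> phi z ` {..<2 ^ k}"
      using a by (cases "even y") (auto simp: mod2_eq_if intro: image_eqI[of _ _ 0])
    then obtain u where u: "u < 2 ^ k" "of_nat (y mod 2) * a = phi z u"
      by (metis imageE lessThan_iff)
    have "phi z y * a = phi z u + phi z v"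
      by (subst phi_rec[of z y]) (simp add: algebra_simps flip: u(2) v(2))
    then show ?thesis using phi_add_closed[OF u(1) v(1)] by (metis imageI lessThan_iff)
  qed
qed

text \<open>Linear independence of \<open>1, z, ..., z ^ (d - 1)\<close> over the field with two
  elements: two different words with equal values, compared at their highest differing bit, would
  express that power of \<open>z\<close> by lower ones.\<close>

lemma phi_inj_minimal:
  assumes "\<And>k. k < d \<Longrightarrow> z ^ k \<notin> phi z ` {..<2 ^ k}"
  shows "inj_on (phi z) {..<2 ^ d}"
proof (rule inj_onI; rule ccontr)
  fix x y assume xy: "x \<in> {..<2 ^ d}" "y \<in> {..<2 ^ d}" "phi z x = phi z y" "x \<noteq> y"
  show False using assms xy
  proof (induction d arbitrary: x y)
    case (Suc d)
    have *: False if "x < 2 ^ d" "2 ^ d \<le> y" "y < 2 ^ Suc d" "phi z x = phi z y" for x y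
    proof -
      define r where "r = y - 2 ^ d"
      have r: "r < 2 ^ d" "y = r + 2 ^ d * 1" using that by (auto simp: r_def)
      have "phi z y = phi z r + z ^ d" using phi_add_high[OF r(1), of z 1] r(2) by simp
      then have "z ^ d = phi z r + phi z x" using that by simp
      then show False using phi_add_closed[OF r(1) that(1)] Suc.prems(1)[of d]
        by (metis imageI lessI lessThan_iff)
    qed
    show ?case
    proof (cases "x < 2 ^ d"; cases "y < 2 ^ d")
      assume "x < 2 ^ d" "y < 2 ^ d"
      then show False using Suc by (metis lessThan_iff less_Suc_eq)
    next
      assume "\<not> x < 2 ^ d" "\<not> y < 2 ^ d"
      then have 1: "x - 2 ^ d < 2 ^ d" "y - 2 ^ d < 2 ^ d"
        "x = (x - 2 ^ d) + 2 ^ d * 1" "y = (y - 2 ^ d) + 2 ^ d * 1" using Suc.prems by auto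
      have "phi z (x - 2 ^ d) = phi z (y - 2 ^ d)"
        using phi_add_high[OF 1(1), of z 1] phi_add_high[OF 1(2), of z 1] 1 Suc.prems by simp
      moreover have "x - 2 ^ d \<noteq> y - 2 ^ d" using 1 Suc.prems by metis
      ultimately show False using Suc 1 by (metis lessThan_iff less_Suc_eq)
    next
      assume "x < 2 ^ d" "\<not> y < 2 ^ d"
      then show False using * Suc.prems by (metis lessThan_iff not_less)
    next
      assume "\<not> x < 2 ^ d" "y < 2 ^ d"
      then show False using * Suc.prems by (metis lessThan_iff not_less)
    qed
  qed auto
qed

text \<open>This plays the part of irreducibility. For the least \<open>d\<close> such that
  \<open>z ^ d\<close> depends on lower powers, the image of the \<open>d\<close>-bit words has
  \<open>2 ^ d\<close> elements and is stable under \<open>z\<close>, so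
  \<open>z ^ (2 ^ d - 1) = 1\<close>. The order of \<open>z\<close> then forces
  \<open>2 * 3 ^ l\<close> to divide \<open>d\<close>.\<close>

lemma phi_inj:
  assumes z: "z ^ (2 * 3 ^ l) + z ^ (3 ^ l) + 1 = 0"
  shows "inj_on (phi z) {..<2 ^ (2 * 3 ^ l)}"
proof (rule phi_inj_minimal)
  let ?P = "\<lambda>k. z ^ k \<in> phi z ` {..<2 ^ k}"
  fix k :: nat assume k: "k < 2 * 3 ^ l"
  show "\<not> ?P k"
  proof
    assume "?P k"
    define d where "d = (LEAST k. ?P k)"
    have P: "?P d" and d: "d \<le> k" and min: "\<And>j. j < d \<Longrightarrow> \<not> ?P j"
      unfolding d_def using \<open>?P k\<close> by (auto intro: LeastI Least_le dest: not_less_Least)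
    have inj: "inj_on (phi z) {..<2 ^ d}" by (rule phi_inj_minimal[OF min])
    have "z \<noteq> 0" using z by (auto simp: power_0_left)
    then have "z ^ (card (phi z ` {..<2 ^ d}) - 1) = 1"
      by (intro finite_stable_set_power_eq_one phi_image_stable[OF P])
        (auto intro: image_eqI[of _ _ 0])
    then have "z ^ (2 ^ d - 1) = 1" by (simp add: card_image[OF inj])
    then have "2 * 3 ^ l dvd d"
      by (intro three_power_dvd_two_power_minus_one order_of_trinomial_root[OF two z])
    \<comment> \<open>Zero is divisible by everything, so this case is excluded separately: the only
      word of 0 bits is 0, whose value is not \<open>z ^ 0\<close>.\<close>
    moreover have "d \<noteq> 0"
    proof
      assume "d = 0"
      then have "(1 :: 'a) = phi z 0" using P by auto
      then show False by simp
    qed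
    ultimately show False using d k by (auto dest: dvd_imp_le)
  qed
qed

text \<open>The trinomial expresses \<open>z\<close> to the power \<open>2 * 3 ^ l\<close> by lower
  powers, so the image of all words of that length is closed under multiplication and Fermat's
  argument applies. This is how the program obtains inverses: by a power with exponent two less than
  the field size.\<close>

lemma phi_power_eq_one:
  assumes z: "z ^ (2 * 3 ^ l) + z ^ (3 ^ l) + 1 = 0"
    and "x < 2 ^ (2 * 3 ^ l)" "x \<noteq> 0"
  shows "phi z x ^ (2 ^ (2 * 3 ^ l) - 1) = 1"
proof -
  let ?d = "2 * 3 ^ l" let ?L = "phi z ` {..<2 ^ ?d}"
  have inj: "inj_on (phi z) {..<2 ^ ?d}" by (rule phi_inj[OF z])
  have "z ^ ?d = phi z (1 + 2 ^ (3 ^ l) * 1)"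
  proof (subst phi_add_high)
    show "(1 :: nat) < 2 ^ 3 ^ l" by (rule one_less_power) auto
    have "z ^ ?d + (z ^ (3 ^ l) + 1) = 0" using z by (simp only: add.assoc)
    then show "z ^ ?d = phi z 1 + z ^ 3 ^ l * phi z 1" by (simp add: add_eq_0 add.commute)
  qed
  moreover have "1 + 2 ^ (3 ^ l) < (2 :: nat) ^ ?d"
  proof -
    have "(2 :: nat) ^ 1 \<le> 2 ^ (3 ^ l)" by (intro power_increasing) auto
    then have "1 + 2 ^ (3 ^ l) < 2 * (2 :: nat) ^ (3 ^ l)" by simp
    also have "\<dots> \<le> 2 ^ (3 ^ l) * 2 ^ (3 ^ l)" using \<open>2 ^ 1 \<le> _\<close> by (intro mult_right_mono) auto
    finally show ?thesis by (simp add: mult_2 power_add)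
  qed
  ultimately have rel: "z ^ ?d \<in> ?L" by (auto simp del: power_Suc)
  have "phi z x \<noteq> phi z 0" using assms inj_onD[OF inj, of x 0] by auto
  then have "phi z x ^ (card ?L - 1) = 1"
    by (intro finite_stable_set_power_eq_one phi_image_mult_closed[OF rel])
      (auto intro: image_eqI[of _ _ 0])
  then show ?thesis by (simp add: card_image[OF inj])
qed

end

section \<open>Sums over perfect matchings and hafnians\<close>

text \<open>The edge type is arbitrary and the ends are given by a map, so that one notion covers
  both cells, several of which may join the same two vertices, and plain pairs of vertices.\<close>

definition pm_sets :: "('e \<Rightarrow> nat set) \<Rightarrow> 'e set \<Rightarrow> nat set \<Rightarrow> 'e set set" where
  "pm_sets en E S = {C. C \<subseteq> E \<and> (\<forall>c\<in>C. en c \<subseteq> S) \<and> (\<forall>v\<in>S. \<exists>!c. c \<in> C \<and> v \<in> en c)}"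

definition pm_sum :: "('e \<Rightarrow> nat set) \<Rightarrow> ('e \<Rightarrow> 'a :: comm_ring_1) \<Rightarrow> 'e set \<Rightarrow> nat set \<Rightarrow> 'a" where
  "pm_sum en f E S = (\<Sum>C\<in>pm_sets en E S. \<Prod>c\<in>C. f c)"

lemma finite_pm_sets: "finite E \<Longrightarrow> finite (pm_sets en E S)"
  by (rule finite_subset[of _ "Pow E"]) (auto simp: pm_sets_def)

lemma pm_sets_insert:
  assumes "c \<in> E" "en c \<subseteq> S" "C \<in> pm_sets en E (S - en c)"
  shows "insert c C \<in> pm_sets en E S"
proof -
  have C: "C \<subseteq> E" "\<And>c'. c' \<in> C \<Longrightarrow> en c' \<subseteq> S - en c"
    "\<And>v. v \<in> S - en c \<Longrightarrow> \<exists>!c'. c' \<in> C \<and> v \<in> en c'"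
    using assms(3) unfolding pm_sets_def by auto
  have "\<exists>!c'. c' \<in> insert c C \<and> v \<in> en c'" if v: "v \<in> S" for v
  proof (cases "v \<in> en c")
    case True
    then show ?thesis using C(2) by (intro ex1I[of _ c]) auto
  next
    case False
    then have "\<exists>!c'. c' \<in> C \<and> v \<in> en c'" using C(3) v by simp
    then obtain c' where c': "c' \<in> C \<and> v \<in> en c'" and u: "\<forall>c''. c'' \<in> C \<and> v \<in> en c'' \<longrightarrow> c'' = c'"
      by (rule ex1E)
    show ?thesis
    proof (rule ex1I[of _ c'])
      show "c' \<in> insert c C \<and> v \<in> en c'" using c' by simp
      show "x = c'" if "x \<in> insert c C \<and> v \<in> en x" for x
        using that u False by (metis insertE)
    qed
  qed
  moreover have "insert c C \<subseteq> E" "\<forall>c'\<in>insert c C. en c' \<subseteq> S" using assms(1,2) C(1,2) by blast+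
  ultimately show ?thesis unfolding pm_sets_def by simp
qed

lemma pm_sets_remove:
  assumes "C \<in> pm_sets en E S" "c \<in> C"
  shows "C - {c} \<in> pm_sets en E (S - en c)"
proof -
  have C: "C \<subseteq> E" "\<And>c'. c' \<in> C \<Longrightarrow> en c' \<subseteq> S"
    "\<And>v. v \<in> S \<Longrightarrow> \<exists>!c'. c' \<in> C \<and> v \<in> en c'"
    using assms(1) unfolding pm_sets_def by auto
  have "v \<notin> en c" if "c' \<in> C - {c}" "v \<in> en c'" for c' v
    using C(2)[of c'] C(3)[of v] that assms(2) by auto
  moreover have "\<exists>!c'. c' \<in> C - {c} \<and> v \<in> en c'" if "v \<in> S - en c" for v
  proof -
    have "\<exists>!c'. c' \<in> C \<and> v \<in> en c'" using C(3) that by simp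
    then obtain c' where c': "c' \<in> C \<and> v \<in> en c'" and u: "\<forall>c''. c'' \<in> C \<and> v \<in> en c'' \<longrightarrow> c'' = c'"
      by (rule ex1E)
    show ?thesis
    proof (rule ex1I[of _ c'])
      show "c' \<in> C - {c} \<and> v \<in> en c'" using c' that by blast
      show "x = c'" if "x \<in> C - {c} \<and> v \<in> en x" for x
        using that u by blast
    qed
  qed
  moreover have "C - {c} \<subseteq> E" "\<forall>c'\<in>C - {c}. en c' \<subseteq> S" using C(1,2) by blast+
  ultimately show ?thesis unfolding pm_sets_def by blast
qed

text \<open>Sorts the matchings by the unique edge covering \<open>i\<close>; uniqueness makes
  insertion of that edge a bijection.\<close>

lemma pm_sum_expand:
  assumes E: "finite E" "\<And>c. c \<in> E \<Longrightarrow> en c \<noteq> {}" and i: "i \<in> S"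
  shows "pm_sum en f E S =
    (\<Sum>c\<in>{c\<in>E. i \<in> en c \<and> en c \<subseteq> S}. f c * pm_sum en f E (S - en c))"
proof -
  let ?D = "{c\<in>E. i \<in> en c \<and> en c \<subseteq> S}"
  let ?P = "\<lambda>c. pm_sets en E (S - en c)"
  have notin: "c \<notin> C" if "C \<in> ?P c" "c \<in> ?D" for c C
    using that unfolding pm_sets_def by auto
  have "(\<Sum>c\<in>?D. f c * pm_sum en f E (S - en c)) = (\<Sum>c\<in>?D. \<Sum>C\<in>?P c. \<Prod>c'\<in>insert c C. f c')"
  proof (intro sum.cong refl)
    fix c assume c: "c \<in> ?D"
    have "finite C" if "C \<in> ?P c" for C
      using that E(1) finite_subset unfolding pm_sets_def by blast
    then have "f c * (\<Prod>c'\<in>C. f c') = (\<Prod>c'\<in>insert c C. f c')" if "C \<in> ?P c" for C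
      using that notin[OF that c] by simp
    then show "f c * pm_sum en f E (S - en c) = (\<Sum>C\<in>?P c. \<Prod>c'\<in>insert c C. f c')"
      unfolding pm_sum_def by (simp add: sum_distrib_left)
  qed
  also have "\<dots> = (\<Sum>(c, C)\<in>Sigma ?D ?P. \<Prod>c'\<in>insert c C. f c')"
    by (rule sum.Sigma) (auto simp: E finite_pm_sets)
  also have "\<dots> = (\<Sum>C\<in>pm_sets en E S. \<Prod>c'\<in>C. f c')"
  proof -
    have "bij_betw (\<lambda>p. insert (fst p) (snd p)) (Sigma ?D ?P) (pm_sets en E S)"
    proof (rule bij_betwI')
      fix p q assume "p \<in> Sigma ?D ?P" "q \<in> Sigma ?D ?P"
      then obtain c C c2 C2 where p: "p = (c, C)" "c \<in> ?D" "C \<in> ?P c"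
        and q: "q = (c2, C2)" "c2 \<in> ?D" "C2 \<in> ?P c2" by auto
      have "p = q" if eq: "insert c C = insert c2 C2"
      proof -
        have "insert c C \<in> pm_sets en E S" using p by (intro pm_sets_insert) auto
        then have "\<exists>!c'. c' \<in> insert c C \<and> i \<in> en c'" using i unfolding pm_sets_def by blast
        moreover have "c2 \<in> insert c C" using eq by auto
        ultimately have "c = c2" using p q by auto
        then have "C = C2" using eq notin p q by (metis insert_ident)
        then show ?thesis using p q \<open>c = c2\<close> by simp
      qed
      then show "(insert (fst p) (snd p) = insert (fst q) (snd q)) = (p = q)"
        using p q by auto
    next
      fix p assume "p \<in> Sigma ?D ?P"
      then show "insert (fst p) (snd p) \<in> pm_sets en E S" by (auto intro!: pm_sets_insert)
    next
      fix C assume C: "C \<in> pm_sets en E S"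
      then obtain c where c: "c \<in> C" "i \<in> en c" using i unfolding pm_sets_def by blast
      then have "c \<in> ?D" using C unfolding pm_sets_def by auto
      moreover have "C - {c} \<in> ?P c" by (rule pm_sets_remove[OF C c(1)])
      moreover have "C = insert c (C - {c})" using c by auto
      ultimately show "\<exists>p\<in>Sigma ?D ?P. C = insert (fst p) (snd p)"
        by (intro bexI[of _ "(c, C - {c})"]) simp_all
    qed
    from sum.reindex_bij_betw[OF this, of "\<lambda>C. \<Prod>c'\<in>C. f c'"]
    show ?thesis by (simp add: case_prod_beta')
  qed
  finally show ?thesis unfolding pm_sum_def by simp
qed

lemma pm_sum_empty:
  assumes "\<And>c. c \<in> E \<Longrightarrow> en c \<noteq> {}"
  shows "pm_sum en f E {} = 1"
proof -
  have "pm_sets en E {} = {{}}" using assms by (fastforce simp: pm_sets_def)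
  then show ?thesis by (simp add: pm_sum_def)
qed

text \<open>Choosing one end of every edge is injective because the edges are disjoint. The bound is
  twice the true value and serves both the degree in \<open>y\<close> and the degree in the random
  scalars.\<close>

lemma pm_sets_card_le:
  assumes "C \<in> pm_sets en E S" "finite S" "\<And>c. c \<in> E \<Longrightarrow> en c \<noteq> {}"
  shows "card C \<le> card S"
proof (rule card_inj_on_le)
  have C: "C \<subseteq> E" "\<And>c'. c' \<in> C \<Longrightarrow> en c' \<subseteq> S"
    "\<And>v. v \<in> S \<Longrightarrow> \<exists>!c'. c' \<in> C \<and> v \<in> en c'"
    using assms(1) unfolding pm_sets_def by auto
  have e: "(SOME v. v \<in> en c) \<in> en c" if "c \<in> C" for c
    using assms(3)[of c] C(1) that by (simp add: some_in_eq subset_eq)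
  then show "(\<lambda>c. SOME v. v \<in> en c) ` C \<subseteq> S" using C(2) by blast
  show "inj_on (\<lambda>c. SOME v. v \<in> en c) C"
  proof (rule inj_onI)
    fix c c' assume "c \<in> C" "c' \<in> C" "(SOME v. v \<in> en c) = (SOME v. v \<in> en c')"
    then show "c = c'" using e[of c] e[of c'] C(2)[of c] C(3)[of "SOME v. v \<in> en c"] by auto
  qed
qed fact

text \<open>The bound \<open>n\<close> on the vertices stays fixed while the set \<open>S\<close>
  shrinks during elimination. Only entries above the diagonal are read, so symmetry of
  \<open>B\<close> is a separate assumption wherever rows are used.\<close>

definition hafnian :: "nat \<Rightarrow> (nat \<Rightarrow> nat \<Rightarrow> 'a :: comm_ring_1) \<Rightarrow> nat set \<Rightarrow> 'a" where
  "hafnian n B S = pm_sum (\<lambda>(u, v). {u, v}) (\<lambda>(u, v). B u v) {(u, v). u < v \<and> v < n} S"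

lemma finite_upper_pairs: "finite {(u, v). u < v \<and> v < (n :: nat)}"
  by (rule finite_subset[of _ "{..<n} \<times> {..<n}"]) auto

lemma hafnian_empty [simp]: "hafnian n B {} = 1"
  unfolding hafnian_def by (rule pm_sum_empty) auto

lemma hafnian_expand:
  assumes sym: "\<And>u v. u < n \<Longrightarrow> v < n \<Longrightarrow> B u v = B v u" and S: "S \<subseteq> {..<n}" and i: "i \<in> S"
  shows "hafnian n B S = (\<Sum>l\<in>S - {i}. B i l * hafnian n B (S - {i, l}))"
proof -
  let ?D = "{c \<in> {(u, v). u < v \<and> v < n}. i \<in> (\<lambda>(u, v). {u, v}) c \<and> (\<lambda>(u, v). {u, v}) c \<subseteq> S}"
  have "hafnian n B S = (\<Sum>c\<in>?D. (\<lambda>(u, v). B u v) c * hafnian n B (S - (\<lambda>(u, v). {u, v}) c))"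
    unfolding hafnian_def by (rule pm_sum_expand) (auto simp: finite_upper_pairs i)
  also have "\<dots> = (\<Sum>l\<in>S - {i}. B i l * hafnian n B (S - {i, l}))"
  proof (rule sum.reindex_bij_witness[of _ "\<lambda>l. (min i l, max i l)" "\<lambda>(u, v). if u = i then v else u"])
    fix l assume "l \<in> S - {i}"
    then show "(min i l, max i l) \<in> ?D" using S i by (auto simp: min_def max_def)
  next
    fix c assume c: "c \<in> ?D"
    then show "B i (case c of (u, v) \<Rightarrow> if u = i then v else u) *
        hafnian n B (S - {i, case c of (u, v) \<Rightarrow> if u = i then v else u}) =
      (case c of (u, v) \<Rightarrow> B u v) * hafnian n B (S - (case c of (u, v) \<Rightarrow> {u, v}))"
      using sym by (auto simp: insert_commute)
  qed (auto simp: min_def max_def split: if_splits)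
  finally show ?thesis .
qed

lemma hafnian_cong:
  assumes "\<And>u v. u \<in> S \<Longrightarrow> v \<in> S \<Longrightarrow> B u v = B' u v"
  shows "hafnian n B S = hafnian n B' S"
  unfolding hafnian_def pm_sum_def
proof (intro sum.cong prod.cong refl)
  fix C c assume "C \<in> pm_sets (\<lambda>(u, v). {u, v}) {(u, v). u < v \<and> v < n} S" "c \<in> C"
  then have "(\<lambda>(u, v). {u, v}) c \<subseteq> S" unfolding pm_sets_def by blast
  then show "(case c of (u, v) \<Rightarrow> B u v) = (case c of (u, v) \<Rightarrow> B' u v)"
    by (cases c) (simp add: assms)
qed

text \<open>Edges with the same ends are merged into one matrix entry. Both sides obey the same
  expansion at a vertex, so induction on the size of \<open>S\<close> applies.\<close>

lemma pm_sum_eq_hafnian: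
  assumes E: "finite E" "\<And>c. c \<in> E \<Longrightarrow> card (en c) = 2" and S: "S \<subseteq> {..<n}"
    and B: "\<And>u v. u \<noteq> v \<Longrightarrow> B u v = (\<Sum>c | c \<in> E \<and> en c = {u, v}. f c)"
  shows "pm_sum en f E S = hafnian n B S"
  using S
proof (induction "card S" arbitrary: S rule: less_induct)
  case less
  have ne: "en c \<noteq> {}" if "c \<in> E" for c using E(2)[OF that] by auto
  have fin: "finite S" using finite_subset[OF less.prems] by simp
  define B' where "B' u v = (if u = v then 0 else B u v)" for u v
  have sym: "B' u v = B' v u" for u v using B[of u v] B[of v u] by (simp add: B'_def insert_commute)
  have hB: "hafnian n B T = hafnian n B' T" for T
    unfolding hafnian_def pm_sum_def
  proof (intro sum.cong prod.cong refl)
    fix C c assume "C \<in> pm_sets (\<lambda>(u, v). {u, v}) {(u, v). u < v \<and> v < n} T" "c \<in> C"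
    then have "c \<in> {(u, v). u < v \<and> v < n}" unfolding pm_sets_def by blast
    then show "(case c of (u, v) \<Rightarrow> B u v) = (case c of (u, v) \<Rightarrow> B' u v)"
      by (auto simp: B'_def)
  qed
  show ?case
  proof (cases "S = {}")
    case True
    then show ?thesis using pm_sum_empty[of E en f] ne by simp
  next
    case False
    then obtain i where i: "i \<in> S" by blast
    let ?D = "{c \<in> E. i \<in> en c \<and> en c \<subseteq> S}"
    have other: "\<exists>l. l \<noteq> i \<and> en c = {i, l}" if c: "c \<in> E" "i \<in> en c" for c
    proof -
      obtain x y where "en c = {x, y}" "x \<noteq> y" using E(2)[OF c(1)] unfolding card_2_iff by blast
      then show ?thesis using c(2) by (cases "x = i") (metis insert_commute insertE singletonD)+
    qed
    have "c \<in> ?D \<longleftrightarrow> c \<in> (\<Union>l\<in>S - {i}. {c. c \<in> E \<and> en c = {i, l}})" for c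
    proof
      assume c: "c \<in> ?D"
      then obtain l where l: "l \<noteq> i" "en c = {i, l}" using other by blast
      then have "l \<in> S - {i}" using c by simp
      then show "c \<in> (\<Union>l\<in>S - {i}. {c. c \<in> E \<and> en c = {i, l}})" using c l by blast
    next
      assume "c \<in> (\<Union>l\<in>S - {i}. {c. c \<in> E \<and> en c = {i, l}})"
      then obtain l where "l \<in> S" "c \<in> E" "en c = {i, l}" by blast
      then show "c \<in> ?D" using i by simp
    qed
    then have "?D = (\<Union>l\<in>S - {i}. {c. c \<in> E \<and> en c = {i, l}})" by (rule Set.set_eqI)
    then have "(\<Sum>c\<in>?D. f c * pm_sum en f E (S - en c)) =
      (\<Sum>c\<in>(\<Union>l\<in>S - {i}. {c. c \<in> E \<and> en c = {i, l}}). f c * pm_sum en f E (S - en c))"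
      by (rule arg_cong)
    also have "\<dots> = (\<Sum>l\<in>S - {i}. \<Sum>c | c \<in> E \<and> en c = {i, l}. f c * pm_sum en f E (S - en c))"
    proof (rule sum.UNION_disjoint)
      show "finite (S - {i})" using fin by simp
      show "\<forall>l\<in>S - {i}. finite {c. c \<in> E \<and> en c = {i, l}}" using E(1) by simp
      show "\<forall>l\<in>S - {i}. \<forall>l'\<in>S - {i}. l \<noteq> l' \<longrightarrow>
          {c. c \<in> E \<and> en c = {i, l}} \<inter> {c. c \<in> E \<and> en c = {i, l'}} = {}"
        by (simp add: disjoint_iff doubleton_eq_iff)
    qed
    also have "\<dots> = (\<Sum>l\<in>S - {i}. B' i l * hafnian n B (S - {i, l}))"
    proof (rule sum.cong[OF refl])
      fix l assume l: "l \<in> S - {i}"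
      have "card (S - {i, l}) < card S" using i fin by (intro psubset_card_mono) auto
      then have IH: "pm_sum en f E (S - {i, l}) = hafnian n B (S - {i, l})"
        using less by (meson Diff_subset order_trans)
      have "B' i l = (\<Sum>c | c \<in> E \<and> en c = {i, l}. f c)" using l B[of i l] by (simp add: B'_def)
      then show "(\<Sum>c | c \<in> E \<and> en c = {i, l}. f c * pm_sum en f E (S - en c)) =
         B' i l * hafnian n B (S - {i, l})"
        by (simp add: IH sum_distrib_right)
    qed
    also have "\<dots> = hafnian n B S"
      unfolding hB by (rule hafnian_expand[OF sym less.prems i, symmetric])
    finally have "(\<Sum>c\<in>?D. f c * pm_sum en f E (S - en c)) = hafnian n B S" .
    moreover have "pm_sum en f E S = (\<Sum>c\<in>?D. f c * pm_sum en f E (S - en c))"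
      by (rule pm_sum_expand[OF E(1) ne i])
    ultimately show ?thesis by (rule trans[rotated])
  qed
qed

section \<open>Elimination for hafnians in characteristic 2\<close>

context char_two
begin

text \<open>Analogue of a determinant with two equal rows. A second expansion, at \<open>j\<close>,
  gives a sum over ordered pairs \<open>(l, p)\<close> of distinct vertices whose summand is
  symmetric, so every value occurs twice and cancels.\<close>

lemma hafnian_double_row:
  fixes B :: "nat \<Rightarrow> nat \<Rightarrow> 'a"
  assumes sym: "\<And>u v. B u v = B v u" and diag: "\<And>u. B u u = 0"
    and S: "S \<subseteq> {..<n}" and i: "i \<in> S" and j: "j \<in> S" "i \<noteq> j"
  shows "(\<Sum>l\<in>S - {i}. B j l * hafnian n B (S - {i, l})) = 0"
proof -
  have fin: "finite S" using finite_subset[OF S] by simp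
  let ?T = "S - {i, j}"
  have "(\<Sum>l\<in>S - {i}. B j l * hafnian n B (S - {i, l})) =
      (\<Sum>l\<in>?T. B j l * hafnian n B (S - {i, l}))"
    by (rule sum.mono_neutral_right) (use fin diag in auto)
  also have "\<dots> = (\<Sum>l\<in>?T. \<Sum>p\<in>?T - {l}. B j l * B j p * hafnian n B (?T - {l, p}))"
  proof (rule sum.cong[OF refl])
    fix l assume l: "l \<in> ?T"
    have "hafnian n B (S - {i, l}) = (\<Sum>p\<in>S - {i, l} - {j}. B j p * hafnian n B (S - {i, l} - {j, p}))"
      by (rule hafnian_expand) (use S l j in \<open>auto intro: sym\<close>)
    moreover have "S - {i, l} - {j} = ?T - {l}" "S - {i, l} - {j, p} = ?T - {l, p}" for p by auto
    ultimately show "B j l * hafnian n B (S - {i, l}) =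
        (\<Sum>p\<in>?T - {l}. B j l * B j p * hafnian n B (?T - {l, p}))"
      by (simp add: sum_distrib_left mult.assoc)
  qed
  also have "\<dots> = (\<Sum>(l, p)\<in>Sigma ?T (\<lambda>l. ?T - {l}). B j l * B j p * hafnian n B (?T - {l, p}))"
    by (rule sum.Sigma) (use fin in auto)
  also have "\<dots> = (\<Sum>q\<in>{q \<in> ?T \<times> ?T. fst q < snd q}. B j (fst q) * B j (snd q) * hafnian n B (?T - {fst q, snd q}))
     + (\<Sum>q\<in>{q \<in> ?T \<times> ?T. snd q < fst q}. B j (fst q) * B j (snd q) * hafnian n B (?T - {fst q, snd q}))"
    by (subst sum.union_disjoint[symmetric])
      (use fin in \<open>auto simp: case_prod_beta intro!: sum.cong\<close>)
  also have "(\<Sum>q\<in>{q \<in> ?T \<times> ?T. snd q < fst q}. B j (fst q) * B j (snd q) * hafnian n B (?T - {fst q, snd q})) =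
     (\<Sum>q\<in>{q \<in> ?T \<times> ?T. fst q < snd q}. B j (fst q) * B j (snd q) * hafnian n B (?T - {fst q, snd q}))"
    by (rule sum.reindex_bij_witness[of _ prod.swap prod.swap]) (auto simp: insert_commute mult.commute)
  finally show ?thesis by simp
qed

text \<open>Row \<open>i\<close> enters the expansion linearly, and the added multiple of row
  \<open>j\<close> contributes a hafnian with a repeated row, which is 0.\<close>

lemma hafnian_row_operation:
  fixes B :: "nat \<Rightarrow> nat \<Rightarrow> 'a"
  assumes sym: "\<And>u v. B u v = B v u" and diag: "\<And>u. B u u = 0"
    and S: "S \<subseteq> {..<n}" and i: "i \<in> S" and j: "j \<in> S" "i \<noteq> j"
    and B': "\<And>u v. B' u v = B' v u" "\<And>l. l \<noteq> i \<Longrightarrow> B' i l = B i l + c * B j l"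
      "\<And>u v. u \<noteq> i \<Longrightarrow> v \<noteq> i \<Longrightarrow> B' u v = B u v"
  shows "hafnian n B' S = hafnian n B S"
proof -
  have "hafnian n B' S = (\<Sum>l\<in>S - {i}. B' i l * hafnian n B' (S - {i, l}))"
    by (rule hafnian_expand) (use S i in \<open>auto intro: B'(1)\<close>)
  also have "\<dots> = (\<Sum>l\<in>S - {i}. (B i l + c * B j l) * hafnian n B (S - {i, l}))"
    by (intro sum.cong refl arg_cong2[where f = times] hafnian_cong) (auto simp: B'(2,3))
  also have "\<dots> = (\<Sum>l\<in>S - {i}. B i l * hafnian n B (S - {i, l})) +
      c * (\<Sum>l\<in>S - {i}. B j l * hafnian n B (S - {i, l}))"
    by (simp add: distrib_right sum.distrib sum_distrib_left mult.assoc)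
  also have "\<dots> = hafnian n B S"
  proof -
    have "(\<Sum>l\<in>S - {i}. B j l * hafnian n B (S - {i, l})) = 0"
      by (rule hafnian_double_row[where B = B]) (fact sym diag S i j)+
    moreover have "hafnian n B S = (\<Sum>l\<in>S - {i}. B i l * hafnian n B (S - {i, l}))"
      by (rule hafnian_expand) (rule sym S i)+
    ultimately show ?thesis by simp
  qed
  finally show ?thesis .
qed

text \<open>One pivot step on \<open>(k, j)\<close>: adding suitable multiples of row and column
  \<open>j\<close> to all other rows and columns leaves in row \<open>k\<close> only the entry at
  \<open>j\<close>, and expanding along that row removes both vertices.\<close>

lemma hafnian_eliminate:
  fixes B :: "nat \<Rightarrow> nat \<Rightarrow> 'a"
  assumes sym: "\<And>u v. B u v = B v u" and diag: "\<And>u. B u u = 0"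
    and S: "S \<subseteq> {..<n}" and k: "k \<in> S" and j: "j \<in> S" and pivot: "B k j \<noteq> 0"
    and c: "\<And>i. c i = B k i / B k j"
  shows "hafnian n B S =
    B k j * hafnian n (\<lambda>u v. B u v + c u * B j v + c v * B j u) (S - {k, j})"
proof -
  have kj: "k \<noteq> j" using pivot diag by auto
  define D where "D T u v = B u v + (if u \<in> T then c u * B j v else 0) + (if v \<in> T then c v * B u j else 0)"
    for T u v
  have D: "D T u v = D T v u" "D T u u = 0" for T u v
    using sym[of u v] sym[of u j] sym[of v j] by (simp_all add: D_def diag ac_simps)
  have fin: "finite (S - {k, j})" using finite_subset[OF S] by simp
  have *: "hafnian n (D T) S = hafnian n B S" if "T \<subseteq> S - {k, j}" "finite T" for T
    using that(2,1)
  proof induction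
    case empty
    show ?case by (simp add: D_def)
  next
    case (insert i T)
    have "hafnian n (D (insert i T)) S = hafnian n (D T) S"
      by (rule hafnian_row_operation[where i = i and j = j and c = "c i"])
        (use insert.hyps insert.prems S j in \<open>auto intro: D(1) simp: D(2), auto simp: D_def diag sym[of j]\<close>)
    then show ?case using insert by simp
  qed
  let ?T = "S - {k, j}"
  have "hafnian n B S = hafnian n (D ?T) S" using *[of ?T] fin by simp
  also have "\<dots> = (\<Sum>l\<in>S - {k}. D ?T k l * hafnian n (D ?T) (S - {k, l}))"
    by (rule hafnian_expand) (use S k in \<open>auto intro: D(1)\<close>)
  \<comment> \<open>For \<open>l\<close> in \<open>S - {k, j}\<close> the new entry is
    \<open>B k l + B k l / B k j * B k j\<close>, which is 0 in characteristic 2.\<close>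
  also have "\<dots> = (\<Sum>l\<in>{j}. D ?T k l * hafnian n (D ?T) (S - {k, l}))"
    by (rule sum.mono_neutral_right)
      (use finite_subset[OF S] j kj pivot in \<open>auto simp: D_def c\<close>)
  also have "\<dots> = B k j * hafnian n (D ?T) ?T" by (simp add: D_def)
  also have "hafnian n (D ?T) ?T = hafnian n (\<lambda>u v. B u v + c u * B j v + c v * B j u) ?T"
  proof (rule hafnian_cong)
    fix u v assume "u \<in> ?T" "v \<in> ?T"
    then show "D ?T u v = B u v + c u * B j v + c v * B j u" using sym[of u j] by (simp add: D_def)
  qed
  finally show ?thesis .
qed

end

section \<open>Linearized vanishing polynomials and coefficient extraction\<close>

text \<open>Coefficient of \<open>x ^ 2 ^ j\<close> in the monic polynomial that vanishes on the
  span of \<open>1, z, ..., z ^ (i - 1)\<close>. The recurrence turns \<open>V x\<close> into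
  \<open>(V x) ^ 2 + V (z ^ i) * V x\<close>, which adds \<open>z ^ i\<close> to the roots; squaring
  shifts the index by one.\<close>

fun subspace_coeff :: "'a :: comm_ring_1 \<Rightarrow> nat \<Rightarrow> nat \<Rightarrow> 'a" where
  "subspace_coeff z 0 j = (if j = 0 then 1 else 0)"
| "subspace_coeff z (Suc i) j = (if j = 0 then 0 else (subspace_coeff z i (j - 1))\<^sup>2) +
     (\<Sum>k\<le>i. subspace_coeff z i k * (z ^ i) ^ (2 ^ k)) * subspace_coeff z i j"

definition subspace_poly :: "'a :: comm_ring_1 \<Rightarrow> nat \<Rightarrow> 'a \<Rightarrow> 'a" where
  "subspace_poly z i x = (\<Sum>k\<le>i. subspace_coeff z i k * x ^ (2 ^ k))"

text \<open>Coefficient of \<open>y ^ t\<close> in the quotient of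
  \<open>subspace_poly z e y - subspace_poly z e a\<close> by \<open>y - a\<close>; each monomial
  \<open>y ^ 2 ^ j\<close> contributes one term of a geometric sum. Up to a common factor it is a
  coefficient of a Lagrange basis polynomial.\<close>

definition dual_weight :: "'a :: comm_ring_1 \<Rightarrow> nat \<Rightarrow> nat \<Rightarrow> 'a \<Rightarrow> 'a" where
  "dual_weight z e t a = (\<Sum>j\<le>e. if t < 2 ^ j then subspace_coeff z e j * a ^ (2 ^ j - 1 - t) else 0)"

lemma subspace_coeff_eq_0: "i < j \<Longrightarrow> subspace_coeff z i j = 0"
  by (induction i arbitrary: j) auto

lemma subspace_coeff_top: "subspace_coeff z i i = 1"
  by (induction i) (auto simp: subspace_coeff_eq_0)

lemma subspace_poly_0 [simp]: "subspace_poly z 0 x = x"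
  by (simp add: subspace_poly_def)

context char_two
begin

lemma add_square: "(x + y)\<^sup>2 = x\<^sup>2 + (y :: 'a)\<^sup>2"
  by (simp add: power2_sum)

lemma sum_square: "(\<Sum>k\<in>A. f k)\<^sup>2 = (\<Sum>k\<in>A. (f k :: 'a)\<^sup>2)"
  by (induction A rule: infinite_finite_induct) (auto simp: add_square)

lemma subspace_poly_Suc:
  "subspace_poly z (Suc i) x = (subspace_poly z i x)\<^sup>2 + subspace_poly z i (z ^ i) * subspace_poly z i x"
proof -
  have "(\<Sum>j\<le>Suc i. (if j = 0 then 0 else (subspace_coeff z i (j - 1))\<^sup>2) * x ^ (2 ^ j)) =
     (\<Sum>k\<le>i. (subspace_coeff z i k * x ^ (2 ^ k))\<^sup>2)"
    unfolding sum.atMost_Suc_shift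
    by (auto simp: power_mult_distrib mult.commute simp flip: power_mult intro!: sum.cong)
  moreover have "(\<Sum>j\<le>Suc i. subspace_coeff z i j * x ^ (2 ^ j)) = subspace_poly z i x"
    by (simp add: subspace_poly_def subspace_coeff_eq_0)
  ultimately show ?thesis
    unfolding subspace_poly_def[of z "Suc i"]
    by (simp only: subspace_coeff.simps distrib_right sum.distrib sum_square subspace_poly_def
        mult.assoc sum_distrib_left[symmetric])
qed

lemma subspace_poly_add: "subspace_poly z i (x + y) = subspace_poly z i x + subspace_poly z i y"
  by (induction i) (simp_all add: subspace_poly_Suc add_square algebra_simps)

lemma subspace_poly_basis: "subspace_poly z (Suc i) (z ^ i) = 0"
  by (simp add: subspace_poly_Suc power2_eq_square)

lemma subspace_poly_phi:
  "w < 2 ^ e \<Longrightarrow> subspace_poly z e (phi z w) = 0"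
proof (induction e arbitrary: w)
  case (Suc e)
  show ?case
  proof (cases "w < 2 ^ e")
    case True
    then show ?thesis by (simp add: subspace_poly_Suc Suc)
  next
    case False
    define r where "r = w - 2 ^ e"
    have r: "r < 2 ^ e" "w = r + 2 ^ e * 1" using Suc.prems False by (auto simp: r_def)
    have "phi z w = phi z r + z ^ e" using phi_add_high[OF r(1), of z 1] r(2) by simp
    then show ?thesis
      by (simp only: subspace_poly_add subspace_poly_basis) (simp add: subspace_poly_Suc Suc.IH[OF r(1)])
  qed
qed simp

text \<open>A nonzero polynomial of degree at most \<open>2 ^ i\<close> already has the values of
  all \<open>i\<close>-bit words as roots, and these are distinct, so \<open>z ^ i\<close> cannot be
  one more.\<close>

lemma subspace_poly_basis_neq_0:
  assumes inj: "inj_on (phi z) {..<2 ^ d}" and i: "i < d"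
  shows "subspace_poly z i (z ^ i) \<noteq> 0"
proof
  assume 0: "subspace_poly z i (z ^ i) = 0"
  define p where "p = (\<Sum>k\<le>i. Polynomial.monom (subspace_coeff z i k) (2 ^ k))"
  have p: "poly p x = subspace_poly z i x" for x
    by (simp add: p_def subspace_poly_def poly_sum poly_monom)
  have "Polynomial.coeff p (2 ^ i) = (\<Sum>k\<le>i. if k = i then 1 else 0)"
    unfolding p_def coeff_sum by (intro sum.cong) (auto simp: subspace_coeff_top)
  then have nz: "p \<noteq> 0" by auto
  have "Polynomial.degree p \<le> 2 ^ i"
    unfolding p_def by (intro degree_sum_le) (auto intro: order_trans[OF degree_monom_le])
  then have "card {x. poly p x = 0} \<le> 2 ^ i" using card_poly_roots_bound[OF nz] by linarith
  moreover have "phi z ` {..2 ^ i} \<subseteq> {x. poly p x = 0}"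
    using 0 by (auto simp: p subspace_poly_phi phi_power_two order_le_less)
  then have "card (phi z ` {..2 ^ i}) \<le> card {x. poly p x = 0}"
    by (intro card_mono poly_roots_finite nz)
  moreover have "{..2 ^ i} \<subseteq> {..<(2 :: nat) ^ d}" using i by (auto intro: le_less_trans)
  then have "card (phi z ` {..2 ^ i}) = Suc (2 ^ i)"
    by (simp add: card_image inj_on_subset[OF inj])
  ultimately show False by simp
qed

text \<open>The recurrence multiplies this coefficient by the nonzero
  \<open>subspace_poly z e (z ^ e)\<close>. It is the derivative of the vanishing polynomial and the
  factor by which the extracted coefficient is scaled.\<close>

lemma subspace_coeff_0_neq_0:
  assumes inj: "inj_on (phi z) {..<2 ^ d}"
  shows "e \<le> d \<Longrightarrow> subspace_coeff z e 0 \<noteq> 0"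
proof (induction e)
  case (Suc e)
  then show ?case using subspace_poly_basis_neq_0[OF inj, of e] by (simp add: subspace_poly_def)
qed simp

text \<open>The quotient of differences off the diagonal, and on the diagonal its limit, the
  derivative. The derivative is the same constant at every point, which makes the weights
  uniform.\<close>

lemma dual_weight_sum:
  "(x + a) * (\<Sum>t<2 ^ e. dual_weight z e t a * x ^ t) = subspace_poly z e x + subspace_poly z e a"
  "(\<Sum>t<2 ^ e. dual_weight z e t a * a ^ t) = subspace_coeff z e 0"
proof -
  have *: "(\<Sum>t<2 ^ e. dual_weight z e t a * x ^ t) =
      (\<Sum>j\<le>e. subspace_coeff z e j * (\<Sum>t<2 ^ j. a ^ (2 ^ j - Suc t) * x ^ t))" for x
  proof -
    have "(\<Sum>t<2 ^ e. dual_weight z e t a * x ^ t) = (\<Sum>j\<le>e. \<Sum>t<2 ^ e.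
        (if t < 2 ^ j then subspace_coeff z e j * a ^ (2 ^ j - 1 - t) else 0) * x ^ t)"
      unfolding dual_weight_def sum_distrib_right by (rule sum.swap)
    also have "\<dots> = (\<Sum>j\<le>e. subspace_coeff z e j * (\<Sum>t<2 ^ j. a ^ (2 ^ j - Suc t) * x ^ t))"
    proof (rule sum.cong[OF refl])
      fix j assume "j \<in> {..e}"
      then have "(2 :: nat) ^ j \<le> 2 ^ e" by (simp add: power_increasing)
      then have "(\<Sum>t<2 ^ e. (if t < 2 ^ j then subspace_coeff z e j * a ^ (2 ^ j - 1 - t) else 0) * x ^ t) =
         (\<Sum>t<2 ^ j. (if t < 2 ^ j then subspace_coeff z e j * a ^ (2 ^ j - 1 - t) else 0) * x ^ t)"
        by (intro sum.mono_neutral_right) auto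
      then show "(\<Sum>t<2 ^ e. (if t < 2 ^ j then subspace_coeff z e j * a ^ (2 ^ j - 1 - t) else 0) * x ^ t) =
         subspace_coeff z e j * (\<Sum>t<2 ^ j. a ^ (2 ^ j - Suc t) * x ^ t)"
        by (simp add: sum_distrib_left mult.assoc)
    qed
    finally show ?thesis .
  qed
  have "(x + a) * (\<Sum>t<2 ^ e. dual_weight z e t a * x ^ t) =
     (\<Sum>j\<le>e. subspace_coeff z e j * (x ^ 2 ^ j - a ^ 2 ^ j))"
    unfolding * power_diff_sumr2 by (simp add: sum_distrib_left ac_simps)
  then show "(x + a) * (\<Sum>t<2 ^ e. dual_weight z e t a * x ^ t) = subspace_poly z e x + subspace_poly z e a"
    by (simp add: subspace_poly_def distrib_left sum.distrib)
  \<comment> \<open>All \<open>2 ^ j\<close> summands are equal, so the sum is 0 unless there is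
    only one of them.\<close>
  have diag: "(\<Sum>t<2 ^ j. a ^ (2 ^ j - Suc t) * a ^ t) = (if j = 0 then 1 else 0)" for j
  proof -
    have "(\<Sum>t<2 ^ j. a ^ (2 ^ j - Suc t) * a ^ t) = (\<Sum>t<(2 :: nat) ^ j. a ^ (2 ^ j - 1))"
      by (intro sum.cong) (auto simp flip: power_add)
    also have "\<dots> = of_nat (2 ^ j) * a ^ (2 ^ j - 1)" by simp
    also have "\<dots> = (if j = 0 then 1 else 0)" by simp
    finally show ?thesis .
  qed
  show "(\<Sum>t<2 ^ e. dual_weight z e t a * a ^ t) = subspace_coeff z e 0"
    unfolding * diag by (simp add: if_distrib cong: if_cong)
qed

text \<open>Lagrange interpolation at the \<open>2 ^ e\<close> points with denominators cleared:
  \<open>R a\<close> takes the value \<open>subspace_coeff z e 0\<close> at \<open>a\<close> and 0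
  at the other points, so the combination \<open>F\<close> agrees with a multiple of
  \<open>f\<close> at more points than the degree allows to differ.\<close>

lemma coefficient_from_subspace_values:
  assumes inj: "inj_on (phi z) {..<2 ^ e}"
    and f: "Polynomial.degree f < 2 ^ e" and t: "t < 2 ^ e"
  shows "(\<Sum>w<2 ^ e. poly f (phi z w) * dual_weight z e t (phi z w)) =
    subspace_coeff z e 0 * Polynomial.coeff f t"
proof -
  define R where "R a = (\<Sum>t<2 ^ e. Polynomial.monom (dual_weight z e t a) t)" for a
  have R: "poly (R a) x = (\<Sum>t<2 ^ e. dual_weight z e t a * x ^ t)" for a x
    by (simp add: R_def poly_sum poly_monom)
  define F where "F = (\<Sum>w<2 ^ e. Polynomial.smult (poly f (phi z w)) (R (phi z w)))"
  have dR: "Polynomial.degree (R a) < 2 ^ e" for a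
  proof -
    have "Polynomial.degree (R a) \<le> 2 ^ e - 1"
      unfolding R_def by (intro degree_sum_le) (auto intro!: order_trans[OF degree_monom_le])
    then show ?thesis by (simp add: le_less_trans)
  qed
  have Rv: "poly (R (phi z w)) (phi z v) = (if v = w then subspace_coeff z e 0 else 0)"
    if "w < 2 ^ e" "v < 2 ^ e" for w v
  proof (cases "v = w")
    case True
    then show ?thesis by (simp add: R dual_weight_sum(2))
  next
    case False
    then have "phi z v + phi z w \<noteq> 0" using inj_onD[OF inj, of v w] that by (auto simp: add_eq_0)
    moreover have "(phi z v + phi z w) * poly (R (phi z w)) (phi z v) = 0"
      by (simp add: R dual_weight_sum(1) subspace_poly_phi that)
    ultimately show ?thesis using False by simp
  qed
  have "F = Polynomial.smult (subspace_coeff z e 0) f"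
  proof (rule poly_eqI_degree)
    fix x assume "x \<in> phi z ` {..<2 ^ e}"
    then obtain v where v: "v < 2 ^ e" "x = phi z v" by auto
    have "poly F x = (\<Sum>w<2 ^ e. poly f (phi z w) * (if v = w then subspace_coeff z e 0 else 0))"
      unfolding F_def poly_sum v(2) by (intro sum.cong) (auto simp: Rv v(1))
    also have "\<dots> = poly (Polynomial.smult (subspace_coeff z e 0) f) x"
      using v by (simp add: if_distrib mult.commute cong: if_cong)
    finally show "poly F x = poly (Polynomial.smult (subspace_coeff z e 0) f) x" .
  next
    have c: "card (phi z ` {..<2 ^ e}) = 2 ^ e" by (simp add: card_image inj)
    have "Polynomial.degree F \<le> 2 ^ e - 1"
      unfolding F_def
    proof (intro degree_sum_le)
      fix w :: nat
      show "Polynomial.degree (Polynomial.smult (poly f (phi z w)) (R (phi z w))) \<le> 2 ^ e - 1"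
        using dR[of "phi z w"] degree_smult_le[of "poly f (phi z w)" "R (phi z w)"] by linarith
    qed simp
    then show "Polynomial.degree F < card (phi z ` {..<2 ^ e})"
      unfolding c by (simp add: le_less_trans)
    show "Polynomial.degree (Polynomial.smult (subspace_coeff z e 0) f) < card (phi z ` {..<2 ^ e})"
      unfolding c using f degree_smult_le le_less_trans by blast
  qed
  moreover have "Polynomial.coeff (R a) t = dual_weight z e t a" for a
    using t by (simp add: R_def coeff_sum)
  then have "Polynomial.coeff F t = (\<Sum>w<2 ^ e. poly f (phi z w) * dual_weight z e t (phi z w))"
    by (simp add: F_def coeff_sum)
  ultimately show ?thesis by simp
qed

end

section \<open>Zeros of multilinear polynomials\<close>

text \<open>A set of sets of indices is a polynomial whose monomials are squarefree with coefficient
  1; it is nonzero as a polynomial iff \<open>F \<noteq> {}\<close>.\<close>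

definition multilinear :: "(nat \<Rightarrow> 'a :: field) \<Rightarrow> nat set set \<Rightarrow> nat list \<Rightarrow> 'a" where
  "multilinear val F xs = (\<Sum>C\<in>F. \<Prod>c\<in>C. val (xs ! c))"

definition word_lists :: "nat \<Rightarrow> nat \<Rightarrow> nat list set" where
  "word_lists N L = {xs. set xs \<subseteq> {..<N} \<and> length xs = L}"

lemma finite_word_lists [simp]: "finite (word_lists N L)"
  unfolding word_lists_def by (rule finite_lists_length_eq) simp

lemma card_word_lists: "card (word_lists N L) = N ^ L"
  unfolding word_lists_def by (subst card_lists_length_eq) simp_all

lemma word_lists_Suc: "word_lists N (Suc L) = (\<lambda>(xs, x). xs @ [x]) ` (word_lists N L \<times> {..<N})"
proof (intro equalityI subsetI)
  fix ys assume "ys \<in> word_lists N (Suc L)"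
  then have ys: "set ys \<subseteq> {..<N}" "length ys = Suc L" by (simp_all add: word_lists_def)
  then obtain xs x where "ys = xs @ [x]" by (cases ys rule: rev_cases) simp_all
  then show "ys \<in> (\<lambda>(xs, x). xs @ [x]) ` (word_lists N L \<times> {..<N})"
    using ys by (intro image_eqI[of _ _ "(xs, x)"]) (simp_all add: word_lists_def)
qed (auto simp: word_lists_def)

lemma multilinear_snoc:
  assumes F: "finite F" "F \<subseteq> Pow {..<Suc L}" and xs: "length xs = L"
  shows "multilinear val F (xs @ [x]) =
    multilinear val {C \<in> F. L \<notin> C} xs + val x * multilinear val ((\<lambda>C. C - {L}) ` {C \<in> F. L \<in> C}) xs"
proof -
  have nth: "(xs @ [x]) ! c = xs ! c" if "C \<in> F" "c \<in> C" "c \<noteq> L" for C c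
  proof -
    have "c < Suc L" using F that by blast
    then show ?thesis using that xs by (simp add: nth_append)
  qed
  have "multilinear val F (xs @ [x]) = multilinear val {C \<in> F. L \<notin> C} (xs @ [x]) + multilinear val {C \<in> F. L \<in> C} (xs @ [x])"
    unfolding multilinear_def using F(1)
    by (subst sum.union_disjoint[symmetric]) (auto intro!: sum.cong)
  also have "multilinear val {C \<in> F. L \<notin> C} (xs @ [x]) = multilinear val {C \<in> F. L \<notin> C} xs"
    unfolding multilinear_def using nth by (intro sum.cong prod.cong refl arg_cong[of _ _ val]) auto
  also have "multilinear val {C \<in> F. L \<in> C} (xs @ [x]) =
      (\<Sum>C\<in>{C \<in> F. L \<in> C}. val x * (\<Prod>c\<in>C - {L}. val (xs ! c)))"
    unfolding multilinear_def
  proof (rule sum.cong[OF refl])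
    fix C assume C: "C \<in> {C \<in> F. L \<in> C}"
    then have "finite C" using F finite_subset by blast
    then have "(\<Prod>c\<in>C. val ((xs @ [x]) ! c)) = val ((xs @ [x]) ! L) * (\<Prod>c\<in>C - {L}. val ((xs @ [x]) ! c))"
      using C by (intro prod.remove) auto
    also have "(\<Prod>c\<in>C - {L}. val ((xs @ [x]) ! c)) = (\<Prod>c\<in>C - {L}. val (xs ! c))"
      using nth C by (intro prod.cong refl arg_cong[of _ _ val]) auto
    finally show "(\<Prod>c\<in>C. val ((xs @ [x]) ! c)) = val x * (\<Prod>c\<in>C - {L}. val (xs ! c))"
      using xs by (simp add: nth_append)
  qed
  also have "\<dots> = val x * multilinear val ((\<lambda>C. C - {L}) ` {C \<in> F. L \<in> C}) xs"
    unfolding multilinear_def sum_distrib_left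
    by (subst sum.reindex) (auto simp: inj_on_def)
  finally show ?thesis .
qed

text \<open>Induction on the number of variables. If the last variable occurs, its coefficient
  \<open>F1\<close> has degree at most \<open>D - 1\<close>; either it vanishes, which the induction
  hypothesis makes rare, or exactly one field element solves the linear equation. Counting
  multiplied by \<open>N\<close> keeps the bound in the natural numbers.\<close>

lemma schwartz_zippel_multilinear:
  fixes val :: "nat \<Rightarrow> 'a :: field"
  assumes inj: "inj_on val {..<N}"
    and "F \<noteq> {}" "F \<subseteq> Pow {..<L}" "\<And>C. C \<in> F \<Longrightarrow> card C \<le> D"
  shows "card {xs \<in> word_lists N L. multilinear val F xs = 0} * N \<le> D * N ^ L"
  using assms(2-)
proof (induction L arbitrary: F D)
  case 0
  then have "F = {{}}" by auto
  then show ?case by (simp add: multilinear_def)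
next
  case (Suc L)
  have finF: "finite F" using Suc.prems(2) finite_subset by (metis finite_Pow_iff finite_lessThan)
  define F0 where "F0 = {C \<in> F. L \<notin> C}"
  define F1 where "F1 = (\<lambda>C. C - {L}) ` {C \<in> F. L \<in> C}"
  let ?W = "word_lists N L"
  let ?bad = "{ys \<in> word_lists N (Suc L). multilinear val F ys = 0}"
  have snoc: "multilinear val F (xs @ [x]) = multilinear val F0 xs + val x * multilinear val F1 xs"
    if "xs \<in> ?W" for xs x
    unfolding F0_def F1_def by (rule multilinear_snoc[OF finF Suc.prems(2)]) (use that in \<open>simp add: word_lists_def\<close>)
  have sub0: "F0 \<subseteq> Pow {..<L}" and sub1: "F1 \<subseteq> Pow {..<L}"
    using Suc.prems(2) unfolding F0_def F1_def by (auto simp: less_Suc_eq subset_eq)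
  show ?case
  proof (cases "F1 = {}")
    case True
    then have "F0 \<noteq> {}" using Suc.prems(1) by (auto simp: F0_def F1_def)
    then have IH: "card {xs \<in> ?W. multilinear val F0 xs = 0} * N \<le> D * N ^ L"
      using \<open>F0 \<noteq> {}\<close> Suc.prems(3) by (intro Suc.IH sub0) (auto simp: F0_def)
    have "?bad \<subseteq> (\<lambda>(xs, x). xs @ [x]) ` ({xs \<in> ?W. multilinear val F0 xs = 0} \<times> {..<N})"
    proof
      fix ys assume "ys \<in> ?bad"
      then obtain xs x where "xs \<in> ?W" "x < N" "ys = xs @ [x]" "multilinear val F (xs @ [x]) = 0"
        unfolding word_lists_Suc by auto
      moreover from this have "multilinear val F0 xs = 0"
        using snoc[of xs x] unfolding True by (simp add: multilinear_def)
      ultimately show "ys \<in> (\<lambda>(xs, x). xs @ [x]) ` ({xs \<in> ?W. multilinear val F0 xs = 0} \<times> {..<N})"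
        by (intro image_eqI[of _ _ "(xs, x)"]) auto
    qed
    then have "card ?bad \<le> card ({xs \<in> ?W. multilinear val F0 xs = 0} \<times> {..<N})"
      by (rule surj_card_le[rotated]) simp
    also have "\<dots> = card {xs \<in> ?W. multilinear val F0 xs = 0} * N" by (simp add: card_cartesian_product)
    finally have "card ?bad * N \<le> (D * N ^ L) * N" using IH by (intro mult_right_mono) auto
    then show ?thesis by (simp add: ac_simps)
  next
    case False
    then obtain C where C: "C \<in> F" "L \<in> C" by (auto simp: F1_def)
    have "finite C" using C Suc.prems(2) finite_subset by blast
    then have "D > 0" using Suc.prems(3)[OF C(1)] C(2) by (metis card_gt_0_iff empty_iff gr_zeroI le_zero_eq less_le_not_le)
    have fin: "finite C" if "C \<in> F" for C using that Suc.prems(2) finite_subset by blast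
    have IH: "card {xs \<in> ?W. multilinear val F1 xs = 0} * N \<le> (D - 1) * N ^ L"
    proof (intro Suc.IH sub1 False)
      fix C assume "C \<in> F1"
      then obtain C' where C': "C' \<in> F" "L \<in> C'" "C = C' - {L}" by (auto simp: F1_def)
      then have "card C' = Suc (card C)" using fin[OF C'(1)] by (metis card_Suc_Diff1)
      then show "card C \<le> D - 1" using Suc.prems(3)[OF C'(1)] by simp
    qed
    \<comment> \<open>The only last word that can make the polynomial vanish when \<open>F1\<close>
      does not; the bad lists of this kind number at most one per prefix.\<close>
    let ?r = "\<lambda>xs. THE x. x < N \<and> multilinear val F (xs @ [x]) = 0"
    have sub: "?bad \<subseteq> (\<lambda>(xs, x). xs @ [x]) ` ({xs \<in> ?W. multilinear val F1 xs = 0} \<times> {..<N}) \<union> (\<lambda>xs. xs @ [?r xs]) ` ?W"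
    proof
      fix ys assume "ys \<in> ?bad"
      then obtain xs x where ys: "xs \<in> ?W" "x < N" "ys = xs @ [x]" "multilinear val F (xs @ [x]) = 0"
        unfolding word_lists_Suc by auto
      show "ys \<in> (\<lambda>(xs, x). xs @ [x]) ` ({xs \<in> ?W. multilinear val F1 xs = 0} \<times> {..<N}) \<union> (\<lambda>xs. xs @ [?r xs]) ` ?W"
      proof (cases "multilinear val F1 xs = 0")
        case True
        then show ?thesis using ys by (intro UnI1 image_eqI[of _ _ "(xs, x)"]) simp_all
      next
        case nz: False
        have "?r xs = x"
        proof (rule the_equality)
          fix y assume y: "y < N \<and> multilinear val F (xs @ [y]) = 0"
          then have "val y * multilinear val F1 xs = val x * multilinear val F1 xs"
            using snoc[OF ys(1), of x] snoc[OF ys(1), of y] ys(4) by (metis add_left_cancel)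
          then have "val y = val x" using nz by simp
          then show "y = x" using inj_onD[OF inj] y ys(2) by (metis lessThan_iff)
        qed (use ys in simp)
        then show ?thesis using ys by (intro UnI2 image_eqI[of _ _ xs]) simp_all
      qed
    qed
    have "card ?bad \<le> card ((\<lambda>(xs, x). xs @ [x]) ` ({xs \<in> ?W. multilinear val F1 xs = 0} \<times> {..<N})) + card ((\<lambda>xs. xs @ [?r xs]) ` ?W)"
      by (rule order_trans[OF card_mono[OF _ sub] card_Un_le]) simp
    also have "\<dots> \<le> card ({xs \<in> ?W. multilinear val F1 xs = 0} \<times> {..<N}) + card ?W"
      by (intro add_mono card_image_le) simp_all
    also have "\<dots> \<le> (D - 1) * N ^ L + N ^ L" using IH by (simp add: card_cartesian_product card_word_lists)
    also have "\<dots> = D * N ^ L" using \<open>D > 0\<close> by (cases D) simp_all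
    finally have "card ?bad * N \<le> (D * N ^ L) * N" by (intro mult_right_mono) auto
    then show ?thesis by (simp add: ac_simps)
  qed
qed

section \<open>Program execution with step counts\<close>

text \<open>Big-step semantics of the programs without coins, with the exact number of small steps.
  Sequencing costs one step to discard \<open>Skip\<close>; a round of a loop costs one more to
  unfold the loop.\<close>

inductive exec :: "nat \<Rightarrow> program \<Rightarrow> ram_state \<Rightarrow> ram_state \<Rightarrow> nat \<Rightarrow> bool" for b where
  "exec b Skip s s 0"
| "exec b (Arith r f p q) s (set_reg r (arith_val b f (operand_val b p s) (operand_val b q s)) s) (Suc 0)"
| "exec b (Load r p) s (set_reg r (mem s (operand_val b p s)) s) (Suc 0)"
| "exec b (Store p q) s (set_mem (operand_val b p s) (operand_val b q s) s) (Suc 0)"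
| "exec b P s s1 n1 \<Longrightarrow> exec b Q s1 s2 n2 \<Longrightarrow> exec b (Seq P Q) s s2 (Suc (n1 + n2))"
| "cond_val b c s \<Longrightarrow> exec b P s s' n \<Longrightarrow> exec b (Cond c P Q) s s' (Suc n)"
| "\<not> cond_val b c s \<Longrightarrow> exec b Q s s' n \<Longrightarrow> exec b (Cond c P Q) s s' (Suc n)"
| "cond_val b c s \<Longrightarrow> exec b P s s1 n1 \<Longrightarrow> exec b (While c P) s1 s2 n2 \<Longrightarrow>
    exec b (While c P) s s2 (Suc (Suc (n1 + n2)))"
| "\<not> cond_val b c s \<Longrightarrow> exec b (While c P) s s (Suc 0)"

inductive_cases exec_SkipE: "exec b Skip s s' n"
  and exec_ArithE: "exec b (Arith r f p q) s s' n"
  and exec_LoadE: "exec b (Load r p) s s' n"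
  and exec_StoreE: "exec b (Store p q) s s' n"
  and exec_SeqE: "exec b (Seq P Q) s s' n"
  and exec_CondE: "exec b (Cond c P Q) s s' n"

text \<open>Total correctness together with the time, the second argument of \<open>R\<close>.
  Existence of an execution is adequate since the coin-free fragment is deterministic.\<close>

definition wp :: "nat \<Rightarrow> program \<Rightarrow> ram_state \<Rightarrow> (ram_state \<Rightarrow> nat \<Rightarrow> bool) \<Rightarrow> bool" where
  "wp b P s R \<longleftrightarrow> (\<exists>s' n. exec b P s s' n \<and> R s' n)"

lemma wp_Skip [simp]: "wp b Skip s R \<longleftrightarrow> R s 0"
  unfolding wp_def by (auto intro: exec.intros elim!: exec_SkipE)

lemma wp_Arith [simp]: "wp b (Arith r f p q) s R \<longleftrightarrow>
    R (set_reg r (arith_val b f (operand_val b p s) (operand_val b q s)) s) (Suc 0)"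
  unfolding wp_def by (auto intro: exec.intros elim!: exec_ArithE)

lemma wp_Load [simp]: "wp b (Load r p) s R \<longleftrightarrow> R (set_reg r (mem s (operand_val b p s)) s) (Suc 0)"
  unfolding wp_def by (auto intro: exec.intros elim!: exec_LoadE)

lemma wp_Store [simp]: "wp b (Store p q) s R \<longleftrightarrow>
    R (set_mem (operand_val b p s) (operand_val b q s) s) (Suc 0)"
  unfolding wp_def by (auto intro: exec.intros elim!: exec_StoreE)

lemma wp_Seq [simp]:
  "wp b (Seq P Q) s R \<longleftrightarrow> wp b P s (\<lambda>s1 n1. wp b Q s1 (\<lambda>s2 n2. R s2 (Suc (n1 + n2))))"
  unfolding wp_def by (blast intro: exec.intros elim: exec_SeqE)

lemma wp_Cond [simp]: "wp b (Cond c P Q) s R \<longleftrightarrow>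
    (if cond_val b c s then wp b P s (\<lambda>s' n. R s' (Suc n)) else wp b Q s (\<lambda>s' n. R s' (Suc n)))"
  unfolding wp_def
  by (auto intro: exec.intros elim!: exec_CondE)

lemma wp_mono: "wp b P s R \<Longrightarrow> (\<And>s' n. R s' n \<Longrightarrow> R' s' n) \<Longrightarrow> wp b P s R'"
  unfolding wp_def by blast

text \<open>Every loop runs a number \<open>K\<close> of rounds known in advance, so the invariant
  is indexed by the round and determines the guard. A round costs at most \<open>B\<close> plus 2
  administrative steps, the last test costs 1.\<close>

lemma wp_while:
  assumes I: "I 0 s"
    and step: "\<And>k s. k < K \<Longrightarrow> I k s \<Longrightarrow> cond_val b c s"
      "\<And>k s. k < K \<Longrightarrow> I k s \<Longrightarrow> wp b P s (\<lambda>s' n. I (Suc k) s' \<and> n \<le> B)"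
    and fin: "\<And>s'. I K s' \<Longrightarrow> \<not> cond_val b c s'"
    and post: "\<And>s' n. I K s' \<Longrightarrow> n \<le> K * (B + 2) + 1 \<Longrightarrow> R s' n"
  shows "wp b (While c P) s R"
proof -
  have "j \<le> K \<Longrightarrow> I (K - j) s \<Longrightarrow>
      \<exists>s' n. exec b (While c P) s s' n \<and> I K s' \<and> n \<le> j * (B + 2) + 1" for j s
  proof (induction j arbitrary: s)
    case 0
    then show ?case using fin by (auto intro: exec.intros)
  next
    case (Suc j)
    have eq: "Suc (K - Suc j) = K - j" and less: "K - Suc j < K" using Suc.prems by auto
    obtain s1 n1 where 1: "exec b P s s1 n1" "I (K - j) s1" "n1 \<le> B"
      using step(2)[OF less Suc.prems(2)] unfolding wp_def eq by blast
    obtain s2 n2 where 2: "exec b (While c P) s1 s2 n2" "I K s2" "n2 \<le> j * (B + 2) + 1"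
      using Suc.IH[OF _ 1(2)] Suc.prems by auto
    have "exec b (While c P) s s2 (Suc (Suc (n1 + n2)))"
      using exec.intros(8)[OF step(1)[OF less Suc.prems(2)] 1(1) 2(1)] .
    moreover have "Suc (Suc (n1 + n2)) \<le> Suc j * (B + 2) + 1" using 1 2 by simp
    ultimately show ?case using 2(2) by blast
  qed
  from this[of K s] I post show ?thesis unfolding wp_def by auto
qed

lemma regs_set_reg [simp]: "regs (set_reg r k s) r' = (if r' = r then k else regs s r')"
  by (simp add: set_reg_def)

lemma mem_set_reg [simp]: "mem (set_reg r k s) = mem s"
  by (simp add: set_reg_def)

lemma mem_set_mem [simp]: "mem (set_mem a k s) a' = (if a' = a then k else mem s a')"
  by (simp add: set_mem_def)

lemma regs_set_mem [simp]: "regs (set_mem a k s) = regs s"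
  by (simp add: set_mem_def)

lemma run_add: "run b (n + k) cfg = bind_pmf (run b n cfg) (run b k)"
  by (induction n arbitrary: cfg) (simp_all add: bind_return_pmf bind_assoc_pmf cong: bind_pmf_cong)

lemma run_Skip [simp]: "run b n (Skip, s) = return_pmf (Skip, s)"
  by (induction n) (simp_all add: bind_return_pmf)

text \<open>Since \<open>Skip\<close> is stationary, \<open>n\<close> is an upper bound on the time
  of every coin outcome, and \<open>D\<close> is the distribution of final states.\<close>

definition halts_with :: "nat \<Rightarrow> program \<Rightarrow> ram_state \<Rightarrow> nat \<Rightarrow> ram_state pmf \<Rightarrow> bool" where
  "halts_with b P s n D \<longleftrightarrow> run b n (P, s) = map_pmf (Pair Skip) D"

lemma halts_with_mono: "halts_with b P s n D \<Longrightarrow> n \<le> n' \<Longrightarrow> halts_with b P s n' D"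
proof -
  assume D: "halts_with b P s n D" and "n \<le> n'"
  then obtain k where k: "n' = n + k" using le_Suc_ex by blast
  show ?thesis using D unfolding halts_with_def k run_add
    by (simp add: bind_map_pmf) (simp add: map_pmf_def)
qed

text \<open>A mixture consists of halted configurations only if each of its components does. This
  allows the outcome to be split along the first step.\<close>

lemma run_halted_support:
  assumes "bind_pmf M (run b n) = map_pmf (Pair Skip) D" "cfg \<in> set_pmf M"
  shows "run b n cfg = map_pmf (Pair Skip) (map_pmf snd (run b n cfg))"
proof -
  have "fst x = Skip" if "x \<in> set_pmf (run b n cfg)" for x
  proof -
    have "x \<in> set_pmf (bind_pmf M (run b n))" using that assms(2) by auto
    then show ?thesis unfolding assms(1) by auto
  qed
  then have "map_pmf (\<lambda>x. (Skip, snd x)) (run b n cfg) = map_pmf (\<lambda>x. x) (run b n cfg)"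
    by (intro map_pmf_cong refl) (metis prod.collapse)
  then show ?thesis by (simp add: map_pmf_comp)
qed

text \<open>Different coin outcomes may let \<open>P\<close> halt at different times. The induction
  on the time allowance decomposes \<open>D\<close> along the first step; where \<open>P\<close> has
  already halted, \<open>Q\<close> starts early and idles at the end.\<close>

lemma halts_with_Seq:
  assumes "halts_with b P s n D" "\<And>s'. s' \<in> set_pmf D \<Longrightarrow> halts_with b Q s' k (D' s')"
  shows "halts_with b (Seq P Q) s (n + 1 + k) (bind_pmf D D')"
  using assms
proof (induction n arbitrary: P s D)
  case 0
  then have "return_pmf (P, s) = map_pmf (Pair Skip) D" by (simp add: halts_with_def)
  then have "map_pmf fst (map_pmf (Pair Skip) D) = return_pmf P"
    and "map_pmf snd (map_pmf (Pair Skip) D) = return_pmf s" by (metis map_return_pmf fst_conv snd_conv)+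
  then have "return_pmf Skip = return_pmf P" and "D = return_pmf s"
    by (simp_all add: map_pmf_comp map_pmf_const)
  then have "P = Skip" by simp
  then show ?case using 0(2) \<open>D = return_pmf s\<close>
    by (simp add: halts_with_def bind_return_pmf)
next
  case (Suc n)
  show ?case
  proof (cases "P = Skip")
    case True
    then have "map_pmf (Pair Skip) D = return_pmf (Skip, s)"
      using Suc.prems(1) unfolding halts_with_def by (simp only: run_Skip)
    then have "map_pmf snd (map_pmf (Pair Skip) D) = return_pmf s" by simp
    then have D: "D = return_pmf s" by (simp add: map_pmf_comp)
    have "halts_with b Q s (Suc n + k) (D' s)"
      using Suc.prems(2)[of s] D by (auto intro: halts_with_mono)
    then show ?thesis using True by (simp add: halts_with_def D bind_return_pmf)
  next
    case False
    define G where "G c = map_pmf snd (run b n c)" for c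
    have run: "bind_pmf (step b P s) (run b n) = map_pmf (Pair Skip) D"
      using Suc.prems(1) by (simp add: halts_with_def)
    have G: "run b n c = map_pmf (Pair Skip) (G c)" if "c \<in> set_pmf (step b P s)" for c
      unfolding G_def by (rule run_halted_support[OF run that])
    have D: "D = bind_pmf (step b P s) G"
    proof -
      have "map_pmf snd (map_pmf (Pair Skip) D) = map_pmf snd (bind_pmf (step b P s) (run b n))"
        by (simp only: run)
      then show ?thesis by (simp add: map_pmf_comp map_bind_pmf G_def[abs_def])
    qed
    have "run b (Suc n + 1 + k) (Seq P Q, s) =
        bind_pmf (step b P s) (\<lambda>(P', s'). run b (n + 1 + k) (Seq P' Q, s'))"
      using False by (simp add: bind_map_pmf case_prod_beta')
    also have "\<dots> = bind_pmf (step b P s) (\<lambda>c. map_pmf (Pair Skip) (bind_pmf (G c) D'))"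
    proof (intro bind_pmf_cong refl)
      fix c assume c: "c \<in> set_pmf (step b P s)"
      obtain P' s' where c': "c = (P', s')" by (cases c)
      have "halts_with b (Seq P' Q) s' (n + 1 + k) (bind_pmf (G c) D')"
      proof (rule Suc.IH)
        show "halts_with b P' s' n (G c)" using G[OF c] by (simp add: halts_with_def c')
        fix s'' assume "s'' \<in> set_pmf (G c)"
        then have "s'' \<in> set_pmf D" using c by (auto simp: D)
        then show "halts_with b Q s'' k (D' s'')" by (rule Suc.prems(2))
      qed
      then show "(case c of (P', s') \<Rightarrow> run b (n + 1 + k) (Seq P' Q, s')) =
          map_pmf (Pair Skip) (bind_pmf (G c) D')"
        by (simp add: halts_with_def c')
    qed
    also have "\<dots> = map_pmf (Pair Skip) (bind_pmf D D')"
      by (simp add: D bind_assoc_pmf map_bind_pmf)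
    finally show ?thesis by (simp only: halts_with_def)
  qed
qed

lemma exec_halts_with: "exec b P s s' n \<Longrightarrow> halts_with b P s n (return_pmf s')"
proof (induction rule: exec.induct)
  case (5 P s s1 n1 Q s2 n2)
  from halts_with_Seq[OF 5(3), of Q n2 "\<lambda>_. return_pmf s2"] 5(4) show ?case
    by (simp add: bind_return_pmf)
next
  case (8 c s P s1 n1 s2 n2)
  have "halts_with b (Seq P (While c P)) s (n1 + 1 + n2) (return_pmf s2)"
    using halts_with_Seq[OF 8(4), of "While c P" n2 "\<lambda>_. return_pmf s2"] 8(5)
    by (simp add: bind_return_pmf)
  then show ?case using 8(1) by (simp add: halts_with_def bind_return_pmf)
qed (simp_all add: halts_with_def bind_return_pmf)

lemma wp_halts_with:
  assumes "wp b P s (\<lambda>s' n. R s' \<and> n \<le> B)"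
  shows "\<exists>s'. halts_with b P s B (return_pmf s') \<and> R s'"
  using assms exec_halts_with halts_with_mono unfolding wp_def by blast

text \<open>The rules for addition, multiplication and subtraction carry the range premises that
  remove the modulus. With the defining equations taken out of the simplifier, every unchecked
  overflow blocks the symbolic execution.\<close>

lemma arith_add: "i + j < 2 ^ b \<Longrightarrow> arith_val b Add i j = i + j" by simp
lemma arith_mul: "i * j < 2 ^ b \<Longrightarrow> arith_val b Mul i j = i * j" by simp
lemma arith_sub: "j \<le> i \<Longrightarrow> i < 2 ^ b \<Longrightarrow> arith_val b Sub i j = i - j"
  by (simp add: of_nat_diff[symmetric] nat_mod_distrib flip: of_nat_diff)
lemma arith_div: "arith_val b Div i j = i div j" by simp
lemma arith_mod: "arith_val b Defs.arith_op.Mod i j = i mod j" by simp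

declare arith_val.simps [simp del]
lemmas arith_simps = arith_add arith_mul arith_sub arith_div arith_mod

abbreviation seq_op (infixr ";;" 55) where "P ;; Q \<equiv> Seq P Q"
abbreviation "MOV r p \<equiv> Arith r Add p (Const 0)"

section \<open>Field arithmetic on words\<close>

text \<open>The machine has no bitwise operation, so the bits are treated one at a time; register 93
  holds the current power of 2 and register 6 the field size. Arguments are in 90 and 91, the result
  in 92. Subroutines own the high registers (this one from 90, multiplication from 80, powers from
  70), and callers rely on everything below being preserved.\<close>

definition "XOR_body =
  Arith 94 Add (Reg 90) (Reg 91) ;; Arith 94 Defs.arith_op.Mod (Reg 94) (Const 2) ;;
   Arith 94 Mul (Reg 94) (Reg 93) ;; Arith 92 Add (Reg 92) (Reg 94) ;;
   Arith 90 Div (Reg 90) (Const 2) ;; Arith 91 Div (Reg 91) (Const 2) ;;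
   Arith 93 Add (Reg 93) (Reg 93)"

definition "XOR_loop = While (Less (Reg 93) (Reg 6)) XOR_body"

definition "XOR = MOV 92 (Const 0) ;; MOV 93 (Const 1) ;; XOR_loop"

text \<open>Double and add: register 80 runs through the products of one factor with the powers of
  \<open>z\<close>. A doubled word that reaches the field size loses its top bit, which stands for
  \<open>z ^ d\<close> and is replaced by register 7, the word of
  \<open>z ^ 3 ^ l + 1\<close>.\<close>

definition "MUL_body =
  Arith 84 Defs.arith_op.Mod (Reg 81) (Const 2) ;;
   Cond (Equal (Reg 84) (Const 1))
     (MOV 90 (Reg 82) ;; MOV 91 (Reg 80) ;; XOR ;; MOV 82 (Reg 92)) Skip ;;
   Arith 81 Div (Reg 81) (Const 2) ;; Arith 80 Add (Reg 80) (Reg 80) ;;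
   Cond (Less (Reg 80) (Reg 6)) Skip
     (Arith 90 Sub (Reg 80) (Reg 6) ;; MOV 91 (Reg 7) ;; XOR ;; MOV 80 (Reg 92)) ;;
   Arith 83 Add (Reg 83) (Reg 83)"

definition "MUL_loop = While (Less (Reg 83) (Reg 6)) MUL_body"

definition "MUL = MOV 82 (Const 0) ;; MOV 83 (Const 1) ;; MUL_loop"

definition "POW_body =
  Arith 74 Defs.arith_op.Mod (Reg 71) (Const 2) ;;
   Cond (Equal (Reg 74) (Const 1))
     (MOV 80 (Reg 72) ;; MOV 81 (Reg 70) ;; MUL ;; MOV 72 (Reg 82)) Skip ;;
   Arith 71 Div (Reg 71) (Const 2) ;;
   MOV 80 (Reg 70) ;; MOV 81 (Reg 70) ;; MUL ;; MOV 70 (Reg 82) ;;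
   Arith 73 Add (Reg 73) (Reg 73)"

definition "POW_loop = While (Less (Reg 73) (Reg 6)) POW_body"

definition "POW = MOV 72 (Const 1) ;; MOV 73 (Const 1) ;; POW_loop"

text \<open>The parameters are the word length \<open>b\<close>, the number of vertices
  \<open>n\<close>, the target \<open>t\<close>, the exponent \<open>e\<close> of the number of
  points and the exponent \<open>l\<close> of the trinomial. The others are base addresses:
  \<open>BS\<close> of the coefficient table, \<open>BM\<close> of the matrix, \<open>BC\<close> of
  the multipliers of a pivot step, \<open>BJ\<close> of the saved row \<open>j\<close> of the pivot
  \<open>(k, j)\<close>, and \<open>BA\<close> of the array of polynomials.\<close>

locale machine = char_two z for z :: "'a :: field" +
  fixes b n t e l BS BM BC BJ BA :: nat
  assumes root: "z ^ (2 * 3 ^ l) + z ^ (3 ^ l) + 1 = 0"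
begin

definition d :: nat where "d = 2 * 3 ^ l"
definition "Q = (2 :: nat) ^ d"
definition "N = (2 :: nat) ^ e"
definition "L = n * n * N"

definition env :: "ram_state \<Rightarrow> bool" where
  "env s \<longleftrightarrow> regs s 1 = n \<and> regs s 3 = t \<and> regs s 4 = N \<and> regs s 5 = e \<and> regs s 6 = Q \<and>
     regs s 7 = 2 ^ (3 ^ l) + 1 \<and> regs s 8 = BS \<and> regs s 9 = BM \<and> regs s 10 = BC \<and> regs s 11 = BJ \<and>
     regs s 12 = BA \<and> regs s 13 = L \<and> regs s 14 = Suc e"

definition "time_xor = 15 * d + 5"
definition "time_mul = d * (32 + 2 * time_xor) + 5"
definition "time_pow = d * (32 + 2 * time_mul) + 5"

lemma d_pos: "0 < d" by (simp add: d_def)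

lemma phi_low: "phi z (2 ^ (3 ^ l) + 1) = z ^ d" "2 ^ (3 ^ l) + 1 < Q"
proof -
  have 1: "(1 :: nat) < 2 ^ 3 ^ l" by (rule one_less_power) auto
  have "z ^ d + (z ^ (3 ^ l) + 1) = 0" using root by (simp only: add.assoc d_def)
  then have "z ^ d = 1 + z ^ 3 ^ l" by (simp add: add_eq_0 add.commute)
  then show "phi z (2 ^ (3 ^ l) + 1) = z ^ d"
    using phi_add_high[OF 1, of z 1] by (simp add: add.commute)
  have "(2 :: nat) ^ (3 ^ l) + 1 < 2 * 2 ^ (3 ^ l)" using 1 by simp
  also have "\<dots> \<le> 2 ^ (3 ^ l) * 2 ^ (3 ^ l)" using 1 by (intro mult_right_mono) auto
  finally show "2 ^ (3 ^ l) + 1 < Q" by (simp add: Q_def d_def mult_2 power_add)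
qed

lemma one_less_Q: "1 < Q"
  unfolding Q_def by (rule one_less_power) (simp_all add: d_pos)

lemma phi_inj_Q: "inj_on (phi z) {..<Q}"
  unfolding Q_def d_def by (rule phi_inj[OF root])

end

text \<open>\<open>128 \<le> 2 ^ b\<close> makes the program constants exact, and
  \<open>4 * Q \<le> 2 ^ b\<close> leaves room for doubling and adding field words. By
  \<open>e \<le> d\<close> all evaluation points are field words. The memory regions are disjoint,
  and the slack \<open>4 * N\<close> covers powers of 2 and counters that are advanced once beyond
  their range.\<close>

locale sized_machine = machine +
  assumes big: "128 \<le> (2 :: nat) ^ b" "4 * Q \<le> 2 ^ b"
    and e: "0 < e" "e \<le> d"
    and layout: "BS + Suc e * Suc e \<le> BM" "BM + n * n \<le> BC" "BC + n \<le> BJ" "BJ + n \<le> BA"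
      "BA + L + 4 * N < 2 ^ b"
begin

lemma const_val: "k < 128 \<Longrightarrow> operand_val b (Const k) s = k"
  using big by simp

declare operand_val.simps(2) [simp del]
declare const_val [simp]

lemma b_pos [simp]: "0 < b"
  using big by (cases b) auto

lemma XOR_loop_spec:
  assumes "env s" and 1: "regs s 90 = x" "x < Q" "regs s 91 = y" "y < Q" "regs s 92 = 0" "regs s 93 = 1"
  shows "wp b XOR_loop s (\<lambda>s' m. m \<le> 15 * d + 1 \<and> mem s' = mem s \<and> (\<forall>r<90. regs s' r = regs s r) \<and>
    regs s' 92 < Q \<and> phi z (regs s' 92) = phi z x + phi z y)"
proof -
  note env = \<open>env s\<close>[unfolded env_def]
  \<comment> \<open>The result so far accounts for the low \<open>k\<close> bits; the remaining bits
    of both arguments still count with the factor \<open>z ^ k\<close>.\<close>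
  define I where "I k s' \<longleftrightarrow> mem s' = mem s \<and> (\<forall>r<90. regs s' r = regs s r) \<and>
    regs s' 90 = x div 2 ^ k \<and> regs s' 91 = y div 2 ^ k \<and> regs s' 93 = 2 ^ k \<and> regs s' 92 < 2 ^ k \<and>
    phi z (regs s' 92) + z ^ k * (phi z (x div 2 ^ k) + phi z (y div 2 ^ k)) = phi z x + phi z y" for k and s' :: ram_state
  show ?thesis unfolding XOR_loop_def
  proof (rule wp_while[where K = d and B = 13 and I = I])
    fix k s' assume k: "k < d" and I: "I k s'"
    have kQ: "2 ^ k < Q" using k by (simp add: Q_def)
    show "cond_val b (Less (Reg 93) (Reg 6)) s'" using I env kQ by (simp add: I_def)
    define u v where "u = x div 2 ^ k" and "v = y div 2 ^ k"
    have uv: "u < Q" "v < Q" using 1 by (auto simp: u_def v_def intro: le_less_trans[OF div_le_dividend])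
    let ?c = "(u + v) mod 2"
    have c: "?c * 2 ^ k \<le> 2 ^ k" by (simp add: mod2_eq_if)
    have p: "phi z (regs s' 92 + ?c * 2 ^ k) = phi z (regs s' 92) + z ^ k * phi z ?c"
      using phi_add_high[of "regs s' 92" k z ?c] I by (simp add: I_def mult.commute)
    have "phi z ?c = of_nat (u mod 2) + of_nat (v mod 2)"
    proof -
      have "phi z ?c = of_nat ?c" by (simp add: mod2_eq_if)
      also have "\<dots> = of_nat (u mod 2) + of_nat (v mod 2)" by (metis of_nat_parity of_nat_add)
      finally show ?thesis .
    qed
    then have c2: "z ^ k * (phi z u + phi z v) =
        z ^ k * phi z ?c + z ^ Suc k * (phi z (u div 2) + phi z (v div 2))"
      by (subst phi_rec[of z u], subst phi_rec[of z v]) (simp add: algebra_simps)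
    have d2: "x div 2 ^ Suc k = u div 2" "y div 2 ^ Suc k = v div 2"
      by (simp_all add: u_def v_def mult.commute flip: div_mult2_eq)
    have lt: "regs s' 92 + ?c * 2 ^ k < 2 ^ Suc k"
    proof -
      have "regs s' 92 < 2 ^ k" using I by (simp add: I_def)
      then show ?thesis using c unfolding power_Suc by linarith
    qed
    show "wp b XOR_body s' (\<lambda>s2 m. I (Suc k) s2 \<and> m \<le> 13)"
      using I[unfolded I_def, folded u_def v_def] uv kQ big c lt p c2 unfolding I_def d2 XOR_body_def
      by (simp add: arith_simps add.assoc)
  qed (use assms one_less_Q in \<open>auto simp: I_def env_def Q_def\<close>)
qed

lemma XOR_spec:
  assumes "env s" "regs s 90 < Q" "regs s 91 < Q"
  shows "wp b XOR s (\<lambda>s' m. m \<le> time_xor \<and> mem s' = mem s \<and> (\<forall>r<90. regs s' r = regs s r) \<and>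
    regs s' 92 < Q \<and> phi z (regs s' 92) = phi z (regs s 90) + phi z (regs s 91))"
  unfolding XOR_def using assms big
  apply (simp add: arith_simps)
  apply (rule wp_mono[OF XOR_loop_spec[of _ "regs s 90" "regs s 91"]])
  apply (simp_all add: env_def time_xor_def)
  done

text \<open>The specification with an arbitrary postcondition, so that a call can be passed by a
  single \<open>rule\<close> in the middle of a symbolic execution. The later \<open>_wp\<close>
  lemmas have the same purpose.\<close>

lemma XOR_wp:
  assumes "env s" "regs s 90 < Q" "regs s 91 < Q"
    and "\<And>s' m. m \<le> time_xor \<Longrightarrow> mem s' = mem s \<Longrightarrow> (\<forall>r<90. regs s' r = regs s r) \<Longrightarrow>
      regs s' 92 < Q \<Longrightarrow> phi z (regs s' 92) = phi z (regs s 90) + phi z (regs s 91) \<Longrightarrow> R s' m"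
  shows "wp b XOR s R"
  using assms by (intro wp_mono[OF XOR_spec]) auto

lemma phi_reduce:
  assumes "a < Q" "\<not> a + a < Q"
  shows "phi z (a + a - Q) = z ^ d + z * phi z a" "a + a - Q < Q"
proof -
  have r: "a + a - Q < 2 ^ d" "a + a = (a + a - Q) + 2 ^ d * 1"
    using assms by (auto simp: Q_def)
  have "phi z (a + a) = phi z (a + a - Q) + z ^ d" using phi_add_high[OF r(1), of z 1] r(2) by simp
  then show "phi z (a + a - Q) = z ^ d + z * phi z a"
    using phi_double[of z a] by (metis add.commute add_self_left mult_2)
  show "a + a - Q < Q" using r by (simp add: Q_def)
qed

lemma MUL_loop_spec:
  assumes env: "env s" and 1: "regs s 80 = x" "x < Q" "regs s 81 = y" "y < Q" "regs s 82 = 0" "regs s 83 = 1"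
  shows "wp b MUL_loop s (\<lambda>s' m. m \<le> d * (32 + 2 * time_xor) + 1 \<and> mem s' = mem s \<and> (\<forall>r<80. regs s' r = regs s r) \<and>
    regs s' 82 < Q \<and> phi z (regs s' 82) = phi z x * phi z y)"
proof -
  note env' = env[unfolded env_def]
  \<comment> \<open>Register 80 has absorbed the factor \<open>z ^ k\<close>, so the unread part of
    \<open>y\<close> is multiplied by register 80 as it stands.\<close>
  define I where "I k s' \<longleftrightarrow> mem s' = mem s \<and> (\<forall>r<80. regs s' r = regs s r) \<and>
    regs s' 81 = y div 2 ^ k \<and> regs s' 83 = 2 ^ k \<and> regs s' 80 < Q \<and> regs s' 82 < Q \<and>
    phi z (regs s' 82) + phi z (regs s' 80) * phi z (y div 2 ^ k) = phi z x * phi z y" for k and s' :: ram_state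
  show ?thesis unfolding MUL_loop_def
  proof (rule wp_while[where K = d and B = "2 * time_xor + 30" and I = I])
    fix k s' assume k: "k < d" and I: "I k s'"
    have kQ: "2 ^ k < Q" using k by (simp add: Q_def)
    show "cond_val b (Less (Reg 83) (Reg 6)) s'" using I env' kQ by (simp add: I_def)
    define v where "v = y div 2 ^ k"
    have v: "v < Q" using 1 by (auto simp: v_def intro: le_less_trans[OF div_le_dividend])
    have d2: "y div 2 ^ Suc k = v div 2"
      by (simp add: v_def mult.commute flip: div_mult2_eq)
    have c: "phi z a * phi z v = phi z a * of_nat (v mod 2) + z * phi z a * phi z (v div 2)" for a
      by (subst phi_rec[of z v]) (simp add: algebra_simps)
    have dbl: "phi z (a + a) = z * phi z a" for a using phi_double[of z a] by (simp add: mult_2)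
    have low: "Suc (2 ^ 3 ^ l) < Q" "phi z (Suc (2 ^ 3 ^ l)) = z ^ d" using phi_low by simp_all
    have m2: "v mod 2 = 0 \<or> v mod 2 = 1" by auto
    show "wp b MUL_body s' (\<lambda>s2 m. I (Suc k) s2 \<and> m \<le> 2 * time_xor + 30)"
      using I[unfolded I_def, folded v_def] m2 v kQ big low env' unfolding I_def d2 MUL_body_def c
      apply (elim disjE)
      apply (simp_all add: arith_simps env_def)
      apply (rule conjI impI XOR_wp | simp add: arith_simps env_def dbl phi_reduce algebra_simps)+
      done
  qed (use assms one_less_Q in \<open>auto simp: I_def env_def Q_def\<close>)
qed

lemma MUL_wp:
  assumes "env s" "regs s 80 < Q" "regs s 81 < Q"
    and "\<And>s' m. m \<le> time_mul \<Longrightarrow> mem s' = mem s \<Longrightarrow> (\<forall>r<80. regs s' r = regs s r) \<Longrightarrow>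
      regs s' 82 < Q \<Longrightarrow> phi z (regs s' 82) = phi z (regs s 80) * phi z (regs s 81) \<Longrightarrow> R s' m"
  shows "wp b MUL s R"
  unfolding MUL_def using assms(1-3) big
  by (simp add: arith_simps, intro wp_mono[OF MUL_loop_spec[of _ "regs s 80" "regs s 81"]])
    (simp_all add: env_def time_mul_def assms(4))

lemma POW_loop_spec:
  assumes env: "env s" and 1: "regs s 70 = x" "x < Q" "regs s 71 = E" "E < Q" "regs s 72 = 1" "regs s 73 = 1"
  shows "wp b POW_loop s (\<lambda>s' m. m \<le> d * (32 + 2 * time_mul) + 1 \<and> mem s' = mem s \<and> (\<forall>r<70. regs s' r = regs s r) \<and>
    regs s' 72 < Q \<and> phi z (regs s' 72) = phi z x ^ E)"
proof -
  note env' = env[unfolded env_def]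
  define I where "I k s' \<longleftrightarrow> mem s' = mem s \<and> (\<forall>r<70. regs s' r = regs s r) \<and>
    regs s' 71 = E div 2 ^ k \<and> regs s' 73 = 2 ^ k \<and> regs s' 70 < Q \<and> regs s' 72 < Q \<and>
    phi z (regs s' 72) * phi z (regs s' 70) ^ (E div 2 ^ k) = phi z x ^ E" for k and s' :: ram_state
  show ?thesis unfolding POW_loop_def
  proof (rule wp_while[where K = d and B = "2 * time_mul + 30" and I = I])
    fix k s' assume k: "k < d" and I: "I k s'"
    have kQ: "2 ^ k < Q" using k by (simp add: Q_def)
    show "cond_val b (Less (Reg 73) (Reg 6)) s'" using I env' kQ by (simp add: I_def)
    define v where "v = E div 2 ^ k"
    have v: "v < Q" using 1 by (auto simp: v_def intro: le_less_trans[OF div_le_dividend])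
    have d2: "E div 2 ^ Suc k = v div 2"
      by (simp add: v_def mult.commute flip: div_mult2_eq)
    have c: "phi z a ^ v = phi z a ^ (v mod 2) * (phi z a * phi z a) ^ (v div 2)" for a
      by (simp flip: power2_eq_square power_mult power_add)
    have m2: "v mod 2 = 0 \<or> v mod 2 = 1" by auto
    show "wp b POW_body s' (\<lambda>s2 m. I (Suc k) s2 \<and> m \<le> 2 * time_mul + 30)"
      using I[unfolded I_def, folded v_def] m2 v kQ big env' unfolding I_def d2 POW_body_def c
      apply (elim disjE)
      apply (simp_all add: arith_simps env_def)
      apply (rule conjI impI MUL_wp | simp add: arith_simps env_def algebra_simps)+
      done
  qed (use assms one_less_Q in \<open>auto simp: I_def env_def Q_def\<close>)
qed

lemma POW_wp:
  assumes "env s" "regs s 70 < Q" "regs s 71 < Q"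
    and "\<And>s' m. m \<le> time_pow \<Longrightarrow> mem s' = mem s \<Longrightarrow> (\<forall>r<70. regs s' r = regs s r) \<Longrightarrow>
      regs s' 72 < Q \<Longrightarrow> phi z (regs s' 72) = phi z (regs s 70) ^ regs s 71 \<Longrightarrow> R s' m"
  shows "wp b POW s R"
  unfolding POW_def using assms(1-3) big
  by (simp add: arith_simps, intro wp_mono[OF POW_loop_spec[of _ "regs s 70" "regs s 71"]])
    (simp_all add: env_def time_pow_def assms(4))

end

lemma wp_while_bound:
  assumes "I 0 s" "\<And>k s. k < K \<Longrightarrow> I k s \<Longrightarrow> cond_val b c s"
    "\<And>k s. k < K \<Longrightarrow> I k s \<Longrightarrow> wp b P s (\<lambda>s' n. I (Suc k) s' \<and> n \<le> B)"
    "\<And>s'. I K s' \<Longrightarrow> \<not> cond_val b c s'"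
    and T: "K * (B + 2) + 1 \<le> T"
    and "\<And>s' n. I K s' \<Longrightarrow> n \<le> T \<Longrightarrow> R s' n"
  shows "wp b (While c P) s R"
  using assms by (intro wp_while[where I = I and K = K and B = B]) auto

section \<open>The table of vanishing polynomials\<close>

text \<open>Only the exponents \<open>2 ^ k\<close> occur, so one squaring per round gives the next
  power and a polynomial of degree \<open>2 ^ i\<close> is evaluated in \<open>Suc i\<close>
  rounds.\<close>

definition "SEVAL_body =
  Arith 67 Add (Reg 66) (Reg 63) ;; Load 67 (Reg 67) ;;
  MOV 80 (Reg 67) ;; MOV 81 (Reg 61) ;; MUL ;; MOV 90 (Reg 62) ;; MOV 91 (Reg 82) ;; XOR ;; MOV 62 (Reg 92) ;;
  MOV 80 (Reg 61) ;; MOV 81 (Reg 61) ;; MUL ;; MOV 61 (Reg 82) ;; Arith 63 Add (Reg 63) (Const 1)"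

definition "SEVAL_loop = While (Less (Reg 63) (Reg 65)) SEVAL_body"

definition "SEVAL = MOV 62 (Const 0) ;; MOV 63 (Const 0) ;; Arith 65 Add (Reg 60) (Const 1) ;;
  Arith 66 Mul (Reg 60) (Reg 14) ;; Arith 66 Add (Reg 66) (Reg 8) ;; SEVAL_loop"

declare subspace_coeff.simps(2) [simp del]
declare mult_Suc_right [simp del]

context machine
begin

definition "time_seval = Suc e * (2 * time_mul + time_xor + 40) + 20"

definition table :: "(nat \<Rightarrow> nat) \<Rightarrow> nat \<Rightarrow> bool" where
  "table M i \<longleftrightarrow> (\<forall>i'\<le>i. \<forall>j\<le>e. M (i' * Suc e + BS + j) < Q \<and>
     phi z (M (i' * Suc e + BS + j)) = subspace_coeff z i' j)"

end

context sized_machine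
begin

lemma table_address: "i \<le> e \<Longrightarrow> j \<le> e \<Longrightarrow> i * Suc e + j < Suc e * Suc e"
proof -
  assume "i \<le> e" "j \<le> e"
  then have "i * Suc e + j < i * Suc e + Suc e" by simp
  also have "\<dots> = Suc i * Suc e" by simp
  also have "\<dots> \<le> Suc e * Suc e" using \<open>i \<le> e\<close> by (intro mult_right_mono) auto
  finally show ?thesis .
qed

lemma table_address_bound: "i \<le> e \<Longrightarrow> j \<le> e \<Longrightarrow> i * Suc e + BS + j < BM"
  using table_address[of i j] layout by linarith

lemma address_less: "BM < 2 ^ b" "BC < 2 ^ b" "BA < 2 ^ b"
  using layout by linarith+

lemma N_bounds: "e < N" "2 \<le> N" "N \<le> Q"
proof -
  show "e < N" by (simp add: N_def)
  have "(2 :: nat) ^ 1 \<le> 2 ^ e" using e by (intro power_increasing) auto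
  then show "2 \<le> N" by (simp add: N_def)
  show "N \<le> Q" using e unfolding N_def Q_def by (intro power_increasing) auto
qed

lemma e_bound: "e + 3 < 2 ^ b"
  using N_bounds layout by linarith

lemma SEVAL_loop_spec:
  assumes env: "env s" and tab: "table (mem s) i" "i \<le> e"
    and 1: "regs s 61 = a" "a < Q" "regs s 62 = 0" "regs s 63 = 0" "regs s 65 = Suc i"
      "regs s 66 = i * Suc e + BS"
  shows "wp b SEVAL_loop s (\<lambda>s' m. m \<le> Suc e * (2 * time_mul + time_xor + 40) + 1 \<and> mem s' = mem s \<and>
    (\<forall>r<60. regs s' r = regs s r) \<and> regs s' 62 < Q \<and> phi z (regs s' 62) = subspace_poly z i (phi z a))"
proof -
  note env' = env[unfolded env_def]
  define I where "I k s' \<longleftrightarrow> mem s' = mem s \<and> (\<forall>r<60. regs s' r = regs s r) \<and>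
    regs s' 61 < Q \<and> regs s' 62 < Q \<and> regs s' 63 = k \<and> regs s' 65 = Suc i \<and> regs s' 66 = i * Suc e + BS \<and>
    phi z (regs s' 61) = phi z a ^ (2 ^ k) \<and>
    phi z (regs s' 62) = (\<Sum>j<k. subspace_coeff z i j * phi z a ^ (2 ^ j))" for k and s' :: ram_state
  show ?thesis unfolding SEVAL_loop_def
  proof (rule wp_while_bound[where K = "Suc i" and B = "2 * time_mul + time_xor + 38" and I = I])
    fix k s' assume k: "k < Suc i" and I: "I k s'"
    show "cond_val b (Less (Reg 63) (Reg 65)) s'" using I env' k by (simp add: I_def)
    have ad: "i * Suc e + BS + k < 2 ^ b" "k + 1 < 2 ^ b"
      using table_address_bound[OF tab(2), of k] address_less(1) k tab(2) e_bound by linarith+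
    have m: "mem s (i * Suc e + BS + k) < Q" "phi z (mem s (i * Suc e + BS + k)) = subspace_coeff z i k"
      using tab k by (simp_all add: table_def)
    have pw: "x ^ (2 ^ Suc k) = x ^ (2 ^ k) * x ^ (2 ^ k)" for x :: 'a
      by (simp add: mult_2 power_add)
    show "wp b SEVAL_body s' (\<lambda>s2 m. I (Suc k) s2 \<and> m \<le> 2 * time_mul + time_xor + 38)"
      using I[unfolded I_def] big env' ad m unfolding I_def SEVAL_body_def pw
      apply (simp add: arith_simps env_def)
      apply (rule conjI impI MUL_wp XOR_wp | simp add: arith_simps env_def mult.commute)+
      done
  next
    show "Suc i * (2 * time_mul + time_xor + 38 + 2) + 1 \<le> Suc e * (2 * time_mul + time_xor + 40) + 1"
      using tab(2) by (intro add_right_mono mult_le_mono) simp_all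
  next
    fix s' n assume I: "I (Suc i) s'" and n: "n \<le> Suc e * (2 * time_mul + time_xor + 40) + 1"
    show "n \<le> Suc e * (2 * time_mul + time_xor + 40) + 1 \<and> mem s' = mem s \<and>
    (\<forall>r<60. regs s' r = regs s r) \<and> regs s' 62 < Q \<and> phi z (regs s' 62) = subspace_poly z i (phi z a)"
      using I n by (simp add: I_def subspace_poly_def lessThan_Suc_atMost del: sum.lessThan_Suc mult_Suc)
  qed (use assms one_less_Q in \<open>auto simp: I_def\<close>)
qed

lemma SEVAL_wp:
  assumes "env s" "table (mem s) j" "regs s 60 \<le> j" "j \<le> e" "regs s 61 < Q"
    and "\<And>s' m. m \<le> time_seval \<Longrightarrow> mem s' = mem s \<Longrightarrow> (\<forall>r<60. regs s' r = regs s r) \<Longrightarrow>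
      regs s' 62 < Q \<Longrightarrow> phi z (regs s' 62) = subspace_poly z (regs s 60) (phi z (regs s 61)) \<Longrightarrow> R s' m"
  shows "wp b SEVAL s R"
proof -
  have i: "regs s 60 \<le> e" using assms by linarith
  have ad: "regs s 60 * Suc e + BS < 2 ^ b" "regs s 60 + 1 < 2 ^ b" "regs s 60 * Suc e < 2 ^ b"
  proof -
    show a: "regs s 60 * Suc e + BS < 2 ^ b" using table_address_bound[OF i, of 0] address_less(1) by simp
    show "regs s 60 + 1 < 2 ^ b" using i e_bound by linarith
    show "regs s 60 * Suc e < 2 ^ b" by (rule le_less_trans[OF _ a]) simp
  qed
  show ?thesis
    unfolding SEVAL_def using assms(1-5) big ad i env_def[of s]
    apply (simp add: arith_simps)
    apply (rule wp_mono[OF SEVAL_loop_spec[of _ "regs s 60" "regs s 61"]])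
    apply (simp_all add: env_def table_def time_seval_def assms(6) arith_simps)
    done
qed

end

text \<open>Builds row \<open>Suc i\<close> from row \<open>i\<close>: the entry at \<open>j\<close>
  adds its multiple by register 52, which holds \<open>subspace_poly z i (z ^ i)\<close>, to slot
  \<open>j\<close> and writes its square to slot \<open>Suc j\<close>. The square is in place before
  the next round adds to that slot.\<close>

definition "ROW_body =
  Arith 57 Add (Reg 54) (Reg 53) ;; Load 58 (Reg 57) ;; MOV 80 (Reg 52) ;; MOV 81 (Reg 58) ;; MUL ;;
  Arith 57 Add (Reg 55) (Reg 53) ;; Load 90 (Reg 57) ;; MOV 91 (Reg 82) ;; XOR ;; Store (Reg 57) (Reg 92) ;;
  MOV 80 (Reg 58) ;; MOV 81 (Reg 58) ;; MUL ;; Arith 57 Add (Reg 57) (Const 1) ;; Store (Reg 57) (Reg 82) ;;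
  Arith 53 Add (Reg 53) (Const 1)"

definition "ROW_loop = While (Less (Reg 53) (Reg 56)) ROW_body"

definition "TABLE_body =
  MOV 60 (Reg 50) ;; MOV 61 (Reg 51) ;; SEVAL ;; MOV 52 (Reg 62) ;; MOV 53 (Const 0) ;;
  Arith 54 Mul (Reg 50) (Reg 14) ;; Arith 54 Add (Reg 54) (Reg 8) ;; Arith 55 Add (Reg 54) (Reg 14) ;;
  Arith 56 Add (Reg 50) (Const 1) ;; ROW_loop ;;
  Arith 50 Add (Reg 50) (Const 1) ;; Arith 51 Add (Reg 51) (Reg 51)"

definition "TABLE_loop = While (Less (Reg 50) (Reg 5)) TABLE_body"

definition "TABLE = Store (Reg 8) (Const 1) ;; MOV 50 (Const 0) ;; MOV 51 (Const 1) ;; TABLE_loop"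

context machine
begin

definition "time_row = Suc e * (2 * time_mul + time_xor + 40) + 1"
definition "time_table = e * (time_seval + time_row + 40) + 10"

end

context sized_machine
begin

text \<open>The recurrence with cut-offs inserted where the coefficients are 0, in the shape in
  which the row loop leaves the new row.\<close>

lemma subspace_coeff_partial:
  "subspace_coeff z (Suc i) j =
    (if j = 0 then 0 else if j \<le> Suc i then (subspace_coeff z i (j - 1))\<^sup>2 else 0) +
    (if j < Suc i then subspace_poly z i (z ^ i) * subspace_coeff z i j else 0)"
  by (auto simp: subspace_poly_def subspace_coeff_eq_0 subspace_coeff.simps(2))

lemma ROW_loop_spec:
  assumes env: "env s" and i: "i < e"
    and row: "\<forall>j\<le>e. mem s (P + j) < Q \<and> phi z (mem s (P + j)) = subspace_coeff z i j"
    and zero: "\<forall>j\<le>e. mem s (P + Suc e + j) = 0" and P: "P + Suc e + Suc e \<le> BM"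
    and 1: "regs s 52 < Q" "phi z (regs s 52) = subspace_poly z i (z ^ i)" "regs s 53 = 0"
      "regs s 54 = P" "regs s 55 = P + Suc e" "regs s 56 = Suc i"
  shows "wp b ROW_loop s (\<lambda>s' m. m \<le> time_row \<and>
    (\<forall>a. a < P + Suc e \<or> P + Suc e + e < a \<longrightarrow> mem s' a = mem s a) \<and>
    (\<forall>r<53. regs s' r = regs s r) \<and>
    (\<forall>j\<le>e. mem s' (P + Suc e + j) < Q \<and> phi z (mem s' (P + Suc e + j)) = subspace_coeff z (Suc i) j))"
proof -
  note env' = env[unfolded env_def]
  define G where "G = subspace_poly z i (z ^ i)"
  \<comment> \<open>The new row after \<open>k\<close> rounds: squares have reached index
    \<open>k\<close>, multiples only the indices below \<open>k\<close>.\<close>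
  define V where "V k j = (if j = 0 then 0 else if j \<le> k then (subspace_coeff z i (j - 1))\<^sup>2 else 0) +
    (if j < k then G * subspace_coeff z i j else 0)" for k j
  define I where "I k s' \<longleftrightarrow> (\<forall>a. a < P + Suc e \<or> P + Suc e + e < a \<longrightarrow> mem s' a = mem s a) \<and>
    (\<forall>r<53. regs s' r = regs s r) \<and> regs s' 53 = k \<and> regs s' 54 = P \<and> regs s' 55 = P + Suc e \<and> regs s' 56 = Suc i \<and>
    (\<forall>j\<le>e. mem s' (P + Suc e + j) < Q \<and> phi z (mem s' (P + Suc e + j)) = V k j)" for k and s' :: ram_state
  show ?thesis unfolding ROW_loop_def
  proof (rule wp_while_bound[where K = "Suc i" and B = "2 * time_mul + time_xor + 38" and I = I])
    fix k s' assume k: "k < Suc i" and I: "I k s'"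
    show "cond_val b (Less (Reg 53) (Reg 56)) s'" using I k by (simp add: I_def)
    have bd: "P + Suc e + e + 1 < 2 ^ b" using P address_less by linarith
    have m: "mem s' (P + k) < Q" "phi z (mem s' (P + k)) = subspace_coeff z i k"
      using I row k i by (simp_all add: I_def)
    have V: "V (Suc k) j = (if j = k then V k k + G * subspace_coeff z i k
       else if j = Suc k then subspace_coeff z i k * subspace_coeff z i k else V k j)" for j
      by (auto simp: V_def power2_eq_square)
    have m2: "mem s' (P + Suc e + k) < Q" "phi z (mem s' (P + Suc e + k)) = V k k"
      using I k i by (simp_all add: I_def)
    have I3: "mem s' (Suc (P + e + j)) < Q" "phi z (mem s' (Suc (P + e + j))) = V k j" if "j \<le> e" for j
      using I that by (simp_all add: I_def)
    have I4: "mem s' a = mem s a" if "a < P + Suc e \<or> P + Suc e + e < a" for a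
      using I that unfolding I_def by blast
    have I5: "\<forall>r<53. regs s' r = regs s r" "regs s' 53 = k" "regs s' 54 = P" "regs s' 55 = P + Suc e" "regs s' 56 = Suc i"
      using I by (simp_all add: I_def)
    have k': "k < e" using k i by simp
    note G = 1(2)[folded G_def]
    show "wp b ROW_body s' (\<lambda>s2 m. I (Suc k) s2 \<and> m \<le> 2 * time_mul + time_xor + 38)"
      using big env' bd m m2 k' 1(1) G I5 unfolding ROW_body_def
      apply (simp add: arith_simps env_def)
      apply (rule MUL_wp XOR_wp | simp add: arith_simps env_def)+
      apply (simp add: I_def V I3 I4 env_def)
      done
  next
    show "Suc i * (2 * time_mul + time_xor + 38 + 2) + 1 \<le> time_row"
      unfolding time_row_def using i by (intro add_right_mono mult_le_mono) simp_all
  next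
    fix s' n assume "I (Suc i) s'" "n \<le> time_row"
    then show "n \<le> time_row \<and>
       (\<forall>a. a < P + Suc e \<or> P + Suc e + e < a \<longrightarrow> mem s' a = mem s a) \<and>
       (\<forall>r<53. regs s' r = regs s r) \<and>
       (\<forall>j\<le>e. mem s' (P + Suc e + j) < Q \<and> phi z (mem s' (P + Suc e + j)) = subspace_coeff z (Suc i) j)"
      unfolding I_def V_def subspace_coeff_partial G_def by blast
  qed (use assms one_less_Q in \<open>auto simp: I_def V_def\<close>)
qed

text \<open>The row loop reads slot 0 of the new row before writing it and leaves the slots beyond
  \<open>Suc i\<close> untouched. Rows not yet built must therefore be 0, which the invariant
  carries along.\<close>

lemma TABLE_loop_spec:
  assumes env: "env s" and zero: "\<forall>a. BS < a \<and> a < BM \<longrightarrow> mem s a = 0" and one: "mem s BS = 1"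
    and 1: "regs s 50 = 0" "regs s 51 = 1"
  shows "wp b TABLE_loop s (\<lambda>s' m. m \<le> e * (time_seval + time_row + 40) + 1 \<and>
    (\<forall>a. a < BS \<or> BM \<le> a \<longrightarrow> mem s' a = mem s a) \<and> (\<forall>r<50. regs s' r = regs s r) \<and> table (mem s') e)"
proof -
  note env' = env[unfolded env_def]
  define I where "I k s' \<longleftrightarrow> (\<forall>a. a < BS \<or> BM \<le> a \<longrightarrow> mem s' a = mem s a) \<and>
    (\<forall>r<50. regs s' r = regs s r) \<and> regs s' 50 = k \<and> regs s' 51 = 2 ^ k \<and> table (mem s') k \<and>
    (\<forall>a. Suc k * Suc e + BS \<le> a \<and> a < BM \<longrightarrow> mem s' a = 0)" for k and s' :: ram_state
  show ?thesis unfolding TABLE_loop_def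
  proof (rule wp_while_bound[where K = e and B = "time_seval + time_row + 38" and I = I])
    show "I 0 s" unfolding I_def
    proof (intro conjI)
      show "table (mem s) 0" unfolding table_def
      proof (intro allI impI)
        fix i' j :: nat assume "i' \<le> 0" "j \<le> e"
        moreover have "mem s (BS + j) = 0" if "0 < j"
          using zero table_address_bound[of 0 j] \<open>j \<le> e\<close> that by simp
        ultimately show "mem s (i' * Suc e + BS + j) < Q \<and> phi z (mem s (i' * Suc e + BS + j)) = subspace_coeff z i' j"
          using one one_less_Q by (cases "j = 0") simp_all
      qed
    qed (use 1 zero in auto)
  next
    fix k s' assume k: "k < e" and I: "I k s'"
    show "cond_val b (Less (Reg 50) (Reg 5)) s'" using I k env' by (simp add: I_def)
    define P where "P = k * Suc e + BS"
    have P: "P + Suc e + Suc e \<le> BM"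
    proof -
      have "Suc (Suc k) * Suc e \<le> Suc e * Suc e" using k by (intro mult_right_mono) auto
      then show ?thesis using layout by (simp add: P_def)
    qed
    have kk: "k * Suc e < 2 ^ b" "P < 2 ^ b" "P + Suc e < 2 ^ b" "k + 1 < 2 ^ b"
      using P address_less e_bound k by (auto simp: P_def)
    have k2: "(2 :: nat) ^ k < Q" "(2 :: nat) ^ k + 2 ^ k < 2 ^ b"
    proof -
      have "(2 :: nat) ^ k < 2 ^ e" using k by simp
      also have "\<dots> \<le> Q" using N_bounds(3) by (simp add: N_def)
      finally show "(2 :: nat) ^ k < Q" .
      then show "(2 :: nat) ^ k + 2 ^ k < 2 ^ b" using big by linarith
    qed
    have kb: "k < b"
      using k2(2) by (metis add_lessD1 nat_power_less_imp_less pos2)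
    have I1: "\<forall>r<50. regs s' r = regs s r" "regs s' 50 = k" "regs s' 51 = 2 ^ k" "table (mem s') k"
      using I by (simp_all add: I_def)
    have row: "\<forall>j\<le>e. mem s' (P + j) < Q \<and> phi z (mem s' (P + j)) = subspace_coeff z k j"
      using I1(4) by (simp add: table_def P_def)
    have zr: "\<forall>j\<le>e. mem s' (P + Suc e + j) = 0"
      using I P by (simp add: I_def P_def)
    have next_table: "table (mem s2) (Suc k)"
      if "\<forall>a. a < P + Suc e \<or> P + Suc e + e < a \<longrightarrow> mem s2 a = mem s' a"
        "\<forall>j\<le>e. mem s2 (P + Suc e + j) < Q \<and> phi z (mem s2 (P + Suc e + j)) = subspace_coeff z (Suc k) j" for s2
      unfolding table_def
    proof (intro allI impI)
      fix i' j :: nat assume i: "i' \<le> Suc k" and j: "j \<le> e"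
      show "mem s2 (i' * Suc e + BS + j) < Q \<and> phi z (mem s2 (i' * Suc e + BS + j)) = subspace_coeff z i' j"
      proof (cases "i' = Suc k")
        case True
        then have eq: "i' * Suc e + BS + j = P + Suc e + j" by (simp add: P_def)
        show ?thesis unfolding eq using that(2) j unfolding True by blast
      next
        case False
        then have "i' * Suc e \<le> k * Suc e" using i by (intro mult_right_mono) auto
        then have "i' * Suc e + BS + j < P + Suc e" using j unfolding P_def by linarith
        then show ?thesis using that(1) I1(4) False i j by (simp add: table_def)
      qed
    qed
    have next_zero: "mem s2 a = 0"
      if "\<forall>a. a < P + Suc e \<or> P + Suc e + e < a \<longrightarrow> mem s2 a = mem s' a"
        "Suc (Suc k) * Suc e + BS \<le> a" "a < BM" for s2 a
    proof -
      have "P + Suc e + Suc e \<le> a" using that by (simp add: P_def)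
      then have "mem s2 a = mem s' a" using that(1) by simp
      moreover have "mem s' a = 0" using \<open>P + Suc e + Suc e \<le> a\<close> that(3) I unfolding I_def P_def by simp
      ultimately show ?thesis by simp
    qed
    have next_frame: "mem s2 a = mem s a"
      if "\<forall>a. a < P + Suc e \<or> P + Suc e + e < a \<longrightarrow> mem s2 a = mem s' a" "a < BS \<or> BM \<le> a" for s2 a
    proof -
      have "a < P + Suc e \<or> P + Suc e + e < a" using that(2) P by (auto simp: P_def)
      then have "mem s2 a = mem s' a" using that(1) by blast
      then show ?thesis using that(2) I unfolding I_def by metis
    qed
    have rest: "I (Suc k) (set_reg 51 (2 ^ k + 2 ^ k) (set_reg 50 (Suc k) s2))"
      if fr: "\<forall>a. a < P + Suc e \<or> P + Suc e + e < a \<longrightarrow> mem s2 a = mem s' a"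
        and rg: "\<forall>r<50. regs s2 r = regs s r"
        and v: "\<forall>j\<le>e. mem s2 (P + Suc e + j) < Q \<and> phi z (mem s2 (P + Suc e + j)) = subspace_coeff z (Suc k) j" for s2
      unfolding I_def mem_set_reg
      using rg next_table[OF fr v] next_zero[OF fr] next_frame[OF fr] by simp
    have Peq: "k * Suc e + BS = P" by (simp add: P_def)
    have ROW: "wp b ROW_loop s1 R"
      if "env s1" "mem s1 = mem s'" "regs s1 52 < Q" "phi z (regs s1 52) = subspace_poly z k (z ^ k)"
        "regs s1 53 = 0" "regs s1 54 = P" "regs s1 55 = P + Suc e" "regs s1 56 = Suc k"
        and R: "\<And>s2 m. m \<le> time_row \<Longrightarrow> \<forall>a. a < P + Suc e \<or> P + Suc e + e < a \<longrightarrow> mem s2 a = mem s' a \<Longrightarrow>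
           \<forall>r<53. regs s2 r = regs s1 r \<Longrightarrow>
           \<forall>j\<le>e. mem s2 (P + Suc e + j) < Q \<and> phi z (mem s2 (P + Suc e + j)) = subspace_coeff z (Suc k) j \<Longrightarrow> R s2 m"
      for s1 R
      by (rule wp_mono[OF ROW_loop_spec[where i = k and P = P]]) (use that k row zr P in simp_all)
    show "wp b TABLE_body s' (\<lambda>s2 m. I (Suc k) s2 \<and> m \<le> time_seval + time_row + 38)"
      unfolding TABLE_body_def
      using big env' I1 k2 kk k kb
      apply (simp add: arith_simps)
      apply (rule SEVAL_wp[where j = k])
           apply (simp_all add: env_def arith_simps Peq)
      apply (rule ROW)
              apply (simp_all add: env_def arith_simps phi_power_two rest)
      done
  qed (use assms in \<open>auto simp: I_def env_def\<close>)
qed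

lemma TABLE_spec:
  assumes env: "env s" and zero: "\<forall>a. BS \<le> a \<and> a < BM \<longrightarrow> mem s a = 0"
  shows "wp b TABLE s (\<lambda>s' m. m \<le> time_table \<and>
    (\<forall>a. a < BS \<or> BM \<le> a \<longrightarrow> mem s' a = mem s a) \<and> (\<forall>r<50. regs s' r = regs s r) \<and> table (mem s') e)"
proof -
  have "BS < BM" using table_address_bound[of 0 0] by simp
  then show ?thesis
    unfolding TABLE_def using assms big
    apply (simp add: arith_simps)
    apply (rule wp_mono[OF TABLE_loop_spec])
        apply (simp_all add: env_def time_table_def)
    done
qed

end

section \<open>Additive fast Fourier transform\<close>

text \<open>Cancels one leading coefficient, in register 46, against the monic
  \<open>subspace_poly z i\<close>. The coefficient itself stays in memory as a coefficient of the
  quotient; below it only \<open>i\<close> cells change, at the offsets \<open>2 ^ k\<close> in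
  register 49.\<close>

definition "INNER_body =
  Load 80 (Reg 48) ;; MOV 81 (Reg 46) ;; MUL ;; Arith 50 Add (Reg 45) (Reg 49) ;; Load 90 (Reg 50) ;;
  MOV 91 (Reg 82) ;; XOR ;; Store (Reg 50) (Reg 92) ;;
  Arith 47 Add (Reg 47) (Const 1) ;; Arith 48 Add (Reg 48) (Const 1) ;; Arith 49 Add (Reg 49) (Reg 49)"

definition "INNER_loop = While (Less (Reg 47) (Reg 40)) INNER_body"

text \<open>Division with remainder from the top, in place: of \<open>2 * h\<close> coefficients,
  where \<open>h = 2 ^ i\<close>, the upper half becomes the quotient and the lower half the
  remainder. The divisor has at most \<open>Suc i\<close> terms, which keeps this near
  linear.\<close>

definition "DIVIDE_body =
  Arith 43 Sub (Reg 43) (Const 1) ;; Arith 45 Add (Reg 44) (Reg 43) ;; Load 46 (Reg 45) ;;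
  Arith 45 Sub (Reg 45) (Reg 41) ;; MOV 47 (Const 0) ;; Arith 48 Mul (Reg 40) (Reg 14) ;;
  Arith 48 Add (Reg 48) (Reg 8) ;; MOV 49 (Const 1) ;; INNER_loop"

definition "DIVIDE_loop = While (Less (Reg 41) (Reg 43)) DIVIDE_body"

text \<open>On a coset where \<open>subspace_poly z i\<close> is constantly \<open>c\<close>,
  remainder \<open>r\<close> and quotient \<open>q\<close> combine to the single polynomial
  \<open>r + c * q\<close> of half the length. Registers 51 and 52 hold \<open>c\<close> for the two
  cosets.\<close>

definition "BFLY_body =
  Load 47 (Reg 45) ;; Load 48 (Reg 46) ;;
  MOV 80 (Reg 51) ;; MOV 81 (Reg 48) ;; MUL ;; MOV 90 (Reg 47) ;; MOV 91 (Reg 82) ;; XOR ;; Store (Reg 45) (Reg 92) ;;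
  MOV 80 (Reg 52) ;; MOV 81 (Reg 48) ;; MUL ;; MOV 90 (Reg 47) ;; MOV 91 (Reg 82) ;; XOR ;; Store (Reg 46) (Reg 92) ;;
  Arith 43 Add (Reg 43) (Const 1) ;; Arith 45 Add (Reg 45) (Const 1) ;; Arith 46 Add (Reg 46) (Const 1)"

definition "BFLY_loop = While (Less (Reg 43) (Reg 41)) BFLY_body"

lemma mem_set_mem_fun: "mem (set_mem a v s) = (mem s)(a := v)"
  by (simp add: set_mem_def)

context machine
begin

definition ev :: "(nat \<Rightarrow> nat) \<Rightarrow> nat \<Rightarrow> nat \<Rightarrow> 'a \<Rightarrow> 'a" where
  "ev M T h y = (\<Sum>w<h. phi z (M (T + w)) * y ^ w)"

lemma ev_cong: "(\<And>w. w < h \<Longrightarrow> M (T + w) = M' (T + w)) \<Longrightarrow> ev M T h y = ev M' T h y"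
  by (simp add: ev_def)

lemma ev_split: "ev M T (a + c) y = ev M T a y + y ^ a * ev M (T + a) c y"
proof -
  have "(\<Sum>w<a + c. phi z (M (T + w)) * y ^ w) =
      (\<Sum>w<a. phi z (M (T + w)) * y ^ w) + (\<Sum>w\<in>{a..<a + c}. phi z (M (T + w)) * y ^ w)"
    by (subst sum.union_disjoint[symmetric]) (auto intro!: sum.cong)
  also have "(\<Sum>w\<in>{a..<a + c}. phi z (M (T + w)) * y ^ w) = (\<Sum>w<c. phi z (M (T + (w + a))) * y ^ (w + a))"
    using sum.shift_bounds_nat_ivl[of "\<lambda>w. phi z (M (T + w)) * y ^ w" 0 a c]
    by (simp add: add.commute atLeast0LessThan)
  finally show ?thesis by (simp add: ev_def sum_distrib_left power_add ac_simps)
qed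

lemma ev_update:
  assumes "p < h" "phi z v = phi z (M (T + p)) + c"
  shows "ev (M(T + p := v)) T h y = ev M T h y + c * y ^ p"
proof -
  have "ev (M(T + p := v)) T h y = (\<Sum>w<h. phi z (M (T + w)) * y ^ w + (if w = p then c * y ^ p else 0))"
    unfolding ev_def using assms(2) by (intro sum.cong) (auto simp: distrib_right)
  also have "\<dots> = ev M T h y + c * y ^ p" using assms(1) by (simp add: sum.distrib ev_def)
  finally show ?thesis .
qed

definition "time_inner = e * (time_mul + time_xor + 40) + 1"

end

context sized_machine
begin

lemma table_cong: "i \<le> e \<Longrightarrow> (\<And>a. a < BM \<Longrightarrow> M a = M' a) \<Longrightarrow> table M i = table M' i"
  unfolding table_def using table_address_bound by (metis le_trans)

lemma e_less_b: "e + 2 < b"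
proof -
  have "(2 :: nat) ^ (e + 2) = 4 * N" by (simp add: N_def)
  then have "(2 :: nat) ^ (e + 2) < 2 ^ b" using layout by linarith
  then show ?thesis by (rule nat_power_less_imp_less[rotated]) simp
qed

text \<open>The loop adds the multiples of all terms except the monic top one, whose contribution
  therefore appears on the left of the identity.\<close>

lemma INNER_loop_spec:
  assumes env: "env s" and tab: "table (mem s) e" and i: "i \<le> e" and T: "BA \<le> T" "T + 2 ^ i \<le> BA + L"
    and Qs: "\<forall>w<2 ^ i. mem s (T + w) < Q"
    and 1: "regs s 40 = i" "regs s 45 = T" "regs s 46 < Q" "regs s 47 = 0" "regs s 48 = i * Suc e + BS" "regs s 49 = 1"
  shows "wp b INNER_loop s (\<lambda>s' m. m \<le> time_inner \<and>
    (\<forall>a. a < T \<or> T + 2 ^ i \<le> a \<longrightarrow> mem s' a = mem s a) \<and> (\<forall>r<47. regs s' r = regs s r) \<and>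
    (\<forall>w<2 ^ i. mem s' (T + w) < Q) \<and>
    (\<forall>y. ev (mem s') T (2 ^ i) y + phi z (regs s 46) * y ^ (2 ^ i) =
       ev (mem s) T (2 ^ i) y + phi z (regs s 46) * subspace_poly z i y))"
proof -
  note env' = env[unfolded env_def]
  define h where "h = (2 :: nat) ^ i"
  define x where "x = regs s 46"
  define I where "I k s' \<longleftrightarrow> (\<forall>a. a < T \<or> T + h \<le> a \<longrightarrow> mem s' a = mem s a) \<and> (\<forall>r<47. regs s' r = regs s r) \<and>
    regs s' 47 = k \<and> regs s' 48 = i * Suc e + BS + k \<and> regs s' 49 = 2 ^ k \<and>
    (\<forall>w<h. mem s' (T + w) < Q) \<and>
    (\<forall>y. ev (mem s') T h y = ev (mem s) T h y + phi z x * (\<Sum>j<k. subspace_coeff z i j * y ^ (2 ^ j)))"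
    for k and s' :: ram_state
  show ?thesis unfolding INNER_loop_def
  proof (rule wp_while_bound[where K = i and B = "time_mul + time_xor + 38" and I = I])
    fix k s' assume k: "k < i" and I: "I k s'"
    show "cond_val b (Less (Reg 47) (Reg 40)) s'" using I k 1 by (simp add: I_def)
    have kh: "2 ^ k < h" using k by (simp add: h_def)
    have kb: "Suc k < b" using k i e_less_b by linarith
    have Th: "T + h \<le> BA + L" using T by (simp add: h_def)
    have ad: "i * Suc e + BS + k + 1 < 2 ^ b" "T + 2 ^ k < 2 ^ b" "(2 :: nat) ^ k + 2 ^ k < 2 ^ b" "k + 1 < 2 ^ b"
    proof -
      show "i * Suc e + BS + k + 1 < 2 ^ b"
        using table_address_bound[OF i, of k] address_less(1) k i by linarith
      show "T + 2 ^ k < 2 ^ b" using kh Th layout by linarith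
      have "(2 :: nat) ^ Suc k < 2 ^ b" using kb by (intro power_strict_increasing) simp_all
      then show "(2 :: nat) ^ k + 2 ^ k < 2 ^ b" by (simp only: power_Suc mult_2)
      show "k + 1 < 2 ^ b" using e_bound k i by linarith
    qed
    have lt: "i * Suc e + BS + k < T" using table_address_bound[OF i, of k] k i T layout by linarith
    have c: "mem s' (i * Suc e + BS + k) < Q" "phi z (mem s' (i * Suc e + BS + k)) = subspace_coeff z i k"
      using I lt tab k i by (simp_all add: I_def table_def)
    have I1: "\<forall>r<47. regs s' r = regs s r" "regs s' 47 = k" "regs s' 48 = i * Suc e + BS + k" "regs s' 49 = 2 ^ k"
      "mem s' (T + 2 ^ k) < Q"
      using I kh by (simp_all add: I_def)
    have step: "I (Suc k) s2" if "\<forall>r<47. regs s2 r = regs s r" "regs s2 47 = Suc k"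
      "regs s2 48 = Suc (i * Suc e + BS + k)" "regs s2 49 = 2 ^ k + 2 ^ k" "v < Q"
      "phi z v = phi z (mem s' (T + 2 ^ k)) + subspace_coeff z i k * phi z x"
      "mem s2 = (mem s')(T + 2 ^ k := v)" for s2 v
    proof -
      have "ev (mem s2) T h y = ev (mem s') T h y + subspace_coeff z i k * phi z x * y ^ 2 ^ k" for y
        unfolding that(7) by (rule ev_update[where M = "mem s'"]) (fact kh that(6))+
      then have "ev (mem s2) T h y = ev (mem s) T h y + phi z x * (\<Sum>j<Suc k. subspace_coeff z i j * y ^ (2 ^ j))" for y
        using I by (simp add: I_def algebra_simps)
      moreover have "mem s2 a = mem s a" if "a < T \<or> T + h \<le> a" for a
        using that I kh \<open>mem s2 = _\<close> by (auto simp: I_def)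
      moreover have "mem s2 (T + w) < Q" if "w < h" for w
        using that I \<open>v < Q\<close> \<open>mem s2 = _\<close> by (auto simp: I_def)
      ultimately show ?thesis using that by (simp add: I_def)
    qed
    show "wp b INNER_body s' (\<lambda>s2 m. I (Suc k) s2 \<and> m \<le> time_mul + time_xor + 38)"
      unfolding INNER_body_def using big env' ad c I1 1 kb
      apply (simp add: arith_simps)
      apply (rule MUL_wp XOR_wp | simp add: arith_simps env_def)+
      apply (rule step)
            apply (simp_all add: mem_set_mem_fun x_def[symmetric])
      done
  next
    show "i * (time_mul + time_xor + 38 + 2) + 1 \<le> time_inner"
      unfolding time_inner_def using i by (intro add_right_mono mult_le_mono) simp_all
  next
    fix s' m assume I: "I i s'" and m: "m \<le> time_inner"
    have "ev (mem s') T h y + phi z x * y ^ h = ev (mem s) T h y + phi z x * subspace_poly z i y" for y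
    proof -
      have "subspace_poly z i y = (\<Sum>j<i. subspace_coeff z i j * y ^ (2 ^ j)) + y ^ h"
        by (simp add: subspace_poly_def h_def subspace_coeff_top flip: lessThan_Suc_atMost)
      then show ?thesis using I by (simp add: I_def algebra_simps)
    qed
    then show "m \<le> time_inner \<and>
    (\<forall>a. a < T \<or> T + 2 ^ i \<le> a \<longrightarrow> mem s' a = mem s a) \<and> (\<forall>r<47. regs s' r = regs s r) \<and>
    (\<forall>w<2 ^ i. mem s' (T + w) < Q) \<and>
    (\<forall>y. ev (mem s') T (2 ^ i) y + phi z (regs s 46) * y ^ (2 ^ i) =
       ev (mem s) T (2 ^ i) y + phi z (regs s 46) * subspace_poly z i y)"
      using I m unfolding I_def h_def x_def by blast
  next
    fix s' assume "I i s'" then show "\<not> cond_val b (Less (Reg 47) (Reg 40)) s'" using 1 by (simp add: I_def)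
  qed (use 1 Qs in \<open>auto simp: I_def h_def\<close>)
qed

lemma DIVIDE_loop_spec:
  assumes env: "env s" and tab: "table (mem s) e" and i: "i \<le> e" and G: "BA \<le> G" "G + h + h \<le> BA + L"
    and h: "h = 2 ^ i" and Qs: "\<forall>w<h + h. mem s (G + w) < Q"
    and 1: "regs s 40 = i" "regs s 41 = h" "regs s 43 = h + h" "regs s 44 = G"
  shows "wp b DIVIDE_loop s (\<lambda>s' m. m \<le> h * (time_inner + 40) + 1 \<and>
    (\<forall>a. a < G \<or> G + h + h \<le> a \<longrightarrow> mem s' a = mem s a) \<and> (\<forall>r<43. regs s' r = regs s r) \<and> regs s' 44 = G \<and>
    (\<forall>w<h + h. mem s' (G + w) < Q) \<and>
    (\<forall>y. ev (mem s') G h y + subspace_poly z i y * ev (mem s') (G + h) h y = ev (mem s) G (h + h) y))"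
proof -
  note env' = env[unfolded env_def]
  \<comment> \<open>After \<open>k\<close> rounds the top \<open>k\<close> cells are the quotient
    coefficients of degrees \<open>h - k\<close> to \<open>h - 1\<close>, whence the factor
    \<open>y ^ (h - k)\<close>.\<close>
  define I where "I k s' \<longleftrightarrow> (\<forall>a. a < G \<or> G + h + h \<le> a \<longrightarrow> mem s' a = mem s a) \<and> (\<forall>r<43. regs s' r = regs s r) \<and>
    regs s' 43 = h + (h - k) \<and> regs s' 44 = G \<and> (\<forall>w<h + h. mem s' (G + w) < Q) \<and>
    (\<forall>y. ev (mem s') G (h + (h - k)) y + subspace_poly z i y * (y ^ (h - k) * ev (mem s') (G + (h + (h - k))) k y) =
      ev (mem s) G (h + h) y)"
    for k and s' :: ram_state
  show ?thesis unfolding DIVIDE_loop_def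
  proof (rule wp_while_bound[where K = h and B = "time_inner + 38" and I = I])
    show "I 0 s" using 1 Qs by (simp add: I_def ev_def)
  next
    fix k s' assume k: "k < h" and I: "I k s'"
    show "cond_val b (Less (Reg 41) (Reg 43)) s'" using I k 1 by (simp add: I_def)
    define c where "c = h - Suc k"
    have hk: "h - k = Suc c" "c < h" using k by (auto simp: c_def)
    have I1: "\<forall>r<43. regs s' r = regs s r" "regs s' 43 = Suc (h + c)" "regs s' 44 = G" "mem s' (G + (h + c)) < Q"
      using I hk by (simp_all add: I_def)
    have ad: "G + (h + c) < 2 ^ b" "h + c < 2 ^ b" "G + (h + c) - h = G + c" "Suc (h + c) < 2 ^ b"
      using G hk layout by linarith+
    have ad2: "i * Suc e < 2 ^ b" "i * Suc e + BS < 2 ^ b"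
      using table_address_bound[OF i, of 0] address_less(1) i by linarith+
    have tab': "table (mem s') e"
      using tab by (rule table_cong[THEN iffD1, rotated 2]) (use I G layout in \<open>auto simp: I_def\<close>)
    have step: "I (Suc k) s2"
      if fr: "\<forall>a. a < G + c \<or> G + c + 2 ^ i \<le> a \<longrightarrow> mem s2 a = mem s' a"
        and rg: "\<forall>r<43. regs s2 r = regs s r" "regs s2 43 = h + c" "regs s2 44 = G"
        and q: "\<forall>w<2 ^ i. mem s2 (G + c + w) < Q"
        and v: "\<forall>y. ev (mem s2) (G + c) (2 ^ i) y + phi z (mem s' (G + (h + c))) * y ^ (2 ^ i) =
          ev (mem s') (G + c) (2 ^ i) y + phi z (mem s' (G + (h + c))) * subspace_poly z i y" for s2
    proof -
      have c': "h - Suc k = c" by (simp add: c_def)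
      have "ev (mem s2) G (h + c) y + subspace_poly z i y * (y ^ c * ev (mem s2) (G + (h + c)) (Suc k) y) =
        ev (mem s) G (h + h) y" for y
      proof -
        let ?x = "phi z (mem s' (G + (h + c)))"
        have hi: "ev (mem s2) (G + (h + c)) (Suc k) y = ?x + y * ev (mem s') (G + (h + Suc c)) k y"
        proof -
          have "ev (mem s2) (G + (h + c)) (Suc k) y = ev (mem s') (G + (h + c)) (Suc k) y"
            using fr by (intro ev_cong) (simp add: h)
          also have "\<dots> = ev (mem s') (G + (h + c)) (1 + k) y" by simp
          also have "\<dots> = ?x + y * ev (mem s') (G + (h + Suc c)) k y"
            unfolding ev_split by (simp add: ev_def)
          finally show ?thesis .
        qed
        have lo: "ev M G (h + c) y = ev M G c y + y ^ c * ev M (G + c) h y" for M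
          using ev_split[of M G c h y] by (simp add: add.commute)
        have lo2: "ev (mem s2) G c y = ev (mem s') G c y" using fr by (intro ev_cong) simp
        have lo3: "ev (mem s') G (h + Suc c) y = ev (mem s') G (h + c) y + y ^ (h + c) * ?x"
          using ev_split[of "mem s'" G "h + c" 1 y] by (simp add: ev_def)
        have v': "ev (mem s2) (G + c) h y = ev (mem s') (G + c) h y + ?x * subspace_poly z i y + ?x * y ^ h"
          using v h by (metis add.assoc add_self add.right_neutral)
        have "ev (mem s) G (h + h) y = ev (mem s') G (h + Suc c) y +
            subspace_poly z i y * (y ^ Suc c * ev (mem s') (G + (h + Suc c)) k y)"
          using I unfolding I_def hk by metis
        then show ?thesis
          unfolding lo[of "mem s2"] lo2 v' hi lo3 lo[of "mem s'"] by (simp add: algebra_simps power_add)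
      qed
      moreover have "mem s2 a = mem s a" if "a < G \<or> G + h + h \<le> a" for a
      proof -
        have "a < G + c \<or> G + c + 2 ^ i \<le> a" using that hk(2) h by linarith
        then have "mem s2 a = mem s' a" using fr by blast
        also have "\<dots> = mem s a" using that I unfolding I_def by blast
        finally show ?thesis .
      qed
      moreover have "mem s2 (G + w) < Q" if "w < h + h" for w
      proof (cases "c \<le> w \<and> w < c + h")
        case True
        then have "w - c < 2 ^ i" using h by linarith
        then have "mem s2 (G + c + (w - c)) < Q" using q by blast
        then show ?thesis using True by simp
      next
        case False
        then have "mem s2 (G + w) = mem s' (G + w)" using fr h by auto
        then show ?thesis using I that by (simp add: I_def)
      qed
      ultimately show ?thesis using rg unfolding I_def c' by blast
    qed
    have INNER: "wp b INNER_loop s1 R"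
      if "env s1" "mem s1 = mem s'" "regs s1 40 = i" "regs s1 45 = G + c" "regs s1 46 = mem s' (G + (h + c))"
        "regs s1 47 = 0" "regs s1 48 = i * Suc e + BS" "regs s1 49 = 1"
        and R: "\<And>s2 m. m \<le> time_inner \<Longrightarrow> \<forall>a. a < G + c \<or> G + c + 2 ^ i \<le> a \<longrightarrow> mem s2 a = mem s' a \<Longrightarrow>
           \<forall>r<47. regs s2 r = regs s1 r \<Longrightarrow> \<forall>w<2 ^ i. mem s2 (G + c + w) < Q \<Longrightarrow>
           \<forall>y. ev (mem s2) (G + c) (2 ^ i) y + phi z (mem s' (G + (h + c))) * y ^ (2 ^ i) =
            ev (mem s') (G + c) (2 ^ i) y + phi z (mem s' (G + (h + c))) * subspace_poly z i y \<Longrightarrow> R s2 m"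
      for s1 R
    proof (rule wp_mono[OF INNER_loop_spec[where i = i and T = "G + c"]])
      show "\<forall>w<2 ^ i. mem s1 (G + c + w) < Q"
        using I that(2) hk h unfolding I_def by (auto simp: add.assoc)
      show "G + c + 2 ^ i \<le> BA + L" using G hk h by linarith
    qed (use that i tab' G I1 in simp_all)
    show "wp b DIVIDE_body s' (\<lambda>s2 m. I (Suc k) s2 \<and> m \<le> time_inner + 38)"
      unfolding DIVIDE_body_def using big env' ad ad2 I1 1
      apply (simp add: arith_simps)
      apply (rule INNER)
                 apply (simp_all add: env_def step)
      done
  next
    fix s' m assume I: "I h s'" and m: "m \<le> h * (time_inner + 40) + 1"
    then show "m \<le> h * (time_inner + 40) + 1 \<and>
    (\<forall>a. a < G \<or> G + h + h \<le> a \<longrightarrow> mem s' a = mem s a) \<and> (\<forall>r<43. regs s' r = regs s r) \<and> regs s' 44 = G \<and>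
    (\<forall>w<h + h. mem s' (G + w) < Q) \<and>
    (\<forall>y. ev (mem s') G h y + subspace_poly z i y * ev (mem s') (G + h) h y = ev (mem s) G (h + h) y)"
      unfolding I_def by simp
  next
    show "h * (time_inner + 38 + 2) + 1 \<le> h * (time_inner + 40) + 1" by simp
  next
    fix s' assume "I h s'" then show "\<not> cond_val b (Less (Reg 41) (Reg 43)) s'" using 1 by (simp add: I_def)
  qed
qed

end

text \<open>Register 42 is the offset of a block of length \<open>2 * h\<close> in the whole array.
  Reduced modulo \<open>N\<close> it is also the word naming the coset of the left half; adding
  \<open>h\<close> names that of the right half.\<close>

definition "LEVEL_body =
  Arith 43 Add (Reg 41) (Reg 41) ;; Arith 44 Add (Reg 12) (Reg 42) ;; DIVIDE_loop ;;
  MOV 60 (Reg 40) ;; Arith 61 Defs.arith_op.Mod (Reg 42) (Reg 4) ;; SEVAL ;; MOV 51 (Reg 62) ;;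
  MOV 60 (Reg 40) ;; Arith 61 Defs.arith_op.Mod (Reg 42) (Reg 4) ;; Arith 61 Add (Reg 61) (Reg 41) ;; SEVAL ;; MOV 52 (Reg 62) ;;
  MOV 43 (Const 0) ;; MOV 45 (Reg 44) ;; Arith 46 Add (Reg 44) (Reg 41) ;; BFLY_loop ;;
  Arith 42 Add (Reg 42) (Reg 41) ;; Arith 42 Add (Reg 42) (Reg 41)"

definition "LEVEL_loop = While (Less (Reg 42) (Reg 13)) LEVEL_body"

definition "FFT_body =
  Arith 40 Sub (Reg 40) (Const 1) ;; Arith 41 Div (Reg 41) (Const 2) ;; MOV 42 (Const 0) ;; LEVEL_loop"

definition "FFT_loop = While (Less (Const 0) (Reg 40)) FFT_body"

definition "FFT = MOV 40 (Reg 5) ;; MOV 41 (Reg 4) ;; FFT_loop"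

context machine
begin

definition "time_block = time_inner + 2 * time_mul + 2 * time_xor + 2 * time_seval + 170"
definition "time_fft = e * (L * (time_block + 2) + 12) + 10"

text \<open>Invariant of the transform: the block of length \<open>2 ^ i\<close> at offset
  \<open>q * 2 ^ i\<close> agrees with the original polynomial on one coset of the span of the first
  \<open>i\<close> powers of \<open>z\<close>. The coset is described by the value of
  \<open>subspace_poly z i\<close>. All \<open>n * n\<close> polynomials lie one after the other,
  each of length \<open>N\<close>.\<close>

definition level :: "(nat \<Rightarrow> nat) \<Rightarrow> nat \<Rightarrow> (nat \<Rightarrow> nat) \<Rightarrow> bool" where
  "level M0 i M \<longleftrightarrow> (\<forall>q y. q * 2 ^ i < L \<longrightarrow>
     subspace_poly z i y = subspace_poly z i (phi z ((q * 2 ^ i) mod N)) \<longrightarrow>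
     ev M (BA + q * 2 ^ i) (2 ^ i) y = ev M0 (BA + (q * 2 ^ i) div N * N) N y)"

text \<open>Passing from the left to the right half of a block sets a bit that was 0, so the field
  element moves by \<open>z ^ i\<close>.\<close>

lemma phi_set_bit: "phi z (2 ^ Suc i * q + 2 ^ i) = phi z (2 ^ Suc i * q) + z ^ i"
proof -
  have 1: "phi z (2 ^ i * m) = z ^ i * phi z m" for m using phi_add_high[of 0 i z m] by simp
  have "2 ^ Suc i * q + 2 ^ i = 2 ^ i * (1 + 2 * q)" by (simp add: algebra_simps mult_Suc_right)
  then have "phi z (2 ^ Suc i * q + 2 ^ i) = z ^ i * phi z (1 + 2 * q)" by (simp only: 1)
  also have "phi z (1 + 2 * q) = 1 + phi z (2 * q)"
    by (simp add: phi_double phi_rec[of z "Suc (2 * q)"])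
  also have "z ^ i * (1 + phi z (2 * q)) = phi z (2 ^ i * (2 * q)) + z ^ i"
    by (simp only: 1) (simp add: algebra_simps)
  finally show ?thesis by (simp add: ac_simps)
qed

end

context sized_machine
begin

lemma BFLY_loop_spec:
  assumes env: "env s" and G: "BA \<le> G" "G + h + h \<le> BA + L"
    and Qs: "\<forall>w<h + h. mem s (G + w) < Q"
    and 1: "regs s 41 = h" "regs s 43 = 0" "regs s 45 = G" "regs s 46 = G + h" "regs s 51 < Q" "regs s 52 < Q"
  shows "wp b BFLY_loop s (\<lambda>s' m. m \<le> h * (2 * time_mul + 2 * time_xor + 80) + 1 \<and>
    (\<forall>a. a < G \<or> G + h + h \<le> a \<longrightarrow> mem s' a = mem s a) \<and> (\<forall>r<43. regs s' r = regs s r) \<and>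
    (\<forall>w<h + h. mem s' (G + w) < Q) \<and>
    (\<forall>y. ev (mem s') G h y = ev (mem s) G h y + phi z (regs s 51) * ev (mem s) (G + h) h y) \<and>
    (\<forall>y. ev (mem s') (G + h) h y = ev (mem s) G h y + phi z (regs s 52) * ev (mem s) (G + h) h y))"
proof -
  note env' = env[unfolded env_def]
  define lo hi where "lo w = phi z (mem s (G + w))" and "hi w = phi z (mem s (G + h + w))" for w
  define I where "I k s' \<longleftrightarrow> (\<forall>a. a < G \<or> G + h + h \<le> a \<longrightarrow> mem s' a = mem s a) \<and> (\<forall>r<43. regs s' r = regs s r) \<and>
    regs s' 43 = k \<and> regs s' 45 = G + k \<and> regs s' 46 = G + h + k \<and> regs s' 51 = regs s 51 \<and> regs s' 52 = regs s 52 \<and>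
    (\<forall>w<h. mem s' (G + w) < Q \<and> mem s' (G + h + w) < Q \<and>
      phi z (mem s' (G + w)) = (if w < k then lo w + phi z (regs s 51) * hi w else lo w) \<and>
      phi z (mem s' (G + h + w)) = (if w < k then lo w + phi z (regs s 52) * hi w else hi w))"
    for k and s' :: ram_state
  show ?thesis unfolding BFLY_loop_def
  proof (rule wp_while_bound[where K = h and B = "2 * time_mul + 2 * time_xor + 78" and I = I])
    show "I 0 s" using 1 Qs by (simp add: I_def lo_def hi_def add.assoc)
  next
    fix k s' assume k: "k < h" and I: "I k s'"
    show "cond_val b (Less (Reg 43) (Reg 41)) s'" using I k 1 by (simp add: I_def)
    have ad: "G + k + 1 < 2 ^ b" "G + h + k + 1 < 2 ^ b" "k + 1 < 2 ^ b"
      using k G layout N_bounds by linarith+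
    have I1: "\<forall>r<43. regs s' r = regs s r" "regs s' 43 = k" "regs s' 45 = G + k" "regs s' 46 = G + h + k"
        "regs s' 51 = regs s 51" "regs s' 52 = regs s 52"
        "mem s' (G + k) < Q" "mem s' (G + h + k) < Q" "phi z (mem s' (G + k)) = lo k" "phi z (mem s' (G + h + k)) = hi k"
      using I k by (simp_all add: I_def)
    have step: "I (Suc k) s2"
      if "\<forall>r<43. regs s2 r = regs s r" "regs s2 43 = Suc k" "regs s2 45 = Suc (G + k)" "regs s2 46 = Suc (G + h + k)"
        "regs s2 51 = regs s 51" "regs s2 52 = regs s 52"
        "u < Q" "v < Q" "phi z u = lo k + phi z (regs s 51) * hi k" "phi z v = lo k + phi z (regs s 52) * hi k"
        "mem s2 = (mem s')(G + k := u, G + h + k := v)" for s2 u v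
    proof -
      have "mem s2 a = mem s a" if "a < G \<or> G + h + h \<le> a" for a
      proof -
        have "a \<noteq> G + k" "a \<noteq> G + h + k" using that k by linarith+
        then have "mem s2 a = mem s' a" using \<open>mem s2 = _\<close> by simp
        then show ?thesis using that I unfolding I_def by metis
      qed
      moreover have "mem s2 (G + w) < Q \<and> mem s2 (G + h + w) < Q \<and>
        phi z (mem s2 (G + w)) = (if w < Suc k then lo w + phi z (regs s 51) * hi w else lo w) \<and>
        phi z (mem s2 (G + h + w)) = (if w < Suc k then lo w + phi z (regs s 52) * hi w else hi w)" if w: "w < h" for w
      proof -
        have m: "mem s2 (G + w) = (if w = k then u else mem s' (G + w))"
          "mem s2 (G + h + w) = (if w = k then v else mem s' (G + h + w))"
          using \<open>mem s2 = _\<close> w k by simp_all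
        show ?thesis using I w that \<open>u < Q\<close> \<open>v < Q\<close> \<open>phi z u = _\<close> \<open>phi z v = _\<close> unfolding I_def m
          by (auto simp: less_Suc_eq)
      qed
      ultimately show ?thesis using that by (simp add: I_def)
    qed
    have neq: "G + h + k \<noteq> G + k" using k by simp
    show "wp b BFLY_body s' (\<lambda>s2 m. I (Suc k) s2 \<and> m \<le> 2 * time_mul + 2 * time_xor + 78)"
      unfolding BFLY_body_def using big env' ad I1 1(5,6)
      apply (simp add: arith_simps)
      apply (rule MUL_wp XOR_wp | simp add: arith_simps env_def)+
      apply (rule step)
                apply (simp_all add: mem_set_mem_fun)
      done
  next
    fix s' m assume I: "I h s'" and m: "m \<le> h * (2 * time_mul + 2 * time_xor + 80) + 1"
    have "ev (mem s') G h y = ev (mem s) G h y + phi z (regs s 51) * ev (mem s) (G + h) h y" for y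
      using I unfolding I_def ev_def by (simp add: lo_def hi_def sum_distrib_left sum.distrib[symmetric] algebra_simps)
    moreover have "ev (mem s') (G + h) h y = ev (mem s) G h y + phi z (regs s 52) * ev (mem s) (G + h) h y" for y
      using I unfolding I_def ev_def by (simp add: lo_def hi_def sum_distrib_left sum.distrib[symmetric] algebra_simps)
    moreover have "mem s' (G + w) < Q" if "w < h + h" for w
    proof (cases "w < h")
      case True
      then show ?thesis using I unfolding I_def by blast
    next
      case False
      then have "w - h < h" using that by linarith
      then have "mem s' (G + h + (w - h)) < Q" using I unfolding I_def by blast
      then show ?thesis using False by simp
    qed
    ultimately show "m \<le> h * (2 * time_mul + 2 * time_xor + 80) + 1 \<and>
    (\<forall>a. a < G \<or> G + h + h \<le> a \<longrightarrow> mem s' a = mem s a) \<and> (\<forall>r<43. regs s' r = regs s r) \<and>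
    (\<forall>w<h + h. mem s' (G + w) < Q) \<and>
    (\<forall>y. ev (mem s') G h y = ev (mem s) G h y + phi z (regs s 51) * ev (mem s) (G + h) h y) \<and>
    (\<forall>y. ev (mem s') (G + h) h y = ev (mem s) G h y + phi z (regs s 52) * ev (mem s) (G + h) h y)"
      using I m unfolding I_def by blast
  next
    show "h * (2 * time_mul + 2 * time_xor + 78 + 2) + 1 \<le> h * (2 * time_mul + 2 * time_xor + 80) + 1" by simp
  next
    fix s' assume "I h s'" then show "\<not> cond_val b (Less (Reg 43) (Reg 41)) s'" using 1 by (simp add: I_def)
  qed
qed

end

context sized_machine
begin

text \<open>The division is an identity for all \<open>y\<close>. Replacing
  \<open>subspace_poly z i y\<close> by its value at one point is sound on the coset of that point,
  hence the premises in the last two conclusions.\<close>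

lemma LEVEL_body_spec:
  assumes env: "env s" and tab: "table (mem s) e" and i: "i < e"
    and h: "h = 2 ^ i" and c: "c mod N + h < N" "c + h + h \<le> L" and Qs: "\<forall>a<L. mem s (BA + a) < Q"
    and 1: "regs s 40 = i" "regs s 41 = h" "regs s 42 = c"
  shows "wp b LEVEL_body s (\<lambda>s' m. m \<le> h * time_block \<and>
    (\<forall>a. a < BA + c \<or> BA + c + h + h \<le> a \<longrightarrow> mem s' a = mem s a) \<and> (\<forall>r<42. regs s' r = regs s r) \<and>
    regs s' 42 = c + h + h \<and> (\<forall>a<L. mem s' (BA + a) < Q) \<and>
    (\<forall>y. subspace_poly z i y = subspace_poly z i (phi z (c mod N)) \<longrightarrow>
       ev (mem s') (BA + c) h y = ev (mem s) (BA + c) (h + h) y) \<and>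
    (\<forall>y. subspace_poly z i y = subspace_poly z i (phi z (c mod N + h)) \<longrightarrow>
       ev (mem s') (BA + c + h) h y = ev (mem s) (BA + c) (h + h) y))"
proof -
  note env' = env[unfolded env_def]
  define G where "G = BA + c"
  have G: "BA \<le> G" "G + h + h \<le> BA + L" using c by (auto simp: G_def)
  have tab': "table M e" if "\<forall>a. a < G \<or> G + h + h \<le> a \<longrightarrow> M a = mem s a" for M
    using tab by (rule table_cong[THEN iffD1, rotated 2]) (use that G layout in auto)
  have Qs': "\<forall>w<h + h. mem s (G + w) < Q"
  proof (intro allI impI)
    fix w assume "w < h + h"
    then have "c + w < L" using c by linarith
    then show "mem s (G + w) < Q" using Qs by (simp add: G_def add.assoc)
  qed
  have DIVIDE: "wp b DIVIDE_loop s1 R"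
    if "env s1" "mem s1 = mem s" "regs s1 40 = i" "regs s1 41 = h" "regs s1 43 = h + h" "regs s1 44 = G"
      and R: "\<And>s2 m. m \<le> h * (time_inner + 40) + 1 \<Longrightarrow>
        \<forall>a. a < G \<or> G + h + h \<le> a \<longrightarrow> mem s2 a = mem s a \<Longrightarrow> \<forall>r<43. regs s2 r = regs s1 r \<Longrightarrow> regs s2 44 = G \<Longrightarrow>
        \<forall>w<h + h. mem s2 (G + w) < Q \<Longrightarrow>
        \<forall>y. ev (mem s2) G h y + subspace_poly z i y * ev (mem s2) (G + h) h y = ev (mem s) G (h + h) y \<Longrightarrow>
        table (mem s2) e \<Longrightarrow> R s2 m" for s1 R
    by (rule wp_mono[OF DIVIDE_loop_spec[where i = i and G = G and h = h]])
      (use that tab i G h Qs' tab' in \<open>simp_all\<close>)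
  have BFLY: "wp b BFLY_loop s1 R"
    if "env s1" "regs s1 41 = h" "regs s1 43 = 0" "regs s1 45 = G" "regs s1 46 = G + h" "regs s1 51 < Q" "regs s1 52 < Q"
      "\<forall>w<h + h. mem s1 (G + w) < Q"
      and R: "\<And>s2 m. m \<le> h * (2 * time_mul + 2 * time_xor + 80) + 1 \<Longrightarrow>
        \<forall>a. a < G \<or> G + h + h \<le> a \<longrightarrow> mem s2 a = mem s1 a \<Longrightarrow> \<forall>r<43. regs s2 r = regs s1 r \<Longrightarrow>
        \<forall>w<h + h. mem s2 (G + w) < Q \<Longrightarrow>
        \<forall>y. ev (mem s2) G h y = ev (mem s1) G h y + phi z (regs s1 51) * ev (mem s1) (G + h) h y \<Longrightarrow>
        \<forall>y. ev (mem s2) (G + h) h y = ev (mem s1) G h y + phi z (regs s1 52) * ev (mem s1) (G + h) h y \<Longrightarrow> R s2 m" for s1 R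
    by (rule wp_mono[OF BFLY_loop_spec[where G = G and h = h]]) (use that G in simp_all)
  have ad: "h + h < 2 ^ b" "BA + c < 2 ^ b" "c mod N < 2 ^ b" "c mod N + h < 2 ^ b" "G + h < 2 ^ b" "c + h + h < 2 ^ b" "i < b"
      "c + h < 2 ^ b" "i < 2 ^ b" "BA + c = G"
    using c layout G e_less_b i e_bound by (auto simp: G_def)
  have aq: "c mod N < Q" "c mod N + h < Q" using c N_bounds by linarith+
  have fin: "h * (time_inner + 40) + 1 + 2 * time_seval + h * (2 * time_mul + 2 * time_xor + 80) + 1 + 42 \<le> h * time_block"
  proof -
    have "1 * (2 * time_seval + 44) \<le> h * (2 * time_seval + 44)" by (intro mult_right_mono) (simp_all add: h)
    then show ?thesis by (simp add: time_block_def algebra_simps)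
  qed
  have post: "(\<forall>a. a < BA + c \<or> BA + c + h + h \<le> a \<longrightarrow> mem s2 a = mem s a) \<and> (\<forall>a<L. mem s2 (BA + a) < Q) \<and>
    (\<forall>y. subspace_poly z i y = subspace_poly z i (phi z (c mod N)) \<longrightarrow>
       ev (mem s2) (BA + c) h y = ev (mem s) (BA + c) (h + h) y) \<and>
    (\<forall>y. subspace_poly z i y = subspace_poly z i (phi z (c mod N + h)) \<longrightarrow>
       ev (mem s2) (BA + c + h) h y = ev (mem s) (BA + c) (h + h) y)"
    if "\<forall>a. a < G \<or> G + h + h \<le> a \<longrightarrow> M a = mem s a"
      "\<forall>y. ev M G h y + subspace_poly z i y * ev M (G + h) h y = ev (mem s) G (h + h) y"
      "\<forall>a. a < G \<or> G + h + h \<le> a \<longrightarrow> mem s2 a = M a" "\<forall>w<h + h. mem s2 (G + w) < Q"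
      "\<forall>y. ev (mem s2) G h y = ev M G h y + subspace_poly z i (phi z (c mod N)) * ev M (G + h) h y"
      "\<forall>y. ev (mem s2) (G + h) h y = ev M G h y + subspace_poly z i (phi z (c mod N + h)) * ev M (G + h) h y" for s2 M
    unfolding G_def[symmetric]
  proof (intro conjI allI impI)
    show "mem s2 a = mem s a" if "a < G \<or> G + h + h \<le> a" for a
      using that \<open>\<forall>a. _ \<longrightarrow> M a = mem s a\<close> \<open>\<forall>a. _ \<longrightarrow> mem s2 a = M a\<close> by metis
    then have *: "mem s2 (BA + a) = mem s (BA + a)" if "BA + a < G \<or> G + h + h \<le> BA + a" for a using that by blast
    show "mem s2 (BA + a) < Q" if "a < L" for a
    proof (cases "BA + a < G \<or> G + h + h \<le> BA + a")
      case True
      then show ?thesis using *[of a] Qs that by simp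
    next
      case False
      then have "BA + a - G < h + h" "BA + a = G + (BA + a - G)" using G by linarith+
      then show ?thesis using \<open>\<forall>w<h + h. mem s2 (G + w) < Q\<close> by metis
    qed
  qed (use that in metis)+
  show ?thesis
    unfolding LEVEL_body_def using big env' ad aq 1 i
    apply (simp add: arith_simps)
    apply (rule DIVIDE)
          apply (simp_all add: env_def)
    apply (rule SEVAL_wp[where j = e])
         apply (simp_all add: env_def arith_simps)
    apply (rule SEVAL_wp[where j = e])
         apply (simp_all add: env_def arith_simps)
    apply (rule BFLY)
            apply (simp_all add: env_def arith_simps)
    subgoal premises p for s1 m1 s2 m2 s3 m3 s4 m4
      using post[of "mem s1" s4] fin p
      by (simp add: add.assoc)
    done
qed

end

context sized_machine
begin

lemma LEVEL_loop_spec: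
  assumes env: "env s" and tab: "table (mem s) e" and i: "i < e"
    and lev: "level M0 (Suc i) (mem s)" and Qs: "\<forall>a<L. mem s (BA + a) < Q"
    and 1: "regs s 40 = i" "regs s 41 = 2 ^ i" "regs s 42 = 0"
  shows "wp b LEVEL_loop s (\<lambda>s' m. m \<le> L * (time_block + 2) + 1 \<and>
    (\<forall>a. a < BA \<or> BA + L \<le> a \<longrightarrow> mem s' a = mem s a) \<and> (\<forall>r<42. regs s' r = regs s r) \<and>
    (\<forall>a<L. mem s' (BA + a) < Q) \<and> level M0 i (mem s'))"
proof -
  note env' = env[unfolded env_def]
  define h where "h = (2 :: nat) ^ i"
  define r where "r = (2 :: nat) ^ (e - Suc i)"
  have hpos: "0 < h" by (simp add: h_def)
  have N: "N = (h + h) * r"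
    using i by (simp add: N_def h_def r_def flip: mult_2 power_Suc power_add)
  define K where "K = n * n * r"
  have L: "L = K * (h + h)" by (simp add: L_def K_def N)
  define orig where "orig a = ev M0 (BA + a div N * N) N" for a
  define I where "I k s' \<longleftrightarrow> (\<forall>a. a < BA \<or> BA + k * (h + h) \<le> a \<longrightarrow> mem s' a = mem s a) \<and>
    (\<forall>r<42. regs s' r = regs s r) \<and> regs s' 42 = k * (h + h) \<and> (\<forall>a<L. mem s' (BA + a) < Q) \<and>
    (\<forall>q y. q < k + k \<longrightarrow> subspace_poly z i y = subspace_poly z i (phi z (q * h mod N)) \<longrightarrow>
       ev (mem s') (BA + q * h) h y = orig (q * h) y)" for k and s' :: ram_state
  have per_block: "h * time_block + 2 \<le> h * (time_block + 2)" using hpos by (simp add: mult_Suc_right)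
  show ?thesis unfolding LEVEL_loop_def
  proof (rule wp_while_bound[where K = K and B = "h * time_block" and I = I])
    show "I 0 s" using Qs 1 by (simp add: I_def)
  next
    fix k s' assume k: "k < K" and I: "I k s'"
    define c where "c = k * (h + h)"
    have "Suc k * (h + h) \<le> K * (h + h)" using k by (intro mult_right_mono) auto
    then have cL: "c + h + h \<le> L" by (simp add: L c_def)
    show "cond_val b (Less (Reg 42) (Reg 13)) s'"
      using I env' cL hpos by (simp add: I_def c_def)
    \<comment> \<open>\<open>2 * h\<close> divides \<open>N\<close>, so a block never straddles two
      polynomials and adding \<open>h\<close> to its offset carries neither into the quotient nor
      past the modulus.\<close>
    have cmod: "c mod N = (h + h) * (k mod r)"
      unfolding N c_def mult.commute[of k] by (rule mult_mod_right[symmetric])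
    have "Suc (k mod r) \<le> r" by (simp add: Suc_le_eq r_def)
    then have "(h + h) * Suc (k mod r) \<le> N" unfolding N by (rule mult_left_mono) simp
    then have cN: "c mod N + h + h \<le> N" by (simp add: cmod mult_Suc_right)
    then have ch: "(c + h) mod N = c mod N + h" "(c + h) div N = c div N"
    proof -
      have less: "c mod N + h < N" using cN hpos by linarith
      then have "h < N" by linarith
      show "(c + h) mod N = c mod N + h"
        using less mod_add_left_eq[of c N h] by simp
      show "(c + h) div N = c div N"
        using less \<open>h < N\<close> div_add1_eq[of c h N] by simp
    qed
    have tab': "table (mem s') e"
      using tab by (rule table_cong[THEN iffD1, rotated 2]) (use I layout in \<open>auto simp: I_def\<close>)
    have parent: "ev (mem s') (BA + c) (h + h) y = orig c y"
      if "subspace_poly z (Suc i) y = subspace_poly z (Suc i) (phi z (c mod N))" for y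
    proof -
      have c2: "k * 2 ^ Suc i = c" "2 ^ Suc i = h + h" by (simp_all add: c_def h_def)
      have "ev (mem s) (BA + c) (h + h) y = orig c y"
        using lev[unfolded level_def, rule_format, of k y, unfolded c2(1), unfolded c2(2)] that cL hpos
        unfolding orig_def by simp
      moreover have "ev (mem s') (BA + c) (h + h) y = ev (mem s) (BA + c) (h + h) y"
        using I by (intro ev_cong) (simp add: I_def c_def)
      ultimately show ?thesis by simp
    qed
    \<comment> \<open>The next polynomial is a function of the current one, so each coset at level
      \<open>i\<close> lies within one at level \<open>Suc i\<close>.\<close>
    have pr: "subspace_poly z (Suc i) y = subspace_poly z (Suc i) x"
      if "subspace_poly z i y = subspace_poly z i x" for x y
      using that by (simp add: subspace_poly_Suc)
    have bit: "phi z (c mod N + h) = phi z (c mod N) + z ^ i"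
      using phi_set_bit[of i "k mod r"] unfolding cmod h_def by (simp add: mult_2)
    \<comment> \<open>Both halves descend from the same coset, because \<open>z ^ i\<close> is a
      root of \<open>subspace_poly z (Suc i)\<close>.\<close>
    have sh: "subspace_poly z (Suc i) (phi z (c mod N + h)) = subspace_poly z (Suc i) (phi z (c mod N))"
      unfolding bit by (simp add: subspace_poly_add subspace_poly_basis)
    have step: "I (Suc k) s2"
      if fr: "\<forall>a. a < BA + c \<or> BA + c + h + h \<le> a \<longrightarrow> mem s2 a = mem s' a" and rg: "\<forall>r<42. regs s2 r = regs s' r"
        and r42: "regs s2 42 = c + h + h" and q: "\<forall>a<L. mem s2 (BA + a) < Q"
        and left: "\<forall>y. subspace_poly z i y = subspace_poly z i (phi z (c mod N)) \<longrightarrow>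
           ev (mem s2) (BA + c) h y = ev (mem s') (BA + c) (h + h) y"
        and right: "\<forall>y. subspace_poly z i y = subspace_poly z i (phi z (c mod N + h)) \<longrightarrow>
           ev (mem s2) (BA + c + h) h y = ev (mem s') (BA + c) (h + h) y" for s2
      unfolding I_def
    proof (intro conjI allI impI)
      have ck: "Suc k * (h + h) = c + h + h" by (simp add: c_def)
      show "mem s2 a = mem s a" if "a < BA \<or> BA + Suc k * (h + h) \<le> a" for a
      proof -
        have "mem s2 a = mem s' a" using fr that unfolding ck by auto
        also have "\<dots> = mem s a" using I that unfolding I_def ck c_def by auto
        finally show ?thesis .
      qed
      show "regs s2 r = regs s r" if "r < 42" for r using rg I that by (simp add: I_def)
      show "regs s2 42 = Suc k * (h + h)" using r42 ck by simp
      show "mem s2 (BA + a) < Q" if "a < L" for a using q that by simp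
      fix p y assume p: "p < Suc k + Suc k"
        and y: "subspace_poly z i y = subspace_poly z i (phi z (p * h mod N))"
      consider "p < k + k" | "p = k + k" | "p = Suc (k + k)" using p by linarith
      then show "ev (mem s2) (BA + p * h) h y = orig (p * h) y"
      proof cases
        case 1
        then have "Suc p * h \<le> (k + k) * h" by (intro mult_right_mono) auto
        then have "p * h + h \<le> c" by (simp add: c_def algebra_simps mult_Suc_right)
        then have "ev (mem s2) (BA + p * h) h y = ev (mem s') (BA + p * h) h y"
          using fr by (intro ev_cong) simp
        then show ?thesis using I 1 y by (simp add: I_def)
      next
        case 2
        then have ph: "p * h = c" by (simp add: c_def algebra_simps mult_Suc_right)
        show ?thesis using left y parent[OF pr] unfolding ph by metis
      next
        case 3
        then have ph: "p * h = c + h" by (simp add: c_def algebra_simps mult_Suc_right)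
        have "orig (c + h) = orig c" by (simp add: orig_def ch)
        moreover have y': "subspace_poly z i y = subspace_poly z i (phi z (c mod N + h))"
          using y unfolding ph ch by simp
        moreover have "ev (mem s') (BA + c) (h + h) y = orig c y"
          using pr[OF y'] sh by (intro parent) simp
        ultimately show ?thesis using right unfolding ph by (metis add.assoc)
      qed
    qed
    show "wp b LEVEL_body s' (\<lambda>s2 m. I (Suc k) s2 \<and> m \<le> h * time_block)"
    proof (rule wp_mono[OF LEVEL_body_spec[where i = i and h = h and c = c]])
      show "env s'" using I env' by (simp add: env_def I_def)
      show "regs s' 40 = i" "regs s' 41 = h" "regs s' 42 = c" using I 1 by (simp_all add: I_def c_def h_def)
      show "\<forall>a<L. mem s' (BA + a) < Q" using I by (simp add: I_def)
      show "c mod N + h < N" using cN hpos by linarith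
    qed (use tab' i h_def cL step in auto)
  next
    show "K * (h * time_block + 2) + 1 \<le> L * (time_block + 2) + 1"
    proof -
      have "K * (h * time_block + 2) \<le> K * (h * (time_block + 2))" by (rule mult_left_mono[OF per_block]) simp
      also have "\<dots> = (K * h) * (time_block + 2)" by simp
      also have "\<dots> \<le> L * (time_block + 2)" unfolding L by (intro mult_right_mono) simp_all
      finally show ?thesis by simp
    qed
  next
    fix s' m assume I: "I K s'" and m: "m \<le> L * (time_block + 2) + 1"
    have "level M0 i (mem s')" unfolding level_def
    proof (intro allI impI)
      fix q y assume q: "q * 2 ^ i < L" and y: "subspace_poly z i y = subspace_poly z i (phi z (q * 2 ^ i mod N))"
      have "q * h < (K + K) * h" using q by (simp add: L h_def algebra_simps)
      then have "q < K + K" by simp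
      then show "ev (mem s') (BA + q * 2 ^ i) (2 ^ i) y = ev M0 (BA + q * 2 ^ i div N * N) N y"
        using I y unfolding I_def orig_def h_def by blast
    qed
    then show "m \<le> L * (time_block + 2) + 1 \<and>
      (\<forall>a. a < BA \<or> BA + L \<le> a \<longrightarrow> mem s' a = mem s a) \<and> (\<forall>r<42. regs s' r = regs s r) \<and>
      (\<forall>a<L. mem s' (BA + a) < Q) \<and> level M0 i (mem s')"
      using I m unfolding I_def L[symmetric] by blast
  next
    fix s' assume "I K s'" then show "\<not> cond_val b (Less (Reg 42) (Reg 13)) s'"
      using env' by (simp add: I_def L)
  qed
qed

lemma level_initial: "level M e M"
  unfolding level_def by (auto simp flip: N_def)

text \<open>At level 0 a block is a single coefficient and \<open>subspace_poly z 0\<close> is the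
  identity, so the coset is one point and the cell holds the value there.\<close>

lemma level_final:
  assumes "level M0 0 M" "a < L"
  shows "phi z (M (BA + a)) = ev M0 (BA + a div N * N) N (phi z (a mod N))"
  using assms(1)[unfolded level_def, rule_format, of a "phi z (a mod N)"] assms(2)
  by (simp add: ev_def mult_Suc_right)

lemma FFT_spec:
  assumes env: "env s" and tab: "table (mem s) e" and Qs: "\<forall>a<L. mem s (BA + a) < Q"
  shows "wp b FFT s (\<lambda>s' m. m \<le> time_fft \<and>
    (\<forall>a. a < BA \<or> BA + L \<le> a \<longrightarrow> mem s' a = mem s a) \<and> (\<forall>r<40. regs s' r = regs s r) \<and>
    (\<forall>a<L. mem s' (BA + a) < Q \<and>
      phi z (mem s' (BA + a)) = ev (mem s) (BA + a div N * N) N (phi z (a mod N))))"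
proof -
  note env' = env[unfolded env_def]
  define I where "I k s' \<longleftrightarrow> (\<forall>a. a < BA \<or> BA + L \<le> a \<longrightarrow> mem s' a = mem s a) \<and>
    (\<forall>r<40. regs s' r = regs s r) \<and> regs s' 40 = e - k \<and> regs s' 41 = 2 ^ (e - k) \<and>
    (\<forall>a<L. mem s' (BA + a) < Q) \<and> level (mem s) (e - k) (mem s')" for k and s' :: ram_state
  have loop: "wp b FFT_loop s1 (\<lambda>s' m. m \<le> e * (L * (time_block + 2) + 12) + 1 \<and> I e s')"
    if s1: "I 0 s1" for s1
    unfolding FFT_loop_def
  proof (rule wp_while_bound[where K = e and B = "L * (time_block + 2) + 10" and I = I])
    fix k s' assume k: "k < e" and I: "I k s'"
    show "cond_val b (Less (Const 0) (Reg 40)) s'" using I k by (simp add: I_def)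
    define i where "i = e - Suc k"
    have ik: "e - k = Suc i" "i < e" using k by (auto simp: i_def)
    have env2: "env s'" using I env' by (simp add: env_def I_def)
    have tab': "table (mem s') e"
      using tab by (rule table_cong[THEN iffD1, rotated 2]) (use I layout in \<open>auto simp: I_def\<close>)
    have I1: "\<forall>r<40. regs s' r = regs s r" "regs s' 40 = Suc i" "regs s' 41 = 2 * 2 ^ i"
      "\<forall>a<L. mem s' (BA + a) < Q" "level (mem s) (Suc i) (mem s')"
      using I unfolding I_def ik by auto
    have LEVEL: "wp b LEVEL_loop s1 R"
      if "env s1" "mem s1 = mem s'" "regs s1 40 = i" "regs s1 41 = 2 ^ i" "regs s1 42 = 0"
        and R: "\<And>s2 m. m \<le> L * (time_block + 2) + 1 \<Longrightarrow> I (Suc k) s2 \<Longrightarrow> R s2 m"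
        and rg: "\<forall>r<40. regs s1 r = regs s' r" for s1 R
    proof (rule wp_mono[OF LEVEL_loop_spec[where i = i and ?M0.0 = "mem s"]])
      fix s2 :: ram_state and m assume *: "m \<le> L * (time_block + 2) + 1 \<and>
        (\<forall>a. a < BA \<or> BA + L \<le> a \<longrightarrow> mem s2 a = mem s1 a) \<and> (\<forall>r<42. regs s2 r = regs s1 r) \<and>
        (\<forall>a<L. mem s2 (BA + a) < Q) \<and> level (mem s) i (mem s2)"
      have "I (Suc k) s2"
        unfolding I_def i_def[symmetric]
      proof (intro conjI)
        show "\<forall>a. a < BA \<or> BA + L \<le> a \<longrightarrow> mem s2 a = mem s a"
          using * I unfolding I_def that(2) by metis
      qed (use * I1 rg that in auto)
      then show "R s2 m" using R * by blast
    qed (use that ik tab' I1 in auto)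
    have "e < 2 ^ b" using e_bound by linarith
    then have "Suc i < 2 ^ b" using ik by linarith
    then show "wp b FFT_body s' (\<lambda>s2 m. I (Suc k) s2 \<and> m \<le> L * (time_block + 2) + 10)"
      unfolding FFT_body_def using env2 I1
      apply (simp add: arith_simps)
      apply (rule LEVEL)
            apply (simp_all add: env_def)
      done
  qed (use s1 in \<open>auto simp: I_def\<close>)
  have Ne: "N < 2 ^ b" "e < 2 ^ b" using layout e_bound by linarith+
  have i0: "I 0 (set_reg 41 N (set_reg 40 e s))"
    unfolding I_def using Qs level_initial by (simp add: N_def)
  show ?thesis
    unfolding FFT_def using env' Ne
    apply (simp add: arith_simps)
    apply (rule wp_mono[OF loop[OF i0]])
    subgoal for s' m
      using level_final[of "mem s" "mem s'"] by (simp add: I_def time_fft_def)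
    done
qed

end

section \<open>The hafnian at each point and the weighted sum\<close>

definition "MAT_body =
  Arith 42 Div (Reg 40) (Reg 1) ;; Arith 43 Defs.arith_op.Mod (Reg 40) (Reg 1) ;;
  Arith 43 Mul (Reg 43) (Reg 1) ;; Arith 43 Add (Reg 43) (Reg 42) ;;
  Arith 44 Mul (Reg 40) (Reg 4) ;; Arith 44 Add (Reg 44) (Reg 30) ;; Arith 44 Add (Reg 12) (Reg 44) ;;
  Arith 45 Mul (Reg 43) (Reg 4) ;; Arith 45 Add (Reg 45) (Reg 30) ;; Arith 45 Add (Reg 12) (Reg 45) ;;
  Load 90 (Reg 44) ;; Load 91 (Reg 45) ;; XOR ;; Arith 46 Add (Reg 9) (Reg 40) ;; Store (Reg 46) (Reg 92) ;;
  Arith 40 Add (Reg 40) (Const 1)"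

definition "MAT_loop = While (Less (Reg 40) (Reg 41)) MAT_body"

definition "MAT = MOV 40 (Const 0) ;; Arith 41 Mul (Reg 1) (Reg 1) ;; MAT_loop"

text \<open>Register 35 ends as the last column with a nonzero entry, any pivot being equally good,
  or as \<open>n\<close> if the row is 0.\<close>

definition "FIND_body =
  Load 42 (Reg 41) ;; Cond (Equal (Reg 42) (Const 0)) Skip (MOV 35 (Reg 40)) ;;
  Arith 40 Add (Reg 40) (Const 1) ;; Arith 41 Add (Reg 41) (Const 1)"

definition "FIND_loop = While (Less (Reg 40) (Reg 1)) FIND_body"

definition "FIND = MOV 35 (Reg 1) ;; MOV 40 (Const 0) ;; Arith 41 Mul (Reg 34) (Reg 1) ;;
  Arith 41 Add (Reg 9) (Reg 41) ;; FIND_loop"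

text \<open>The matrix is updated in place, so the multipliers (row \<open>k\<close> divided by the
  pivot) and row \<open>j\<close> are saved first; afterwards the entries can be treated in any
  order.\<close>

definition "COPY_body =
  Load 80 (Reg 41) ;; MOV 81 (Reg 36) ;; MUL ;; Arith 43 Add (Reg 10) (Reg 40) ;; Store (Reg 43) (Reg 82) ;;
  Load 44 (Reg 42) ;; Arith 43 Add (Reg 11) (Reg 40) ;; Store (Reg 43) (Reg 44) ;;
  Arith 40 Add (Reg 40) (Const 1) ;; Arith 41 Add (Reg 41) (Const 1) ;; Arith 42 Add (Reg 42) (Const 1)"

definition "COPY_loop = While (Less (Reg 40) (Reg 1)) COPY_body"

definition "UPDATE_body =
  Arith 42 Div (Reg 40) (Reg 1) ;; Arith 43 Defs.arith_op.Mod (Reg 40) (Reg 1) ;;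
  Arith 44 Add (Reg 10) (Reg 42) ;; Load 80 (Reg 44) ;; Arith 44 Add (Reg 11) (Reg 43) ;; Load 81 (Reg 44) ;;
  MUL ;; Arith 45 Add (Reg 9) (Reg 40) ;; Load 90 (Reg 45) ;; MOV 91 (Reg 82) ;; XOR ;; MOV 46 (Reg 92) ;;
  Arith 44 Add (Reg 10) (Reg 43) ;; Load 80 (Reg 44) ;; Arith 44 Add (Reg 11) (Reg 42) ;; Load 81 (Reg 44) ;;
  MUL ;; MOV 90 (Reg 46) ;; MOV 91 (Reg 82) ;; XOR ;; Store (Reg 45) (Reg 92) ;;
  Arith 40 Add (Reg 40) (Const 1)"

definition "UPDATE_loop = While (Less (Reg 40) (Reg 41)) UPDATE_body"

text \<open>The inverse of the pivot is its power with exponent \<open>Q - 2\<close>. The update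
  covers rows \<open>k\<close> and \<open>j\<close> as well and turns them into zero rows, by which
  eliminated vertices are recognised later.\<close>

definition "ELIM =
  Arith 33 Add (Reg 33) (Const 2) ;;
  Arith 41 Mul (Reg 34) (Reg 1) ;; Arith 41 Add (Reg 9) (Reg 41) ;; Arith 43 Add (Reg 41) (Reg 35) ;; Load 37 (Reg 43) ;;
  MOV 80 (Reg 31) ;; MOV 81 (Reg 37) ;; MUL ;; MOV 31 (Reg 82) ;;
  MOV 70 (Reg 37) ;; Arith 71 Sub (Reg 6) (Const 2) ;; POW ;; MOV 36 (Reg 72) ;;
  MOV 40 (Const 0) ;; Arith 42 Mul (Reg 35) (Reg 1) ;; Arith 42 Add (Reg 9) (Reg 42) ;; COPY_loop ;;
  MOV 40 (Const 0) ;; Arith 41 Mul (Reg 1) (Reg 1) ;; UPDATE_loop"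

definition "HAF_body = FIND ;; Cond (Less (Reg 35) (Reg 1)) ELIM Skip ;; Arith 34 Add (Reg 34) (Const 1)"

definition "HAF_loop = While (Less (Reg 34) (Reg 1)) HAF_body"

text \<open>Register 31 collects the product of the pivots and register 33 the number of eliminated
  vertices. A count other than \<open>n\<close> means that some remaining row had no pivot, and then
  the hafnian is 0.\<close>

definition "HAF = MOV 31 (Const 1) ;; MOV 33 (Const 0) ;; MOV 34 (Const 0) ;; HAF_loop ;;
  Cond (Equal (Reg 33) (Reg 1)) Skip (MOV 31 (Const 0))"

text \<open>Only \<open>Suc e\<close> coefficients of the vanishing polynomial can be nonzero, so
  one weight takes at most \<open>Suc e\<close> powers; register 42 walks along the last row of the
  table.\<close>

definition "DUAL_body =
  Cond (Less (Reg 3) (Reg 41))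
    (MOV 70 (Reg 30) ;; Arith 71 Sub (Reg 41) (Const 1) ;; Arith 71 Sub (Reg 71) (Reg 3) ;; POW ;;
     MOV 80 (Reg 72) ;; Load 81 (Reg 42) ;; MUL ;; MOV 90 (Reg 32) ;; MOV 91 (Reg 82) ;; XOR ;; MOV 32 (Reg 92))
    Skip ;;
  Arith 40 Add (Reg 40) (Const 1) ;; Arith 41 Add (Reg 41) (Reg 41) ;; Arith 42 Add (Reg 42) (Const 1)"

definition "DUAL_loop = While (Less (Reg 40) (Reg 14)) DUAL_body"

definition "DUAL = MOV 32 (Const 0) ;; MOV 40 (Const 0) ;; MOV 41 (Const 1) ;; Arith 42 Mul (Reg 5) (Reg 14) ;;
  Arith 42 Add (Reg 42) (Reg 8) ;; DUAL_loop"

definition "ACCUMULATE_body = MAT ;; HAF ;; DUAL ;; MOV 80 (Reg 31) ;; MOV 81 (Reg 32) ;; MUL ;;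
  MOV 90 (Reg 0) ;; MOV 91 (Reg 82) ;; XOR ;; MOV 0 (Reg 92) ;; Arith 30 Add (Reg 30) (Const 1)"

definition "ACCUMULATE_loop = While (Less (Reg 30) (Reg 4)) ACCUMULATE_body"

definition "ACCUMULATE = MOV 0 (Const 0) ;; MOV 30 (Const 0) ;; ACCUMULATE_loop"

context machine
begin

definition "time_mat = n * n * (time_xor + 60) + 10"
definition "time_find = n * 20 + 20"
definition "time_copy = n * (time_mul + 40) + 1"
definition "time_update = n * n * (2 * time_mul + 2 * time_xor + 80) + 1"
definition "time_elim = time_mul + time_pow + time_copy + time_update + 60"
definition "time_haf = n * (time_find + time_elim + 20) + 20"
definition "time_dual = Suc e * (time_pow + time_mul + time_xor + 60) + 20"
definition "time_sum = N * (time_mat + time_haf + time_dual + time_mul + time_xor + 60) + 10"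

definition matrix :: "(nat \<Rightarrow> nat) \<Rightarrow> (nat \<Rightarrow> nat \<Rightarrow> 'a) \<Rightarrow> bool" where
  "matrix M B \<longleftrightarrow> (\<forall>i<n * n. M (BM + i) < Q \<and> phi z (M (BM + i)) = B (i div n) (i mod n))"

text \<open>An edge may be listed with its ends in either order, so the polynomials of
  \<open>(u, v)\<close> and \<open>(v, u)\<close> are added. In characteristic 2 this also makes the
  diagonal 0, as elimination demands.\<close>

definition point_matrix :: "(nat \<Rightarrow> nat) \<Rightarrow> nat \<Rightarrow> nat \<Rightarrow> nat \<Rightarrow> 'a" where
  "point_matrix M a u v = phi z (M (BA + ((u * n + v) * N + a))) + phi z (M (BA + ((v * n + u) * N + a)))"

lemma phi_eq_0_iff: "w < Q \<Longrightarrow> phi z w = 0 \<longleftrightarrow> w = 0"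
  using inj_onD[OF phi_inj_Q, of w 0] one_less_Q by auto

lemma phi_inverse:
  assumes "w < Q" "w \<noteq> 0"
  shows "phi z w ^ (Q - 2) = inverse (phi z w)"
proof -
  have "phi z w ^ (Q - 1) = 1"
    using phi_power_eq_one[OF root, of w] assms by (simp add: Q_def d_def)
  moreover have "Q - 1 = Suc (Q - 2)" using one_less_Q by simp
  ultimately have "phi z w * phi z w ^ (Q - 2) = 1" by simp
  then show ?thesis by (rule inverse_unique[symmetric])
qed

lemma flat_index: "u < n \<Longrightarrow> v < n \<Longrightarrow> u * n + v < n * n"
proof -
  assume "u < n" "v < n"
  then have "u * n + v < Suc u * n" by simp
  also have "\<dots> \<le> n * n" using \<open>u < n\<close> by (intro mult_right_mono) auto
  finally show ?thesis .
qed

lemma array_index: "i < n * n \<Longrightarrow> a < N \<Longrightarrow> i * N + a < L"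
proof -
  assume "i < n * n" "a < N"
  then have "i * N + a < Suc i * N" by simp
  also have "\<dots> \<le> n * n * N" using \<open>i < n * n\<close> by (intro mult_right_mono) auto
  finally show ?thesis by (simp add: L_def)
qed

lemma flat_index_split: "i < n * n \<Longrightarrow> i div n < n \<and> i mod n < n"
  by (cases "n = 0") (simp_all add: less_mult_imp_div_less)

end

context sized_machine
begin

lemma n_bounds: "n * n < 2 ^ b" "n < 2 ^ b" "BM + n * n < 2 ^ b" "BC + n < 2 ^ b" "BJ + n < 2 ^ b" "BA + L < 2 ^ b"
  "L < 2 ^ b" "N < 2 ^ b"
  using layout by linarith+

lemma MAT_spec:
  assumes env: "env s" and Qs: "\<forall>a<L. mem s (BA + a) < Q" and a: "regs s 30 = a" "a < N"
  shows "wp b MAT s (\<lambda>s' m. m \<le> time_mat \<and>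
    (\<forall>x. x < BM \<or> BC \<le> x \<longrightarrow> mem s' x = mem s x) \<and> (\<forall>r<40. regs s' r = regs s r) \<and>
    matrix (mem s') (point_matrix (mem s) a))"
proof -
  note env' = env[unfolded env_def]
  let ?B = "point_matrix (mem s) a"
  define I where "I k s' \<longleftrightarrow> (\<forall>x. x < BM \<or> BC \<le> x \<longrightarrow> mem s' x = mem s x) \<and> (\<forall>r<40. regs s' r = regs s r) \<and>
    regs s' 40 = k \<and> regs s' 41 = n * n \<and>
    (\<forall>i<k. mem s' (BM + i) < Q \<and> phi z (mem s' (BM + i)) = ?B (i div n) (i mod n))" for k and s' :: ram_state
  have loop: "wp b MAT_loop s1 (\<lambda>s' m. m \<le> n * n * (time_xor + 60) + 1 \<and> I (n * n) s')" if s1: "I 0 s1" for s1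
    unfolding MAT_loop_def
  proof (rule wp_while_bound[where K = "n * n" and B = "time_xor + 58" and I = I])
    fix k s' assume k: "k < n * n" and I: "I k s'"
    show "cond_val b (Less (Reg 40) (Reg 41)) s'" using I k by (simp add: I_def)
    define u v where "u = k div n" and "v = k mod n"
    have uv: "u < n" "v < n" "u * n + v = k" using flat_index_split[OF k] by (auto simp: u_def v_def)
    have idx: "v * n + u < n * n" "v * n < n * n" using flat_index[OF uv(2,1)] by linarith+
    have ai: "k * N + a < L" "(v * n + u) * N + a < L"
      using array_index k idx a by blast+
    have ad: "v * n < 2 ^ b" "v * n + u < 2 ^ b" "k * N < 2 ^ b" "k * N + a < 2 ^ b" "BA + (k * N + a) < 2 ^ b"
      "(v * n + u) * N < 2 ^ b" "(v * n + u) * N + a < 2 ^ b" "BA + ((v * n + u) * N + a) < 2 ^ b" "BM + k < 2 ^ b" "k + 1 < 2 ^ b"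
      using idx ai k n_bounds by linarith+
    have lay: "BC \<le> BA + x" "BM + k < BC" for x using layout k by linarith+
    have I1: "\<forall>r<40. regs s' r = regs s r" "regs s' 40 = k" "regs s' 41 = n * n"
      "mem s' (BA + (k * N + a)) = mem s (BA + (k * N + a))" "mem s' (BA + ((v * n + u) * N + a)) = mem s (BA + ((v * n + u) * N + a))"
      using I lay by (simp_all add: I_def)
    have Qa: "mem s (BA + (k * N + a)) < Q" "mem s (BA + ((v * n + u) * N + a)) < Q" using Qs ai by simp_all
    have step: "I (Suc k) s2" if "\<forall>r<40. regs s2 r = regs s r" "regs s2 40 = Suc k" "regs s2 41 = n * n"
      "w < Q" "phi z w = phi z (mem s (BA + (k * N + a))) + phi z (mem s (BA + ((v * n + u) * N + a)))"
      "mem s2 = (mem s')(BM + k := w)" for s2 w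
    proof -
      have "phi z w = ?B (k div n) (k mod n)" using that(5) uv(3) unfolding point_matrix_def u_def v_def by simp
      moreover have "mem s2 x = mem s x" if "x < BM \<or> BC \<le> x" for x
      proof -
        have "x \<noteq> BM + k" using that lay(2) by linarith
        then have "mem s2 x = mem s' x" using \<open>mem s2 = _\<close> by simp
        then show ?thesis using I that unfolding I_def by metis
      qed
      ultimately show ?thesis using that I by (simp add: I_def less_Suc_eq)
    qed
    show "wp b MAT_body s' (\<lambda>s2 m. I (Suc k) s2 \<and> m \<le> time_xor + 58)"
      unfolding MAT_body_def using big env' ad I1 a Qa
      apply (simp add: arith_simps flip: u_def v_def)
      apply (rule XOR_wp)
         apply (simp_all add: arith_simps env_def flip: u_def v_def)
      apply (rule step)
           apply (simp_all add: mem_set_mem_fun)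
      done
  qed (use s1 in \<open>auto simp: I_def\<close>)
  have i0: "I 0 (set_reg 41 (n * n) (set_reg 40 0 s))" by (simp add: I_def)
  show ?thesis
    unfolding MAT_def using env' n_bounds(1)
    apply (simp add: arith_simps)
    apply (rule wp_mono[OF loop[OF i0]])
    apply (simp add: I_def time_mat_def matrix_def)
    done
qed

lemma FIND_spec:
  assumes env: "env s" and k: "regs s 34 = k" "k < n"
  shows "wp b FIND s (\<lambda>s' m. m \<le> time_find \<and> mem s' = mem s \<and> (\<forall>r<35. regs s' r = regs s r) \<and>
    (regs s' 35 < n \<and> mem s (BM + (k * n + regs s' 35)) \<noteq> 0 \<or>
     regs s' 35 = n \<and> (\<forall>j<n. mem s (BM + (k * n + j)) = 0)))"
proof -
  note env' = env[unfolded env_def]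
  define I where "I i s' \<longleftrightarrow> mem s' = mem s \<and> (\<forall>r<35. regs s' r = regs s r) \<and>
    regs s' 40 = i \<and> regs s' 41 = BM + (k * n + i) \<and>
    (regs s' 35 < n \<and> mem s (BM + (k * n + regs s' 35)) \<noteq> 0 \<or>
     regs s' 35 = n \<and> (\<forall>j<i. mem s (BM + (k * n + j)) = 0))" for i and s' :: ram_state
  have kn: "k * n < 2 ^ b" "BM + k * n < 2 ^ b" using flat_index[of k 0] k n_bounds by linarith+
  have loop: "wp b FIND_loop s1 (\<lambda>s' m. m \<le> n * 20 + 1 \<and> I n s')" if s1: "I 0 s1" for s1
    unfolding FIND_loop_def
  proof (rule wp_while_bound[where K = n and B = 18 and I = I])
    fix i s' assume i: "i < n" and I: "I i s'"
    have I1: "mem s' = mem s" "\<forall>r<35. regs s' r = regs s r" "regs s' 40 = i" "regs s' 41 = BM + (k * n + i)"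
      using I by (simp_all add: I_def)
    show "cond_val b (Less (Reg 40) (Reg 1)) s'" using I1 i env' by simp
    have ad: "i + 1 < 2 ^ b" "BM + (k * n + i) + 1 < 2 ^ b" "i < 2 ^ b"
      using flat_index[OF k(2) i] n_bounds i by linarith+
    show "wp b FIND_body s' (\<lambda>s2 m. I (Suc i) s2 \<and> m \<le> 18)"
      unfolding FIND_body_def using I1 ad i I
      by (auto simp: arith_simps I_def less_Suc_eq)
  qed (use s1 env' in \<open>auto simp: I_def\<close>)
  have i0: "I 0 (set_reg 41 (BM + k * n) (set_reg 41 (k * n) (set_reg 40 0 (set_reg 35 n s))))" by (simp add: I_def)
  show ?thesis
    unfolding FIND_def using env' n_bounds(2) kn k
    apply (simp add: arith_simps)
    apply (rule wp_mono[OF loop[OF i0]])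
    apply (simp add: I_def time_find_def)
    done
qed

lemma COPY_loop_spec:
  assumes env: "env s" and kj: "k < n" "j < n" and Ms: "\<forall>i<n * n. mem s (BM + i) < Q"
    and 1: "regs s 40 = 0" "regs s 41 = BM + k * n" "regs s 42 = BM + j * n" "regs s 36 < Q"
  shows "wp b COPY_loop s (\<lambda>s' m. m \<le> time_copy \<and>
    (\<forall>x. x < BC \<or> BA \<le> x \<longrightarrow> mem s' x = mem s x) \<and> (\<forall>r<40. regs s' r = regs s r) \<and>
    (\<forall>i<n. mem s' (BC + i) < Q \<and> mem s' (BJ + i) < Q \<and>
      phi z (mem s' (BC + i)) = phi z (mem s (BM + (k * n + i))) * phi z (regs s 36) \<and>
      phi z (mem s' (BJ + i)) = phi z (mem s (BM + (j * n + i)))))"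
proof -
  note env' = env[unfolded env_def]
  define I where "I i s' \<longleftrightarrow> (\<forall>x. x < BC \<or> BA \<le> x \<longrightarrow> mem s' x = mem s x) \<and> (\<forall>r<40. regs s' r = regs s r) \<and>
    regs s' 40 = i \<and> regs s' 41 = BM + (k * n + i) \<and> regs s' 42 = BM + (j * n + i) \<and>
    (\<forall>i'<i. mem s' (BC + i') < Q \<and> mem s' (BJ + i') < Q \<and>
      phi z (mem s' (BC + i')) = phi z (mem s (BM + (k * n + i'))) * phi z (regs s 36) \<and>
      phi z (mem s' (BJ + i')) = phi z (mem s (BM + (j * n + i'))))" for i and s' :: ram_state
  show ?thesis unfolding COPY_loop_def
  proof (rule wp_while_bound[where K = n and B = "time_mul + 38" and I = I])
    fix i s' assume i: "i < n" and I: "I i s'"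
    show "cond_val b (Less (Reg 40) (Reg 1)) s'" using I i env' by (simp add: I_def)
    have fi: "k * n + i < n * n" "j * n + i < n * n" using flat_index kj i by blast+
    have ad: "i + 1 < 2 ^ b" "BM + (k * n + i) + 1 < 2 ^ b" "BM + (j * n + i) + 1 < 2 ^ b" "BC + i < 2 ^ b" "BJ + i < 2 ^ b"
      using fi n_bounds i by linarith+
    have lay: "BM + (k * n + i) < BC" "BM + (j * n + i) < BC" "BC + i < BJ" "BJ + i < BA" "BC \<le> BJ"
      using layout fi i by linarith+
    have I1: "\<forall>r<40. regs s' r = regs s r" "regs s' 40 = i" "regs s' 41 = BM + (k * n + i)" "regs s' 42 = BM + (j * n + i)"
      "mem s' (BM + (k * n + i)) = mem s (BM + (k * n + i))" "mem s' (BM + (j * n + i)) = mem s (BM + (j * n + i))"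
      using I lay by (simp_all add: I_def)
    have Qa: "mem s (BM + (k * n + i)) < Q" "mem s (BM + (j * n + i)) < Q" using Ms fi by simp_all
    have step: "I (Suc i) s2" if "\<forall>r<40. regs s2 r = regs s r" "regs s2 40 = Suc i" "regs s2 41 = Suc (BM + (k * n + i))"
      "regs s2 42 = Suc (BM + (j * n + i))" "w < Q" "phi z w = phi z (mem s (BM + (k * n + i))) * phi z (regs s 36)"
      "mem s2 = (mem s')(BC + i := w, BJ + i := mem s (BM + (j * n + i)))" for s2 w
    proof -
      have "mem s2 x = mem s x" if "x < BC \<or> BA \<le> x" for x
      proof -
        have "x \<noteq> BC + i" "x \<noteq> BJ + i" using that lay by linarith+
        then have "mem s2 x = mem s' x" using \<open>mem s2 = _\<close> by simp
        then show ?thesis using I that unfolding I_def by metis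
      qed
      moreover have "mem s2 (BC + i') < Q \<and> mem s2 (BJ + i') < Q \<and>
        phi z (mem s2 (BC + i')) = phi z (mem s (BM + (k * n + i'))) * phi z (regs s 36) \<and>
        phi z (mem s2 (BJ + i')) = phi z (mem s (BM + (j * n + i')))" if "i' < Suc i" for i'
      proof -
        have "mem s2 (BC + i') = (if i' = i then w else mem s' (BC + i'))"
          "mem s2 (BJ + i') = (if i' = i then mem s (BM + (j * n + i)) else mem s' (BJ + i'))"
          using \<open>mem s2 = _\<close> lay that i layout by auto
        then show ?thesis using \<open>i' < Suc i\<close> I \<open>w < Q\<close> \<open>phi z w = _\<close> Qa
          by (auto simp: I_def less_Suc_eq)
      qed
      ultimately show ?thesis using that by (simp add: I_def)
    qed
    have neq: "BM + (j * n + i) \<noteq> BC + i" using lay by linarith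
    show "wp b COPY_body s' (\<lambda>s2 m. I (Suc i) s2 \<and> m \<le> time_mul + 38)"
      unfolding COPY_body_def using big env' ad I1 1(4) Qa neq
      apply (simp add: arith_simps)
      apply (rule MUL_wp)
         apply (simp_all add: arith_simps env_def)
      apply (rule step)
            apply (simp_all add: mem_set_mem_fun)
      done
  next
    show "n * (time_mul + 38 + 2) + 1 \<le> time_copy" by (simp add: time_copy_def)
  qed (use 1 env' in \<open>auto simp: I_def\<close>)
qed

lemma UPDATE_loop_spec:
  assumes env: "env s" and M: "matrix (mem s) B"
    and CJ: "\<forall>i<n. mem s (BC + i) < Q \<and> mem s (BJ + i) < Q \<and>
      phi z (mem s (BC + i)) = c i \<and> phi z (mem s (BJ + i)) = B j i"
    and 1: "regs s 40 = 0" "regs s 41 = n * n"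
  shows "wp b UPDATE_loop s (\<lambda>s' m. m \<le> time_update \<and>
    (\<forall>x. x < BM \<or> BC \<le> x \<longrightarrow> mem s' x = mem s x) \<and> (\<forall>r<40. regs s' r = regs s r) \<and>
    matrix (mem s') (\<lambda>u v. B u v + c u * B j v + c v * B j u))"
proof -
  note env' = env[unfolded env_def]
  let ?B = "\<lambda>u v. B u v + c u * B j v + c v * B j u"
  define I where "I k s' \<longleftrightarrow> (\<forall>x. x < BM \<or> BM + n * n \<le> x \<longrightarrow> mem s' x = mem s x) \<and> (\<forall>r<40. regs s' r = regs s r) \<and>
    regs s' 40 = k \<and> regs s' 41 = n * n \<and>
    (\<forall>i<n * n. mem s' (BM + i) < Q \<and>
      phi z (mem s' (BM + i)) = (if i < k then ?B (i div n) (i mod n) else B (i div n) (i mod n)))" for k and s' :: ram_state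
  show ?thesis unfolding UPDATE_loop_def
  proof (rule wp_while_bound[where K = "n * n" and B = "2 * time_mul + 2 * time_xor + 78" and I = I])
    fix k s' assume k: "k < n * n" and I: "I k s'"
    show "cond_val b (Less (Reg 40) (Reg 41)) s'" using I k by (simp add: I_def)
    define u v where "u = k div n" and "v = k mod n"
    have uv: "u < n" "v < n" using flat_index_split[OF k] by (auto simp: u_def v_def)
    have ad: "BC + u < 2 ^ b" "BC + v < 2 ^ b" "BJ + u < 2 ^ b" "BJ + v < 2 ^ b" "BM + k < 2 ^ b" "k + 1 < 2 ^ b"
      using k uv n_bounds by linarith+
    have lay: "BM + n * n \<le> BC + x" "BM + n * n \<le> BJ + x" for x using layout by linarith+
    have I1: "\<forall>r<40. regs s' r = regs s r" "regs s' 40 = k" "regs s' 41 = n * n"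
      "mem s' (BC + u) = mem s (BC + u)" "mem s' (BC + v) = mem s (BC + v)"
      "mem s' (BJ + u) = mem s (BJ + u)" "mem s' (BJ + v) = mem s (BJ + v)"
      "mem s' (BM + k) < Q" "phi z (mem s' (BM + k)) = B u v"
      using I lay k by (simp_all add: I_def u_def v_def)
    have Qa: "mem s (BC + u) < Q" "mem s (BC + v) < Q" "mem s (BJ + u) < Q" "mem s (BJ + v) < Q"
      "phi z (mem s (BC + u)) = c u" "phi z (mem s (BC + v)) = c v" "phi z (mem s (BJ + u)) = B j u" "phi z (mem s (BJ + v)) = B j v"
      using CJ uv by simp_all
    have step: "I (Suc k) s2" if "\<forall>r<40. regs s2 r = regs s r" "regs s2 40 = Suc k" "regs s2 41 = n * n"
      "w < Q" "phi z w = ?B u v" "mem s2 = (mem s')(BM + k := w)" for s2 w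
    proof -
      have "mem s2 x = mem s x" if "x < BM \<or> BM + n * n \<le> x" for x
      proof -
        have "x \<noteq> BM + k" using that k by linarith
        then have "mem s2 x = mem s' x" using \<open>mem s2 = _\<close> by simp
        then show ?thesis using I that unfolding I_def by metis
      qed
      then show ?thesis using that I k by (simp add: I_def less_Suc_eq u_def v_def)
    qed
    show "wp b UPDATE_body s' (\<lambda>s2 m. I (Suc k) s2 \<and> m \<le> 2 * time_mul + 2 * time_xor + 78)"
      unfolding UPDATE_body_def using big env' ad I1 Qa
      apply (simp add: arith_simps flip: u_def v_def)
      apply (rule MUL_wp)
         apply (simp_all add: arith_simps env_def)
      apply (rule XOR_wp)
         apply (simp_all add: arith_simps env_def)
      apply (rule MUL_wp)
         apply (simp_all add: arith_simps env_def)
      apply (rule XOR_wp)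
         apply (simp_all add: arith_simps env_def)
      apply (rule step)
           apply (simp_all add: mem_set_mem_fun)
      done
  next
    show "n * n * (2 * time_mul + 2 * time_xor + 78 + 2) + 1 \<le> time_update" by (simp add: time_update_def)
  next
    fix s' m assume "I (n * n) s'" "m \<le> time_update"
    then show "m \<le> time_update \<and> (\<forall>x. x < BM \<or> BC \<le> x \<longrightarrow> mem s' x = mem s x) \<and> (\<forall>r<40. regs s' r = regs s r) \<and>
      matrix (mem s') ?B"
      using layout by (auto simp: I_def matrix_def)
  qed (use 1 M in \<open>auto simp: I_def matrix_def\<close>)
qed

end

context sized_machine
begin

lemma matrix_cong: "(\<And>x. BM \<le> x \<Longrightarrow> x < BC \<Longrightarrow> M x = M' x) \<Longrightarrow> matrix M B = matrix M' B"
  unfolding matrix_def using layout by (metis le_add1 less_le_trans nat_add_left_cancel_less)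

lemma matrix_entry:
  assumes "matrix M B" "u < n" "v < n"
  shows "M (BM + (u * n + v)) < Q" "phi z (M (BM + (u * n + v))) = B u v"
  using assms flat_index[OF assms(2,3)] unfolding matrix_def by auto

lemma ELIM_spec:
  assumes env: "env s" and M: "matrix (mem s) B" and kj: "k < n" "j < n" "B k j \<noteq> 0"
    and 1: "regs s 34 = k" "regs s 35 = j" "regs s 31 = w" "w < Q" "regs s 33 + 2 < 2 ^ b"
  shows "wp b ELIM s (\<lambda>s' m. m \<le> time_elim \<and>
    (\<forall>x. x < BM \<or> BA \<le> x \<longrightarrow> mem s' x = mem s x) \<and> (\<forall>r<31. regs s' r = regs s r) \<and>
    regs s' 34 = k \<and> regs s' 33 = regs s 33 + 2 \<and> regs s' 31 < Q \<and> phi z (regs s' 31) = phi z w * B k j \<and>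
    matrix (mem s') (\<lambda>u v. B u v + B k u / B k j * B j v + B k v / B k j * B j u))"
proof -
  note env' = env[unfolded env_def]
  define p where "p = mem s (BM + (k * n + j))"
  have p: "p < Q" "phi z p = B k j" "p \<noteq> 0"
    using matrix_entry[OF M kj(1,2)] kj(3) phi_0[of z] unfolding p_def by metis+
  have inv: "phi z p ^ (Q - 2) = inverse (B k j)" using phi_inverse[OF p(1,3)] p(2) by simp
  have fi: "k * n + j < n * n" "k * n < n * n" "j * n < n * n"
    using flat_index[of k j] flat_index[of k 0] flat_index[of j 0] kj by auto
  have ad: "k * n < 2 ^ b" "j * n < 2 ^ b" "BM + k * n < 2 ^ b" "BM + k * n + j < 2 ^ b" "BM + j * n < 2 ^ b" "n * n < 2 ^ b"
    "Q < 2 ^ b" "Q - 2 < Q" "2 \<le> Q"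
    using fi n_bounds big one_less_Q by linarith+
  have Ms: "\<forall>i<n * n. mem s (BM + i) < Q" using M by (simp add: matrix_def)
  have COPY: "wp b COPY_loop s1 R"
    if "env s1" "mem s1 = mem s" "regs s1 40 = 0" "regs s1 41 = BM + k * n" "regs s1 42 = BM + j * n" "regs s1 36 < Q"
      "phi z (regs s1 36) = inverse (B k j)"
      and R: "\<And>s2 m. m \<le> time_copy \<Longrightarrow> \<forall>x. x < BC \<or> BA \<le> x \<longrightarrow> mem s2 x = mem s x \<Longrightarrow>
        \<forall>r<40. regs s2 r = regs s1 r \<Longrightarrow> matrix (mem s2) B \<Longrightarrow>
        \<forall>i<n. mem s2 (BC + i) < Q \<and> mem s2 (BJ + i) < Q \<and>
          phi z (mem s2 (BC + i)) = B k i / B k j \<and> phi z (mem s2 (BJ + i)) = B j i \<Longrightarrow> R s2 m" for s1 R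
  proof (rule wp_mono[OF COPY_loop_spec[where k = k and j = j]])
    fix s2 :: ram_state and m
    assume *: "m \<le> time_copy \<and>
      (\<forall>x. x < BC \<or> BA \<le> x \<longrightarrow> mem s2 x = mem s1 x) \<and> (\<forall>r<40. regs s2 r = regs s1 r) \<and>
      (\<forall>i<n. mem s2 (BC + i) < Q \<and> mem s2 (BJ + i) < Q \<and>
        phi z (mem s2 (BC + i)) = phi z (mem s1 (BM + (k * n + i))) * phi z (regs s1 36) \<and>
        phi z (mem s2 (BJ + i)) = phi z (mem s1 (BM + (j * n + i))))"
    have "matrix (mem s2) B" using M by (rule matrix_cong[THEN iffD1, rotated]) (use * that(2) in auto)
    then show "R s2 m"
      using * that(2,7) matrix_entry(2)[OF M] kj by (intro R) (simp_all add: divide_inverse)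
  qed (use that kj Ms in simp_all)
  have UPDATE: "wp b UPDATE_loop s1 R"
    if "env s1" "matrix (mem s1) B" "regs s1 40 = 0" "regs s1 41 = n * n"
      "\<forall>i<n. mem s1 (BC + i) < Q \<and> mem s1 (BJ + i) < Q \<and>
          phi z (mem s1 (BC + i)) = B k i / B k j \<and> phi z (mem s1 (BJ + i)) = B j i"
      and R: "\<And>s2 m. m \<le> time_update \<Longrightarrow> \<forall>x. x < BM \<or> BC \<le> x \<longrightarrow> mem s2 x = mem s1 x \<Longrightarrow>
        \<forall>r<40. regs s2 r = regs s1 r \<Longrightarrow>
        matrix (mem s2) (\<lambda>u v. B u v + B k u / B k j * B j v + B k v / B k j * B j u) \<Longrightarrow> R s2 m" for s1 R
    by (rule wp_mono[OF UPDATE_loop_spec[where B = B and j = j and c = "\<lambda>i. B k i / B k j"]]) (use that in simp_all)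
  have fr: "mem s3 x = mem s x"
    if "\<forall>x. x < BC \<or> BA \<le> x \<longrightarrow> mem s2 x = mem s x" "\<forall>x. x < BM \<or> BC \<le> x \<longrightarrow> mem s3 x = mem s2 x"
      "x < BM \<or> BA \<le> x" for s2 s3 x
  proof -
    have "x < BC \<or> BA \<le> x" "x < BM \<or> BC \<le> x" using that(3) layout by linarith+
    then show ?thesis using that by metis
  qed
  have pp: "mem s (BM + k * n + j) = p" by (simp add: p_def add.assoc)
  show ?thesis
    unfolding ELIM_def using env' 1 ad kj p pp inv
    apply (simp add: arith_simps)
    apply (rule MUL_wp)
       apply (simp_all add: arith_simps env_def)
    apply (rule POW_wp)
       apply (simp_all add: arith_simps env_def)
    apply (rule COPY)
           apply (simp_all add: arith_simps env_def)
    apply (rule UPDATE)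
         apply (simp_all add: arith_simps env_def)
    subgoal premises prems for s1 m1 s2 m2 s3 m3 s4 m4
    proof -
      have "\<forall>x. (x < BM \<longrightarrow> mem s4 x = mem s x) \<and> (BA \<le> x \<longrightarrow> mem s4 x = mem s x)"
        using fr[of s3 s4] prems by simp
      then show ?thesis using prems by (simp add: time_elim_def)
    qed
    done
qed

lemma HAF_spec:
  assumes env: "env s" and M: "matrix (mem s) B0"
    and sym0: "\<And>u v. B0 u v = B0 v u" and diag0: "\<And>u. B0 u u = 0"
  shows "wp b HAF s (\<lambda>s' m. m \<le> time_haf \<and>
    (\<forall>x. x < BM \<or> BA \<le> x \<longrightarrow> mem s' x = mem s x) \<and> (\<forall>r<31. regs s' r = regs s r) \<and>
    regs s' 31 < Q \<and> phi z (regs s' 31) = hafnian n B0 {..<n})"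
proof -
  note env' = env[unfolded env_def]
  define hf where "hf = hafnian n B0 {..<n}"
  \<comment> \<open>\<open>S\<close> is the set of vertices not yet eliminated; it exists only here,
    and the program sees it as the complement of zero rows it has made. The last clause records that
    a vertex passed over while still in \<open>S\<close> had a zero row, so the hafnian is already
    known to be 0.\<close>
  define J where "J k B S x cnt \<longleftrightarrow> (\<forall>u v. B u v = B v u) \<and> (\<forall>u. B u u = 0) \<and> S \<subseteq> {..<n} \<and>
    (\<forall>u<n. \<forall>v<n. u \<notin> S \<longrightarrow> B u v = 0) \<and> hf = x * hafnian n B S \<and> cnt + card S = n \<and>
    ((\<exists>i\<in>S. i < k) \<longrightarrow> hf = 0)" for k :: nat and B :: "nat \<Rightarrow> nat \<Rightarrow> 'a" and S and x :: 'a and cnt :: nat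
  define I where "I k s' \<longleftrightarrow> (\<forall>x. x < BM \<or> BA \<le> x \<longrightarrow> mem s' x = mem s x) \<and> (\<forall>r<31. regs s' r = regs s r) \<and>
    regs s' 34 = k \<and> regs s' 31 < Q \<and>
    (\<exists>B S. matrix (mem s') B \<and> J k B S (phi z (regs s' 31)) (regs s' 33))" for k and s' :: ram_state
  have loop: "wp b HAF_loop s1 (\<lambda>s' m. m \<le> n * (time_find + time_elim + 20) + 1 \<and> I n s')" if s1: "I 0 s1" for s1
    unfolding HAF_loop_def
  proof (rule wp_while_bound[where K = n and B = "time_find + time_elim + 18" and I = I])
    fix k s' assume k: "k < n" and I: "I k s'"
    show "cond_val b (Less (Reg 34) (Reg 1)) s'" using I k env' by (simp add: I_def)
    obtain B S where MB: "matrix (mem s') B" and J: "J k B S (phi z (regs s' 31)) (regs s' 33)"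
      using I unfolding I_def by blast
    have sym: "\<And>u v. B u v = B v u" and diag: "\<And>u. B u u = 0" and S: "S \<subseteq> {..<n}"
      and out: "\<And>u v. u < n \<Longrightarrow> v < n \<Longrightarrow> u \<notin> S \<Longrightarrow> B u v = 0"
      and val: "hf = phi z (regs s' 31) * hafnian n B S" and cnt: "regs s' 33 + card S = n"
      and bad: "\<And>i. i \<in> S \<Longrightarrow> i < k \<Longrightarrow> hf = 0"
      using J unfolding J_def by blast+
    have finS: "finite S" using finite_subset[OF S] by simp
    have env2: "env s'" using I env' by (simp add: env_def I_def)
    have I1: "regs s' 34 = k" "regs s' 31 < Q" "\<forall>r<31. regs s' r = regs s r" using I by (simp_all add: I_def)
    have memI: "mem s' x = mem s x" if "x < BM \<or> BA \<le> x" for x using I that unfolding I_def by blast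
    have k1: "k + 1 < 2 ^ b" using k n_bounds by linarith
    have c2: "regs s' 33 + 2 < 2 ^ b" using cnt n_bounds(2) N_bounds layout by linarith
    have nz: "mem s' (BM + (k * n + j)) = 0 \<longleftrightarrow> B k j = 0" if "j < n" for j
      using matrix_entry[OF MB k that] phi_eq_0_iff by metis
    \<comment> \<open>If \<open>k\<close> is still in \<open>S\<close>, expansion along its zero row
      gives 0; otherwise an earlier pivot cleared the row and nothing is to be recorded.\<close>
    have not_found: "J (Suc k) B S (phi z (regs s' 31)) (regs s' 33)" if zero: "\<forall>j<n. B k j = 0"
    proof -
      have "hf = 0" if "i \<in> S" "i < Suc k" for i
      proof (cases "i = k")
        case True
        have "hafnian n B S = (\<Sum>l\<in>S - {k}. B k l * hafnian n B (S - {k, l}))"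
          by (rule hafnian_expand) (use sym S that True in auto)
        also have "\<dots> = 0" using zero S by (intro sum.neutral) auto
        finally show ?thesis using val by simp
      qed (use bad that in simp)
      then show ?thesis using J unfolding J_def by blast
    qed
    have found: "J (Suc k) (\<lambda>u v. B u v + B k u / B k j * B j v + B k v / B k j * B j u) (S - {k, j})
        (phi z (regs s' 31) * B k j) (regs s' 33 + 2)" if j: "j < n" "B k j \<noteq> 0" for j
    proof -
      \<comment> \<open>A nonzero entry cannot lie in a row or column of an eliminated
        vertex.\<close>
      have kS: "k \<in> S" "j \<in> S" "k \<noteq> j" using out[OF k j(1)] out[OF j(1) k] j sym diag by metis+
      have el: "hafnian n B S = B k j * hafnian n (\<lambda>u v. B u v + B k u / B k j * B j v + B k v / B k j * B j u) (S - {k, j})"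
        by (rule hafnian_eliminate[where B = B and c = "\<lambda>u. B k u / B k j"]) (use sym diag S kS j in auto)
      have card: "card S = card (S - {k, j}) + 2"
      proof -
        have "card (S - {k, j}) = card S - card {k, j}" by (rule card_Diff_subset) (use kS in auto)
        moreover have "card {k, j} \<le> card S" by (rule card_mono) (use kS finS in auto)
        ultimately show ?thesis using kS(3) by simp
      qed
      \<comment> \<open>For \<open>u = k\<close> the first and third summands are equal, for
        \<open>u = j\<close> the first two; the remaining summand contains a diagonal entry.\<close>
      have zero: "B u v + B k u / B k j * B j v + B k v / B k j * B j u = 0" if uv: "u < n" "v < n" "u \<notin> S - {k, j}" for u v
      proof -
        consider "u = k" | "u = j" | "u \<notin> S" using uv by blast
        then show ?thesis
        proof cases
          case 1
          then show ?thesis using diag sym[of j k] j(2) by simp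
        next
          case 2
          then show ?thesis using diag j(2) by simp
        next
          case 3
          then have "B u x = 0" "B x u = 0" if "x < n" for x using out[OF \<open>u < n\<close> that] sym by metis+
          then show ?thesis using k j uv by simp
        qed
      qed
      show ?thesis unfolding J_def
      proof (intro conjI allI impI)
        fix u v show "B u v + B k u / B k j * B j v + B k v / B k j * B j u =
          B v u + B k v / B k j * B j u + B k u / B k j * B j v" using sym[of u v] by (simp add: ac_simps)
      next
        assume "\<exists>i\<in>S - {k, j}. i < Suc k"
        then show "hf = 0" using bad less_Suc_eq by auto
      qed (use S zero val el cnt card diag in \<open>auto simp: mult.assoc\<close>)
    qed
    have FIND: "wp b FIND s' R"
      if R: "\<And>s2 m. m \<le> time_find \<Longrightarrow> mem s2 = mem s' \<Longrightarrow> \<forall>r<35. regs s2 r = regs s' r \<Longrightarrow>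
        regs s2 35 < n \<and> B k (regs s2 35) \<noteq> 0 \<or> regs s2 35 = n \<and> (\<forall>j<n. B k j = 0) \<Longrightarrow> R s2 m" for R
    proof (rule wp_mono[OF FIND_spec[OF env2 I1(1) k]])
      fix s2 :: ram_state and m
      assume *: "m \<le> time_find \<and> mem s2 = mem s' \<and> (\<forall>r<35. regs s2 r = regs s' r) \<and>
        (regs s2 35 < n \<and> mem s' (BM + (k * n + regs s2 35)) \<noteq> 0 \<or>
         regs s2 35 = n \<and> (\<forall>j<n. mem s' (BM + (k * n + j)) = 0))"
      then have "regs s2 35 < n \<and> B k (regs s2 35) \<noteq> 0 \<or> regs s2 35 = n \<and> (\<forall>j<n. B k j = 0)"
        using nz by metis
      then show "R s2 m" using * by (intro R) blast+
    qed
    show "wp b HAF_body s' (\<lambda>s2 m. I (Suc k) s2 \<and> m \<le> time_find + time_elim + 18)"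
      unfolding HAF_body_def wp_Seq
    proof (rule FIND)
      fix s2 :: ram_state and m2 assume m2: "m2 \<le> time_find" and s2: "mem s2 = mem s'" "\<forall>r<35. regs s2 r = regs s' r"
        and or: "regs s2 35 < n \<and> B k (regs s2 35) \<noteq> 0 \<or> regs s2 35 = n \<and> (\<forall>j<n. B k j = 0)"
      have env3: "env s2" using env2 s2 by (simp add: env_def)
      have r1: "regs s2 (Suc 0) = n" "regs s2 1 = n" using env3 by (simp_all add: env_def)
      show "wp b (Cond (Less (Reg 35) (Reg 1)) ELIM Skip) s2
        (\<lambda>s1 n1. wp b (Arith 34 Add (Reg 34) (Const 1)) s1
          (\<lambda>s2a n2. I (Suc k) s2a \<and> Suc (m2 + Suc (n1 + n2)) \<le> time_find + time_elim + 18))"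
      proof (cases "regs s2 35 < n")
        case True
        then have nz: "B k (regs s2 35) \<noteq> 0" using or by auto
        have elim: "wp b ELIM s2 (\<lambda>s1 n1. wp b (Arith 34 Add (Reg 34) (Const 1)) s1
          (\<lambda>s2a n2. I (Suc k) s2a \<and> Suc (m2 + Suc (Suc n1 + n2)) \<le> time_find + time_elim + 18))"
        proof (rule wp_mono[OF ELIM_spec[where B = B and k = k and j = "regs s2 35" and w = "regs s' 31"]])
          fix s3 :: ram_state and m3
          let ?B' = "\<lambda>u v. B u v + B k u / B k (regs s2 35) * B (regs s2 35) v + B k v / B k (regs s2 35) * B (regs s2 35) u"
          assume *: "m3 \<le> time_elim \<and> (\<forall>x. x < BM \<or> BA \<le> x \<longrightarrow> mem s3 x = mem s2 x) \<and>
            (\<forall>r<31. regs s3 r = regs s2 r) \<and> regs s3 34 = k \<and> regs s3 33 = regs s2 33 + 2 \<and> regs s3 31 < Q \<and>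
            phi z (regs s3 31) = phi z (regs s' 31) * B k (regs s2 35) \<and> matrix (mem s3) ?B'"
          have "J (Suc k) ?B' (S - {k, regs s2 35}) (phi z (regs s3 31)) (regs s3 33)"
            using found[OF True nz] * s2 by simp
          then have "I (Suc k) (set_reg 34 (Suc k) s3)"
            using * s2 I1 memI unfolding I_def by auto
          then show "wp b (Arith 34 Add (Reg 34) (Const 1)) s3
            (\<lambda>s2a n2. I (Suc k) s2a \<and> Suc (m2 + Suc (Suc m3 + n2)) \<le> time_find + time_elim + 18)"
            using * m2 k1 by (simp add: arith_simps)
        qed (use env3 s2 MB k True nz I1 c2 in simp_all)
        show ?thesis
          by (simp add: True r1) (rule wp_mono[OF elim], simp)
      next
        case False
        then have "\<forall>j<n. B k j = 0" using or by auto
        then have "J (Suc k) B S (phi z (regs s2 31)) (regs s2 33)" using not_found s2 by simp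
        then have "I (Suc k) (set_reg 34 (Suc k) s2)"
          using s2 I1 memI MB unfolding I_def by auto
        then show ?thesis using False r1 k1 s2 I1 m2 by (simp add: arith_simps)
      qed
    qed
  qed (use s1 env' in \<open>auto simp: I_def\<close>)
  have "J 0 (\<lambda>u v. B0 u v) {..<n} 1 0"
    using sym0 diag0 by (auto simp: J_def hf_def)
  then have i0: "I 0 (set_reg 34 0 (set_reg 33 0 (set_reg 31 1 s)))"
    using M one_less_Q by (auto simp: I_def)
  \<comment> \<open>All rows have been visited. An empty \<open>S\<close> leaves the product of
    pivots times the empty hafnian 1; a vertex left in \<open>S\<close> was passed over.\<close>
  have final: "regs s' 31 < Q \<and> (if regs s' 33 = n then phi z (regs s' 31) = hf else hf = 0)" if I: "I n s'" for s'
  proof -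
    obtain B S where J: "J n B S (phi z (regs s' 31)) (regs s' 33)" using I unfolding I_def by blast
    have S: "S \<subseteq> {..<n}" using J unfolding J_def by blast
    have fin: "finite S" using finite_subset[OF S] by simp
    show ?thesis
    proof (cases "regs s' 33 = n")
      case True
      then have "S = {}" using J fin unfolding J_def by simp
      then show ?thesis using J True I unfolding J_def I_def by simp
    next
      case False
      then have "S \<noteq> {}" using J unfolding J_def by auto
      then have "hf = 0" using J S unfolding J_def by blast
      then show ?thesis using False I unfolding I_def by simp
    qed
  qed
  show ?thesis
    unfolding HAF_def using env' big
    apply (simp add: arith_simps del: One_nat_def wp_Cond)
    apply (rule wp_mono[OF loop[OF i0]])
    subgoal premises prems for s' m
    proof -
      have I: "I n s'" and m: "m \<le> n * (time_find + time_elim + 20) + 1" using prems by blast+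
      have fr: "\<forall>x. x < BM \<or> BA \<le> x \<longrightarrow> mem s' x = mem s x" "\<forall>r<31. regs s' r = regs s r"
        using I unfolding I_def by blast+
      have r1: "regs s' (Suc 0) = n" using fr(2) env' by simp
      note f = final[OF I] and q = one_less_Q
      show ?thesis
        using f q fr r1 m by (cases "regs s' 33 = n") (simp_all add: time_haf_def hf_def arith_simps)
    qed
    done
qed

lemma DUAL_spec:
  assumes env: "env s" and tab: "table (mem s) e" and a: "regs s 30 < N"
  shows "wp b DUAL s (\<lambda>s' m. m \<le> time_dual \<and> mem s' = mem s \<and> (\<forall>r<32. regs s' r = regs s r) \<and>
    regs s' 32 < Q \<and> phi z (regs s' 32) = dual_weight z e t (phi z (regs s 30)))"
proof -
  note env' = env[unfolded env_def]
  define a where "a = phi z (regs s 30)"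
  define I where "I k s' \<longleftrightarrow> mem s' = mem s \<and> (\<forall>r<32. regs s' r = regs s r) \<and>
    regs s' 40 = k \<and> regs s' 41 = 2 ^ k \<and> regs s' 42 = e * Suc e + BS + k \<and> regs s' 32 < Q \<and>
    phi z (regs s' 32) = (\<Sum>j<k. if t < 2 ^ j then subspace_coeff z e j * a ^ (2 ^ j - 1 - t) else 0)"
    for k and s' :: ram_state
  have loop: "wp b DUAL_loop s1 (\<lambda>s' m. m \<le> Suc e * (time_pow + time_mul + time_xor + 60) + 1 \<and> I (Suc e) s')"
    if s1: "I 0 s1" for s1
    unfolding DUAL_loop_def
  proof (rule wp_while_bound[where K = "Suc e" and B = "time_pow + time_mul + time_xor + 58" and I = I])
    fix k s' assume k: "k < Suc e" and I: "I k s'"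
    show "cond_val b (Less (Reg 40) (Reg 14)) s'" using I k env' by (simp add: I_def)
    have I1: "mem s' = mem s" "\<forall>r<32. regs s' r = regs s r" "regs s' 40 = k" "regs s' 41 = 2 ^ k"
      "regs s' 42 = e * Suc e + BS + k" "regs s' 32 < Q"
      "phi z (regs s' 32) = (\<Sum>j<k. if t < 2 ^ j then subspace_coeff z e j * a ^ (2 ^ j - 1 - t) else 0)"
      using I by (simp_all add: I_def)
    define P where "P = (2 :: nat) ^ k"
    have P: "P \<le> N" "0 < P" using k by (auto simp: P_def N_def)
    have c: "mem s (e * Suc e + BS + k) < Q" "phi z (mem s (e * Suc e + BS + k)) = subspace_coeff z e k"
      using tab k by (simp_all add: table_def)
    have ad: "P < 2 ^ b" "P + P < 2 ^ b" "k + 1 < 2 ^ b" "e * Suc e + BS + k + 1 < 2 ^ b" "P - Suc 0 - t < Q" "P - Suc 0 < 2 ^ b"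
      "regs s 30 < Q"
      using P a layout N_bounds e_bound k table_address_bound[of e k] address_less(1) by linarith+
    have sub: "t \<le> P - Suc 0" if "t < P" using that by linarith
    have step: "I (Suc k) s2" if "mem s2 = mem s" "\<forall>r<32. regs s2 r = regs s r" "regs s2 40 = Suc k" "regs s2 41 = P + P"
      "regs s2 42 = Suc (e * Suc e + BS + k)" "regs s2 32 < Q"
      "phi z (regs s2 32) = phi z (regs s' 32) + (if t < P then subspace_coeff z e k * a ^ (P - Suc 0 - t) else 0)" for s2
      using that I1 by (simp add: I_def P_def)
    show "wp b DUAL_body s' (\<lambda>s2 m. I (Suc k) s2 \<and> m \<le> time_pow + time_mul + time_xor + 58)"
    proof (cases "t < P")
      case True
      show ?thesis
        unfolding DUAL_body_def using big env' I1[folded P_def] ad c True sub[OF True]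
        apply (simp add: arith_simps)
        apply (rule POW_wp)
           apply (simp_all add: arith_simps env_def)
        apply (rule MUL_wp)
           apply (simp_all add: arith_simps env_def)
        apply (rule XOR_wp)
           apply (simp_all add: arith_simps env_def)
        apply (rule step)
              apply (simp_all add: a_def mult.commute)
        done
    next
      case False
      show ?thesis
        unfolding DUAL_body_def using big env' I1[folded P_def] ad False
        apply (simp add: arith_simps)
        apply (rule step)
              apply (simp_all add: a_def)
        done
    qed
  next
    show "Suc e * (time_pow + time_mul + time_xor + 58 + 2) + 1 \<le> Suc e * (time_pow + time_mul + time_xor + 60) + 1"
      by (intro add_right_mono mult_le_mono) simp_all
  qed (use s1 env' in \<open>auto simp: I_def\<close>)
  have i0: "I 0 (set_reg 42 (e * Suc e + BS) (set_reg 42 (e * Suc e) (set_reg 41 1 (set_reg 40 0 (set_reg 32 0 s)))))"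
    using one_less_Q by (simp add: I_def)
  have ad: "e * Suc e < 2 ^ b" "e * Suc e + BS < 2 ^ b" using table_address_bound[of e 0] address_less(1) by linarith+
  show ?thesis
    unfolding DUAL_def a_def[symmetric] using env' big ad
    apply (simp add: arith_simps del: One_nat_def)
    apply (rule wp_mono[OF loop[OF i0]])
    apply (simp add: I_def time_dual_def dual_weight_def lessThan_Suc_atMost del: sum.lessThan_Suc)
    done
qed

lemma ACCUMULATE_spec:
  assumes env: "env s" and tab: "table (mem s) e" and Qs: "\<forall>a<L. mem s (BA + a) < Q"
  shows "wp b ACCUMULATE s (\<lambda>s' m. m \<le> time_sum \<and> regs s' 0 < Q \<and>
    phi z (regs s' 0) = (\<Sum>a<N. hafnian n (point_matrix (mem s) a) {..<n} * dual_weight z e t (phi z a)))"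
proof -
  note env' = env[unfolded env_def]
  define I where "I k s' \<longleftrightarrow> (\<forall>x. x < BM \<or> BA \<le> x \<longrightarrow> mem s' x = mem s x) \<and> (\<forall>r<30. 0 < r \<longrightarrow> regs s' r = regs s r) \<and>
    regs s' 30 = k \<and> regs s' 0 < Q \<and>
    phi z (regs s' 0) = (\<Sum>a<k. hafnian n (point_matrix (mem s) a) {..<n} * dual_weight z e t (phi z a))"
    for k and s' :: ram_state
  have loop: "wp b ACCUMULATE_loop s1 (\<lambda>s' m. m \<le> N * (time_mat + time_haf + time_dual + time_mul + time_xor + 60) + 1 \<and> I N s')"
    if s1: "I 0 s1" for s1
    unfolding ACCUMULATE_loop_def
  proof (rule wp_while_bound[where K = N and B = "time_mat + time_haf + time_dual + time_mul + time_xor + 58" and I = I])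
    fix k s' assume k: "k < N" and I: "I k s'"
    show "cond_val b (Less (Reg 30) (Reg 4)) s'" using I k env' by (simp add: I_def)
    have I1: "\<forall>r<30. 0 < r \<longrightarrow> regs s' r = regs s r" "regs s' 30 = k" "regs s' 0 < Q"
      "phi z (regs s' 0) = (\<Sum>a<k. hafnian n (point_matrix (mem s) a) {..<n} * dual_weight z e t (phi z a))"
      using I by (simp_all add: I_def)
    have memI: "mem s' x = mem s x" if "x < BM \<or> BA \<le> x" for x using I that unfolding I_def by blast
    have env2: "env s'" using I1 env' by (simp add: env_def)
    have Qs': "\<forall>a<L. mem s' (BA + a) < Q" using Qs memI by simp
    have pm: "point_matrix (mem s') k = point_matrix (mem s) k"
      unfolding point_matrix_def using memI by simp
    have k1: "k + 1 < 2 ^ b" using k n_bounds by linarith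
    have MAT: "wp b MAT s' R"
      if R: "\<And>s2 m. m \<le> time_mat \<Longrightarrow> \<forall>x. x < BM \<or> BA \<le> x \<longrightarrow> mem s2 x = mem s x \<Longrightarrow>
        \<forall>r<40. regs s2 r = regs s' r \<Longrightarrow> matrix (mem s2) (point_matrix (mem s) k) \<Longrightarrow> R s2 m" for R
    proof (rule wp_mono[OF MAT_spec[OF env2 Qs' I1(2) k]])
      fix s2 :: ram_state and m assume *: "m \<le> time_mat \<and> (\<forall>x. x < BM \<or> BC \<le> x \<longrightarrow> mem s2 x = mem s' x) \<and>
        (\<forall>r<40. regs s2 r = regs s' r) \<and> matrix (mem s2) (point_matrix (mem s') k)"
      have "mem s2 x = mem s x" if "x < BM \<or> BA \<le> x" for x
      proof -
        have "x < BM \<or> BC \<le> x" using that layout by linarith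
        then show ?thesis using * memI[OF that] by metis
      qed
      then show "R s2 m" using * pm by (intro R) simp_all
    qed
    have HAF: "wp b HAF s1 R"
      if "env s1" "\<forall>x. x < BM \<or> BA \<le> x \<longrightarrow> mem s1 x = mem s x" "matrix (mem s1) (point_matrix (mem s) k)"
        and R: "\<And>s2 m. m \<le> time_haf \<Longrightarrow> \<forall>x. x < BM \<or> BA \<le> x \<longrightarrow> mem s2 x = mem s x \<Longrightarrow> \<forall>r<31. regs s2 r = regs s1 r \<Longrightarrow>
          regs s2 31 < Q \<Longrightarrow> phi z (regs s2 31) = hafnian n (point_matrix (mem s) k) {..<n} \<Longrightarrow>
          table (mem s2) e \<Longrightarrow> R s2 m" for s1 R
    proof (rule wp_mono[OF HAF_spec[OF that(1,3)]])
      fix s2 :: ram_state and m assume *: "m \<le> time_haf \<and> (\<forall>x. x < BM \<or> BA \<le> x \<longrightarrow> mem s2 x = mem s1 x) \<and>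
        (\<forall>r<31. regs s2 r = regs s1 r) \<and> regs s2 31 < Q \<and> phi z (regs s2 31) = hafnian n (point_matrix (mem s) k) {..<n}"
      then have m: "mem s2 x = mem s x" if "x < BM \<or> BA \<le> x" for x using that \<open>\<forall>x. _ \<longrightarrow> mem s1 x = _\<close> by metis
      have "table (mem s2) e" using tab by (rule table_cong[THEN iffD1, rotated 2]) (use m in auto)
      then show "R s2 m" using * m by (intro R) simp_all
    qed (simp_all add: point_matrix_def add.commute)
    have DUAL: "wp b DUAL s1 R"
      if "env s1" "table (mem s1) e" "regs s1 30 < N"
        and R: "\<And>s2 m. m \<le> time_dual \<Longrightarrow> mem s2 = mem s1 \<Longrightarrow> \<forall>r<32. regs s2 r = regs s1 r \<Longrightarrow>
          regs s2 32 < Q \<Longrightarrow> phi z (regs s2 32) = dual_weight z e t (phi z (regs s1 30)) \<Longrightarrow> R s2 m" for s1 R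
      by (rule wp_mono[OF DUAL_spec[OF that(1-3)]]) (simp add: R)
    have step: "I (Suc k) s2" if "\<forall>x. x < BM \<or> BA \<le> x \<longrightarrow> mem s2 x = mem s x" "\<forall>r<30. 0 < r \<longrightarrow> regs s2 r = regs s r"
      "regs s2 30 = Suc k" "regs s2 0 < Q"
      "phi z (regs s2 0) = (\<Sum>a<k. hafnian n (point_matrix (mem s) a) {..<n} * dual_weight z e t (phi z a)) +
         hafnian n (point_matrix (mem s) k) {..<n} * dual_weight z e t (phi z k)" for s2
      using that unfolding I_def by simp
    show "wp b ACCUMULATE_body s' (\<lambda>s2 m. I (Suc k) s2 \<and> m \<le> time_mat + time_haf + time_dual + time_mul + time_xor + 58)"
      unfolding ACCUMULATE_body_def using big env' I1 k k1
      apply (simp add: arith_simps)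
      apply (rule MAT)
      apply simp
      apply (rule HAF)
         apply (simp_all add: env_def)
      apply (rule DUAL)
         apply (simp_all add: arith_simps env_def)
      apply (rule MUL_wp)
         apply (simp_all add: arith_simps env_def)
      apply (rule XOR_wp)
         apply (simp_all add: arith_simps env_def)
      apply (rule step)
          apply (simp_all)
      done
  qed (use s1 env' in \<open>auto simp: I_def\<close>)
  have i0: "I 0 (set_reg 30 0 (set_reg 0 0 s))" using one_less_Q by (simp add: I_def)
  show ?thesis
    unfolding ACCUMULATE_def using env' big
    apply (simp add: arith_simps)
    apply (rule wp_mono[OF loop[OF i0]])
    apply (simp add: I_def time_sum_def)
    done
qed

end

section \<open>Uniformly distributed outcomes\<close>

lemma pair_pmf_of_set:
  assumes "finite A" "A \<noteq> {}" "finite B" "B \<noteq> {}"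
  shows "pair_pmf (pmf_of_set A) (pmf_of_set B) = pmf_of_set (A \<times> B)"
proof (rule pmf_eqI)
  fix x :: "'a \<times> 'b"
  obtain a b where x: "x = (a, b)" by (cases x)
  have AB: "A \<times> B \<noteq> {}" "finite (A \<times> B)" using assms by auto
  show "pmf (pair_pmf (pmf_of_set A) (pmf_of_set B)) x = pmf (pmf_of_set (A \<times> B)) x"
    unfolding x pmf_pair pmf_of_set[OF assms(2,1)] pmf_of_set[OF assms(4,3)] pmf_of_set[OF AB]
      card_cartesian_product by (simp add: indicator_def)
qed

text \<open>The final state is a function of a uniform sample from \<open>W\<close>, and
  \<open>R\<close> relates the two. Probabilities become counting, and coin-free phases simply
  transform \<open>R\<close> with the sample fixed.\<close>

definition halts_uniformly ::
    "nat \<Rightarrow> program \<Rightarrow> ram_state \<Rightarrow> nat \<Rightarrow> 'w set \<Rightarrow> ('w \<Rightarrow> ram_state \<Rightarrow> bool) \<Rightarrow> bool" where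
  "halts_uniformly b P s B W R \<longleftrightarrow>
     (\<exists>S. halts_with b P s B (map_pmf S (pmf_of_set W)) \<and> (\<forall>w\<in>W. R w (S w)))"

text \<open>Fresh coins are independent of the state reached, so the samples of the two phases form
  a product even though the second phase may depend on the first.\<close>

lemma halts_uniformly_Seq:
  assumes W: "finite W" "W \<noteq> {}" "finite V" "V \<noteq> {}"
    and P: "halts_uniformly b P s B W R1"
    and Q: "\<And>w s1. w \<in> W \<Longrightarrow> R1 w s1 \<Longrightarrow> halts_uniformly b Q s1 B' V (\<lambda>v. R (w, v))"
  shows "halts_uniformly b (Seq P Q) s (B + 1 + B') (W \<times> V) R"
proof -
  obtain S where S: "halts_with b P s B (map_pmf S (pmf_of_set W))" "\<And>w. w \<in> W \<Longrightarrow> R1 w (S w)"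
    using P unfolding halts_uniformly_def by blast
  have "\<forall>w\<in>W. \<exists>S2. halts_with b Q (S w) B' (map_pmf S2 (pmf_of_set V)) \<and> (\<forall>v\<in>V. R (w, v) (S2 v))"
    using Q S(2) unfolding halts_uniformly_def by blast
  then obtain S2 where S2: "\<And>w. w \<in> W \<Longrightarrow> halts_with b Q (S w) B' (map_pmf (S2 w) (pmf_of_set V))"
    "\<And>w v. w \<in> W \<Longrightarrow> v \<in> V \<Longrightarrow> R (w, v) (S2 w v)" by metis
  \<comment> \<open>\<open>S2\<close> is chosen per sample, but two samples may lead to the same
    state. Reading the distribution off the run makes it depend on the state alone.\<close>
  define D' where "D' s1 = map_pmf snd (run b B' (Q, s1))" for s1
  have D': "D' (S w) = map_pmf (S2 w) (pmf_of_set V)" if "w \<in> W" for w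
    using S2(1)[OF that] by (simp add: D'_def halts_with_def map_pmf_comp)
  have "halts_with b (Seq P Q) s (B + 1 + B') (bind_pmf (map_pmf S (pmf_of_set W)) D')"
  proof (rule halts_with_Seq[OF S(1)])
    fix s1 assume "s1 \<in> set_pmf (map_pmf S (pmf_of_set W))"
    then obtain w where "w \<in> W" "s1 = S w" using W by auto
    then show "halts_with b Q s1 B' (D' s1)" using S2(1) D' by simp
  qed
  also have "bind_pmf (map_pmf S (pmf_of_set W)) D' =
      bind_pmf (pmf_of_set W) (\<lambda>w. map_pmf (S2 w) (pmf_of_set V))"
    unfolding bind_map_pmf by (intro bind_pmf_cong refl) (use W D' in auto)
  also have "\<dots> = map_pmf (\<lambda>(w, v). S2 w v) (pair_pmf (pmf_of_set W) (pmf_of_set V))"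
    by (simp add: pair_pmf_def map_bind_pmf map_pmf_def bind_assoc_pmf bind_return_pmf)
  also have "\<dots> = map_pmf (\<lambda>(w, v). S2 w v) (pmf_of_set (W \<times> V))"
    by (simp only: pair_pmf_of_set[OF W])
  finally show ?thesis unfolding halts_uniformly_def using S2(2) by (intro exI) auto
qed

text \<open>Relabels the samples, so that pairs produced by sequencing can be read as words or
  lists.\<close>

lemma halts_uniformly_bij:
  assumes "finite W" "W \<noteq> {}" "bij_betw f W V" "halts_uniformly b P s B W (\<lambda>w. R (f w))"
  shows "halts_uniformly b P s B V R"
proof -
  obtain S where S: "halts_with b P s B (map_pmf S (pmf_of_set W))" "\<And>w. w \<in> W \<Longrightarrow> R (f w) (S w)"
    using assms(4) unfolding halts_uniformly_def by blast
  let ?g = "inv_into W f"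
  have g: "bij_betw ?g V W" using assms(3) by (rule bij_betw_inv_into)
  have V: "finite V" "V \<noteq> {}" using assms bij_betw_finite bij_betw_empty1 by (auto simp: bij_betw_def)
  have "map_pmf ?g (pmf_of_set V) = pmf_of_set W"
    by (rule map_pmf_of_set_bij_betw[OF g]) (use V in auto)
  then have "halts_with b P s B (map_pmf (\<lambda>v. S (?g v)) (pmf_of_set V))"
    using S(1) by (simp flip: map_pmf_comp)
  moreover have "R v (S (?g v))" if "v \<in> V" for v
    using S(2)[of "?g v"] that g assms(3) by (metis bij_betw_apply bij_betw_inv_into_right)
  ultimately show ?thesis unfolding halts_uniformly_def by blast
qed

lemma halts_uniformly_det:
  assumes "wp b P s (\<lambda>s' n. R () s' \<and> n \<le> B)"
  shows "halts_uniformly b P s B {()} R"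
proof -
  obtain s' where s': "halts_with b P s B (return_pmf s')" "R () s'" using wp_halts_with[OF assms] by blast
  have "halts_with b P s B (map_pmf (\<lambda>_. s') (pmf_of_set {()}))" using s'(1) by (simp add: map_pmf_const)
  then show ?thesis unfolding halts_uniformly_def using s'(2) by (intro exI[of _ "\<lambda>_. s'"]) simp
qed

lemma halts_uniformly_mono:
  assumes "halts_uniformly b P s B W R" "B \<le> B'" "\<And>w s'. w \<in> W \<Longrightarrow> R w s' \<Longrightarrow> R' w s'"
  shows "halts_uniformly b P s B' W R'"
  using assms halts_with_mono unfolding halts_uniformly_def by blast

lemma halts_uniformly_Seq_det:
  assumes W: "finite W" "W \<noteq> {}"
    and P: "wp b P s (\<lambda>s1 n. R1 s1 \<and> n \<le> B)"
    and Q: "\<And>s1. R1 s1 \<Longrightarrow> halts_uniformly b Q s1 B' W R"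
  shows "halts_uniformly b (Seq P Q) s (B + 1 + B') W R"
proof (rule halts_uniformly_bij[where f = snd and W = "{()} \<times> W"])
  show "halts_uniformly b (Seq P Q) s (B + 1 + B') ({()} \<times> W) (\<lambda>w. R (snd w))"
    by (rule halts_uniformly_Seq[where ?R1.0 = "\<lambda>_. R1"])
      (use W Q in \<open>auto intro!: halts_uniformly_det[where R = "\<lambda>_. R1"] P\<close>)
qed (use W in \<open>auto simp: bij_betw_def inj_on_def image_def\<close>)

lemma halts_uniformly_then_det:
  assumes W: "finite W" "W \<noteq> {}"
    and P: "halts_uniformly b P s B W R1"
    and Q: "\<And>w s1. w \<in> W \<Longrightarrow> R1 w s1 \<Longrightarrow> wp b Q s1 (\<lambda>s2 n. R w s2 \<and> n \<le> B')"
  shows "halts_uniformly b (Seq P Q) s (B + 1 + B') W R"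
proof (rule halts_uniformly_bij[where f = fst and W = "W \<times> {()}"])
  show "halts_uniformly b (Seq P Q) s (B + 1 + B') (W \<times> {()}) (\<lambda>w. R (fst w))"
    by (rule halts_uniformly_Seq[OF W _ _ P]) (use Q in \<open>auto intro!: halts_uniformly_det\<close>)
qed (use W in \<open>auto simp: bij_betw_def inj_on_def image_def\<close>)

lemma halts_uniformly_While_step:
  assumes "cond_val b c s" "halts_uniformly b (Seq P (While c P)) s B W R"
  shows "halts_uniformly b (While c P) s (Suc B) W R"
  using assms unfolding halts_uniformly_def halts_with_def by (simp add: bind_return_pmf)

lemma halts_uniformly_While_end:
  assumes "\<not> cond_val b c s" "\<And>w. w \<in> W \<Longrightarrow> R w s"
  shows "halts_uniformly b (While c P) s 1 W R"
proof -
  have "halts_with b (While c P) s 1 (map_pmf (\<lambda>_. s) (pmf_of_set W))"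
    using assms(1) by (simp add: halts_with_def bind_return_pmf map_pmf_const)
  then show ?thesis unfolding halts_uniformly_def using assms(2) by (intro exI[of _ "\<lambda>_. s"]) simp
qed

lemma halts_uniformly_Coin:
  assumes "\<And>k. k < 2 \<Longrightarrow> R k (set_reg r k s)"
  shows "halts_uniformly b (Coin r) s 1 {..<2} R"
proof -
  have "{..<2} = {0, 1 :: nat}" by auto
  then have "halts_with b (Coin r) s 1 (map_pmf (\<lambda>k. set_reg r k s) (pmf_of_set {..<2}))"
    by (simp add: halts_with_def bind_return_pmf' map_pmf_comp bind_map_pmf map_pmf_def[symmetric] cong: bind_pmf_cong)
  then show ?thesis unfolding halts_uniformly_def using assms by (intro exI[of _ "\<lambda>k. set_reg r k s"]) simp
qed

definition "BITS_body = Coin 44 ;; Arith 42 Add (Reg 42) (Reg 42) ;; Arith 42 Add (Reg 42) (Reg 44) ;;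
  Arith 43 Add (Reg 43) (Const 1)"

definition "BITS_loop = While (Less (Reg 43) (Reg 5)) BITS_body"

text \<open>Every cell draws a word, marked or not, so the sample space does not depend on the
  edges; the mark, 0 or 1, is multiplied with the word.\<close>

definition "RANDOM_body = MOV 42 (Const 0) ;; MOV 43 (Const 0) ;; BITS_loop ;;
  Load 45 (Reg 40) ;; Arith 45 Mul (Reg 45) (Reg 42) ;; Store (Reg 40) (Reg 45) ;; Arith 40 Add (Reg 40) (Const 1)"

definition "RANDOM_loop = While (Less (Reg 40) (Reg 41)) RANDOM_body"

definition "RANDOM = MOV 40 (Reg 12) ;; Arith 41 Add (Reg 12) (Reg 13) ;; RANDOM_loop"

context machine
begin

definition "time_random = L * (9 * e + 30) + 10"

end

context sized_machine
begin

text \<open>Induction on the number \<open>j\<close> of coins left, with \<open>x\<close> the bits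
  already drawn, most significant first. A coin \<open>c\<close> and the remaining bits
  \<open>w\<close> correspond bijectively to the number \<open>c * 2 ^ j + w\<close>, so uniformity
  passes from pairs to words.\<close>

lemma BITS_loop_spec:
  assumes "env s" "regs s 43 = e - j" "j \<le> e" "regs s 42 = x" "x < 2 ^ (e - j)"
  shows "halts_uniformly b BITS_loop s (9 * j + 1) {..<2 ^ j}
    (\<lambda>w s'. regs s' 42 = x * 2 ^ j + w \<and> mem s' = mem s \<and> (\<forall>r<42. regs s' r = regs s r))"
  using assms
proof (induction j arbitrary: s x)
  case 0
  then show ?case
    unfolding BITS_loop_def by (auto intro!: halts_uniformly_While_end[unfolded One_nat_def] simp: env_def)
next
  case (Suc j)
  note env' = Suc.prems(1)[unfolded env_def]
  have ej: "Suc (e - Suc j) = e - j" using Suc.prems by simp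
  have x2: "2 * x + 1 < 2 ^ (e - j)" if "x < 2 ^ (e - Suc j)" for x :: nat
  proof -
    have "2 * x + 2 \<le> 2 ^ Suc (e - Suc j)" using that unfolding power_Suc by linarith
    then show ?thesis unfolding ej by linarith
  qed
  have "(2 :: nat) ^ (e - j) \<le> N" unfolding N_def by (intro power_increasing) simp_all
  then have xN: "2 * x + 1 < N" using x2[OF Suc.prems(5)] by simp
  have eN: "e < N" by (simp add: N_def)
  have ad: "x + x < 2 ^ b" "x + x + c < 2 ^ b" "e - Suc j + 1 < 2 ^ b" if "c < 2" for c
    using xN eN layout that Suc.prems(3) by linarith+
  have ne: "{..<2} \<noteq> ({} :: nat set)" "{..<2 ^ j} \<noteq> ({} :: nat set)"
    by (metis lessThan_iff empty_iff zero_less_numeral, metis lessThan_iff empty_iff zero_less_numeral zero_less_power)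
  let ?R1 = "\<lambda>c s1. regs s1 42 = 2 * x + c \<and> regs s1 43 = e - j \<and> mem s1 = mem s \<and> (\<forall>r<42. regs s1 r = regs s r)"
  have body: "halts_uniformly b BITS_body s (1 + 1 + 5) {..<2} ?R1"
    unfolding BITS_body_def
  proof (rule halts_uniformly_then_det[where ?R1.0 = "\<lambda>c s1. s1 = set_reg 44 c s"])
    show "halts_uniformly b (Coin 44) s 1 {..<2} (\<lambda>c s1. s1 = set_reg 44 c s)"
      by (rule halts_uniformly_Coin) simp
    fix c and s1 :: ram_state assume "c \<in> {..<2 :: nat}" "s1 = set_reg 44 c s"
    then show "wp b (Arith 42 Add (Reg 42) (Reg 42) ;; Arith 42 Add (Reg 42) (Reg 44) ;; Arith 43 Add (Reg 43) (Const 1)) s1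
        (\<lambda>s2 n. ?R1 c s2 \<and> n \<le> 5)"
      using Suc.prems ad[of c] ej by (simp add: arith_simps)
  qed (use ne in auto)
  have "halts_uniformly b (Seq BITS_body BITS_loop) s ((1 + 1 + 5) + 1 + (9 * j + 1)) ({..<2} \<times> {..<2 ^ j})
     (\<lambda>(c, w) s'. regs s' 42 = x * 2 ^ Suc j + (c * 2 ^ j + w) \<and> mem s' = mem s \<and> (\<forall>r<42. regs s' r = regs s r))"
  proof (rule halts_uniformly_Seq[OF _ _ _ _ body])
    fix c and s1 :: ram_state assume c: "c \<in> {..<2 :: nat}" and s1: "?R1 c s1"
    have "halts_uniformly b BITS_loop s1 (9 * j + 1) {..<2 ^ j}
      (\<lambda>w s'. regs s' 42 = (2 * x + c) * 2 ^ j + w \<and> mem s' = mem s1 \<and> (\<forall>r<42. regs s' r = regs s1 r))"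
      by (rule Suc.IH) (use s1 env' Suc.prems c x2[OF Suc.prems(5)] in \<open>auto simp: env_def\<close>)
    then show "halts_uniformly b BITS_loop s1 (9 * j + 1) {..<2 ^ j}
      (\<lambda>w. case (c, w) of (c, w) \<Rightarrow> \<lambda>s'. regs s' 42 = x * 2 ^ Suc j + (c * 2 ^ j + w) \<and> mem s' = mem s \<and> (\<forall>r<42. regs s' r = regs s r))"
      by (rule halts_uniformly_mono) (use s1 in \<open>auto simp: algebra_simps\<close>)
  qed (use ne in auto)
  then have "halts_uniformly b (Seq BITS_body BITS_loop) s ((1 + 1 + 5) + 1 + (9 * j + 1)) {..<2 ^ Suc j}
     (\<lambda>w s'. regs s' 42 = x * 2 ^ Suc j + w \<and> mem s' = mem s \<and> (\<forall>r<42. regs s' r = regs s r))"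
  proof (intro halts_uniformly_bij[where f = "\<lambda>(c, w). c * 2 ^ j + w" and W = "{..<2} \<times> {..<2 ^ j}"])
    show "bij_betw (\<lambda>(c, w). c * 2 ^ j + w) ({..<2} \<times> {..<2 ^ j}) {..<(2 :: nat) ^ Suc j}"
    proof (rule bij_betw_byWitness[where f' = "\<lambda>y. (y div 2 ^ j, y mod 2 ^ j)"])
      show "(\<lambda>(c, w). c * 2 ^ j + w) ` ({..<2} \<times> {..<2 ^ j}) \<subseteq> {..<(2 :: nat) ^ Suc j}"
      proof safe
        fix c w :: nat assume "c < 2" "w < 2 ^ j"
        then have "c * 2 ^ j \<le> 1 * 2 ^ j" by (intro mult_right_mono) auto
        then show "c * 2 ^ j + w < 2 ^ Suc j" using \<open>w < 2 ^ j\<close> unfolding power_Suc by linarith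
      qed
    qed (auto simp: less_mult_imp_div_less div_mult_mod_eq)
  qed (use ne in \<open>auto simp: case_prod_beta' elim: halts_uniformly_mono\<close>)
  then have "halts_uniformly b BITS_loop s (Suc ((1 + 1 + 5) + 1 + (9 * j + 1))) {..<2 ^ Suc j}
     (\<lambda>w s'. regs s' 42 = x * 2 ^ Suc j + w \<and> mem s' = mem s \<and> (\<forall>r<42. regs s' r = regs s r))"
    unfolding BITS_loop_def using Suc.prems env' by (intro halts_uniformly_While_step) simp_all
  then show ?case by (rule halts_uniformly_mono) (simp_all add: mult_Suc_right)
qed

text \<open>The same scheme with lists: the first cell's word and the list for the other cells
  combine by \<open>#\<close>. The marks are at most 1, which rules out overflow in the
  product.\<close>

lemma RANDOM_loop_spec:
  assumes "env s" "regs s 40 = a" "regs s 41 = a + j" "a + j \<le> BA + L" "\<forall>i<j. mem s (a + i) \<le> 1"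
  shows "halts_uniformly b RANDOM_loop s (j * (9 * e + 30) + 1) (word_lists N j)
    (\<lambda>w s'. (\<forall>x. x < a \<or> a + j \<le> x \<longrightarrow> mem s' x = mem s x) \<and> (\<forall>r<40. regs s' r = regs s r) \<and>
      (\<forall>i<j. mem s' (a + i) = mem s (a + i) * w ! i))"
  using assms
proof (induction j arbitrary: s a)
  case 0
  then show ?case
    unfolding RANDOM_loop_def by (auto intro!: halts_uniformly_While_end[unfolded One_nat_def])
next
  case (Suc j)
  note env' = Suc.prems(1)[unfolded env_def]
  let ?R1 = "\<lambda>w s1. regs s1 40 = Suc a \<and> regs s1 41 = Suc a + j \<and> (\<forall>r<40. regs s1 r = regs s r) \<and>
    mem s1 = (mem s)(a := mem s a * w)"
  have m1: "mem s a \<le> 1" using Suc.prems(5)[rule_format, of 0] by simp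
  have NN: "N < 2 ^ b" "a + 1 < 2 ^ b" using layout Suc.prems(4) by linarith+
  have Npos: "0 < N" by (simp add: N_def)
  have body: "halts_uniformly b RANDOM_body s (3 + 1 + (((9 * e + 1) + 1 + 7))) {..<N} ?R1"
    unfolding RANDOM_body_def
  proof -
    show "halts_uniformly b (MOV 42 (Const 0) ;; MOV 43 (Const 0) ;; BITS_loop ;;
      Load 45 (Reg 40) ;; Arith 45 Mul (Reg 45) (Reg 42) ;; Store (Reg 40) (Reg 45) ;; Arith 40 Add (Reg 40) (Const 1)) s
      (3 + 1 + (((9 * e + 1) + 1 + 7))) {..<N} ?R1"
    proof (rule halts_uniformly_mono)
      show "halts_uniformly b (MOV 42 (Const 0) ;; MOV 43 (Const 0) ;; BITS_loop ;;
        Load 45 (Reg 40) ;; Arith 45 Mul (Reg 45) (Reg 42) ;; Store (Reg 40) (Reg 45) ;; Arith 40 Add (Reg 40) (Const 1)) s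
        (1 + 1 + (1 + 1 + ((9 * e + 1) + 1 + 7))) {..<N} ?R1"
      proof (rule halts_uniformly_Seq_det[where ?R1.0 = "\<lambda>s1. s1 = set_reg 42 0 s"])
        fix s1 :: ram_state assume s1: "s1 = set_reg 42 0 s"
        show "halts_uniformly b (MOV 43 (Const 0) ;; BITS_loop ;;
          Load 45 (Reg 40) ;; Arith 45 Mul (Reg 45) (Reg 42) ;; Store (Reg 40) (Reg 45) ;; Arith 40 Add (Reg 40) (Const 1)) s1
          (1 + 1 + ((9 * e + 1) + 1 + 7)) {..<N} ?R1"
        proof (rule halts_uniformly_Seq_det[where ?R1.0 = "\<lambda>s2. s2 = set_reg 43 0 s1"])
          fix s2 :: ram_state assume s2: "s2 = set_reg 43 0 s1"
          show "halts_uniformly b (BITS_loop ;;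
            Load 45 (Reg 40) ;; Arith 45 Mul (Reg 45) (Reg 42) ;; Store (Reg 40) (Reg 45) ;; Arith 40 Add (Reg 40) (Const 1)) s2
            ((9 * e + 1) + 1 + 7) {..<N} ?R1"
          proof (rule halts_uniformly_then_det)
            show "halts_uniformly b BITS_loop s2 (9 * e + 1) {..<N}
              (\<lambda>w s'. regs s' 42 = 0 * 2 ^ e + w \<and> mem s' = mem s2 \<and> (\<forall>r<42. regs s' r = regs s2 r))"
              unfolding N_def by (rule BITS_loop_spec) (use s1 s2 env' in \<open>auto simp: env_def\<close>)
            fix w and s3 :: ram_state assume w: "w \<in> {..<N}"
              and s3: "regs s3 42 = 0 * 2 ^ e + w \<and> mem s3 = mem s2 \<and> (\<forall>r<42. regs s3 r = regs s2 r)"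
            have "mem s a * w \<le> 1 * w" using m1 by (intro mult_right_mono) simp_all
            moreover have "w < N" using w by simp
            ultimately have "mem s a * w < 2 ^ b" using NN(1) by linarith
            then show "wp b (Load 45 (Reg 40) ;; Arith 45 Mul (Reg 45) (Reg 42) ;; Store (Reg 40) (Reg 45) ;; Arith 40 Add (Reg 40) (Const 1)) s3
              (\<lambda>s4 n. ?R1 w s4 \<and> n \<le> 7)"
              using s1 s2 s3 NN Suc.prems by (simp add: arith_simps set_mem_def)
          qed (use Npos in auto)
        qed (use Npos in \<open>auto simp: arith_simps\<close>)
      qed (use Npos in \<open>auto simp: arith_simps\<close>)
    qed simp_all
  qed
  have "halts_uniformly b (Seq RANDOM_body RANDOM_loop) s ((3 + 1 + ((9 * e + 1) + 1 + 7)) + 1 + (j * (9 * e + 30) + 1))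
    ({..<N} \<times> word_lists N j)
    (\<lambda>(v, w) s'. (\<forall>x. x < a \<or> a + Suc j \<le> x \<longrightarrow> mem s' x = mem s x) \<and> (\<forall>r<40. regs s' r = regs s r) \<and>
      (\<forall>i<Suc j. mem s' (a + i) = mem s (a + i) * (v # w) ! i))"
  proof (rule halts_uniformly_Seq[OF _ _ _ _ body])
    show "word_lists N j \<noteq> {}" using card_word_lists[of N j] Npos by auto
    fix v and s1 :: ram_state assume v: "v \<in> {..<N}" and s1: "?R1 v s1"
    have "halts_uniformly b RANDOM_loop s1 (j * (9 * e + 30) + 1) (word_lists N j)
      (\<lambda>w s'. (\<forall>x. x < Suc a \<or> Suc a + j \<le> x \<longrightarrow> mem s' x = mem s1 x) \<and> (\<forall>r<40. regs s' r = regs s1 r) \<and>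
        (\<forall>i<j. mem s' (Suc a + i) = mem s1 (Suc a + i) * w ! i))"
      by (rule Suc.IH) (use s1 env' Suc.prems in \<open>auto simp: env_def dest: spec[of _ "Suc _"]\<close>)
    then show "halts_uniformly b RANDOM_loop s1 (j * (9 * e + 30) + 1) (word_lists N j)
      (\<lambda>w. case (v, w) of (v, w) \<Rightarrow> \<lambda>s'. (\<forall>x. x < a \<or> a + Suc j \<le> x \<longrightarrow> mem s' x = mem s x) \<and> (\<forall>r<40. regs s' r = regs s r) \<and>
        (\<forall>i<Suc j. mem s' (a + i) = mem s (a + i) * (v # w) ! i))"
    proof (rule halts_uniformly_mono)
      fix w and s' :: ram_state assume *: "(\<forall>x. x < Suc a \<or> Suc a + j \<le> x \<longrightarrow> mem s' x = mem s1 x) \<and> (\<forall>r<40. regs s' r = regs s1 r) \<and>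
        (\<forall>i<j. mem s' (Suc a + i) = mem s1 (Suc a + i) * w ! i)"
      have "mem s' (a + i) = mem s (a + i) * (v # w) ! i" if "i < Suc j" for i
        using * s1 that by (cases i) simp_all
      then show "(case (v, w) of (v, w) \<Rightarrow> \<lambda>s'. (\<forall>x. x < a \<or> a + Suc j \<le> x \<longrightarrow> mem s' x = mem s x) \<and> (\<forall>r<40. regs s' r = regs s r) \<and>
        (\<forall>i<Suc j. mem s' (a + i) = mem s (a + i) * (v # w) ! i)) s'"
        using * s1 by simp
    qed simp
  qed (use Npos in auto)
  note product = this
  have bij: "bij_betw (\<lambda>(v, w). v # w) ({..<N} \<times> word_lists N j) (word_lists N (Suc j))"
    by (rule bij_betw_byWitness[where f' = "\<lambda>xs. (hd xs, tl xs)"])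
      (auto simp: word_lists_def length_Suc_conv)
  have ne: "{..<N} \<times> word_lists N j \<noteq> {}" "finite ({..<N} \<times> word_lists N j)"
    using card_word_lists[of N j] Npos by auto
  have "halts_uniformly b (Seq RANDOM_body RANDOM_loop) s ((3 + 1 + ((9 * e + 1) + 1 + 7)) + 1 + (j * (9 * e + 30) + 1))
    (word_lists N (Suc j))
    (\<lambda>w s'. (\<forall>x. x < a \<or> a + Suc j \<le> x \<longrightarrow> mem s' x = mem s x) \<and> (\<forall>r<40. regs s' r = regs s r) \<and>
      (\<forall>i<Suc j. mem s' (a + i) = mem s (a + i) * w ! i))"
    by (rule halts_uniformly_bij[OF ne(2,1) bij], rule halts_uniformly_mono[OF product order_refl])
      (simp add: case_prod_beta')
  then have "halts_uniformly b RANDOM_loop s (Suc ((3 + 1 + ((9 * e + 1) + 1 + 7)) + 1 + (j * (9 * e + 30) + 1))) (word_lists N (Suc j))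
    (\<lambda>w s'. (\<forall>x. x < a \<or> a + Suc j \<le> x \<longrightarrow> mem s' x = mem s x) \<and> (\<forall>r<40. regs s' r = regs s r) \<and>
      (\<forall>i<Suc j. mem s' (a + i) = mem s (a + i) * w ! i))"
    unfolding RANDOM_loop_def using Suc.prems by (intro halts_uniformly_While_step) simp_all
  then show ?case by (rule halts_uniformly_mono) simp_all
qed

lemma RANDOM_spec:
  assumes "env s" "\<forall>i<L. mem s (BA + i) \<le> 1"
  shows "halts_uniformly b RANDOM s time_random (word_lists N L)
    (\<lambda>w s'. (\<forall>x. x < BA \<or> BA + L \<le> x \<longrightarrow> mem s' x = mem s x) \<and> (\<forall>r<40. regs s' r = regs s r) \<and>
      (\<forall>i<L. mem s' (BA + i) = mem s (BA + i) * w ! i))"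
proof (rule halts_uniformly_mono)
  note env' = assms(1)[unfolded env_def]
  have W: "finite (word_lists N L)" "word_lists N L \<noteq> {}"
    using card_word_lists[of N L] by (auto simp: N_def)
  have ad: "BA < 2 ^ b" "BA + L < 2 ^ b" using layout by linarith+
  let ?R = "\<lambda>w s'. (\<forall>x. x < BA \<or> BA + L \<le> x \<longrightarrow> mem s' x = mem s x) \<and> (\<forall>r<40. regs s' r = regs s r) \<and>
      (\<forall>i<L. mem s' (BA + i) = mem s (BA + i) * w ! i)"
  show "halts_uniformly b RANDOM s (1 + 1 + (1 + 1 + (L * (9 * e + 30) + 1))) (word_lists N L) ?R"
    unfolding RANDOM_def
  proof (rule halts_uniformly_Seq_det[OF W, where ?R1.0 = "\<lambda>s1. s1 = set_reg 40 BA s"])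
    fix s1 :: ram_state assume s1: "s1 = set_reg 40 BA s"
    show "halts_uniformly b (Arith 41 Add (Reg 12) (Reg 13) ;; RANDOM_loop) s1 (1 + 1 + (L * (9 * e + 30) + 1)) (word_lists N L) ?R"
    proof (rule halts_uniformly_Seq_det[OF W, where ?R1.0 = "\<lambda>s2. s2 = set_reg 41 (BA + L) s1"])
      fix s2 :: ram_state assume s2: "s2 = set_reg 41 (BA + L) s1"
      have "halts_uniformly b RANDOM_loop s2 (L * (9 * e + 30) + 1) (word_lists N L)
        (\<lambda>w s'. (\<forall>x. x < BA \<or> BA + L \<le> x \<longrightarrow> mem s' x = mem s2 x) \<and> (\<forall>r<40. regs s' r = regs s2 r) \<and>
          (\<forall>i<L. mem s' (BA + i) = mem s2 (BA + i) * w ! i))"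
        by (rule RANDOM_loop_spec) (use s1 s2 env' assms(2) in \<open>simp_all add: env_def\<close>)
      then show "halts_uniformly b RANDOM_loop s2 (L * (9 * e + 30) + 1) (word_lists N L) ?R"
        by (rule halts_uniformly_mono) (use s1 s2 in simp_all)
    qed (use s1 env' ad in \<open>simp add: arith_simps\<close>)
  qed (use env' ad in \<open>simp add: arith_simps\<close>)
  show "1 + 1 + (1 + 1 + (L * (9 * e + 30) + 1)) \<le> time_random" by (simp add: time_random_def)
qed

end

section \<open>Setup, marking of cells and the main program\<close>

text \<open>Finds the least power \<open>N\<close> of 2 above \<open>4 * n * (t + 1)\<close>. The
  factor 4 bounds the error by a quarter, and \<open>n * t < N\<close> leaves room for the degree of
  the matching polynomial.\<close>

definition "DOUBLE_body = Arith 4 Add (Reg 4) (Reg 4) ;; Arith 5 Add (Reg 5) (Const 1)"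
definition "DOUBLE_loop = While (Less (Reg 4) (Reg 21)) DOUBLE_body"
text \<open>Register 24 holds the field degree \<open>2 * 3 ^ k\<close> and register 23, cubed in
  each round, holds \<open>2 ^ 3 ^ k\<close>. The loop stops once all \<open>e\<close>-bit points
  are field words.\<close>

definition "TRIPLE_body = Arith 24 Mul (Reg 24) (Const 3) ;; Arith 25 Mul (Reg 23) (Reg 23) ;; Arith 23 Mul (Reg 25) (Reg 23)"
definition "TRIPLE_loop = While (Less (Reg 24) (Reg 5)) TRIPLE_body"

definition "LAYOUT =
  Arith 6 Mul (Reg 23) (Reg 23) ;; Arith 7 Add (Reg 23) (Const 1) ;; Arith 14 Add (Reg 5) (Const 1) ;;
  Arith 8 Mul (Reg 2) (Const 3) ;; Arith 8 Add (Reg 8) (Const 4) ;;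
  Arith 9 Mul (Reg 14) (Reg 14) ;; Arith 9 Add (Reg 8) (Reg 9) ;;
  Arith 13 Mul (Reg 1) (Reg 1) ;; Arith 10 Add (Reg 9) (Reg 13) ;; Arith 11 Add (Reg 10) (Reg 1) ;;
  Arith 12 Add (Reg 11) (Reg 1) ;; Arith 13 Mul (Reg 13) (Reg 4)"

definition "SETUP =
  Arith 21 Add (Reg 3) (Const 1) ;; Arith 21 Mul (Reg 1) (Reg 21) ;; Arith 21 Mul (Const 4) (Reg 21) ;;
  Arith 21 Add (Reg 21) (Const 1) ;; MOV 4 (Const 1) ;; MOV 5 (Const 0) ;; DOUBLE_loop ;;
  MOV 23 (Const 2) ;; MOV 24 (Const 2) ;; TRIPLE_loop ;; LAYOUT"

text \<open>Weights are non-negative, so an edge heavier than \<open>t\<close> cannot occur in a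
  matching of weight \<open>t\<close>. Writing 1 instead of adding makes repeated edges count once;
  adding them up would let an even number cancel.\<close>

definition "MARK_body =
  Load 42 (Reg 41) ;; Arith 41 Add (Reg 41) (Const 1) ;; Load 43 (Reg 41) ;; Arith 41 Add (Reg 41) (Const 1) ;;
  Load 44 (Reg 41) ;; Arith 41 Add (Reg 41) (Const 1) ;;
  Cond (Less (Reg 3) (Reg 44)) Skip
    (Arith 45 Mul (Reg 42) (Reg 1) ;; Arith 45 Add (Reg 45) (Reg 43) ;; Arith 45 Mul (Reg 45) (Reg 4) ;;
     Arith 45 Add (Reg 45) (Reg 44) ;; Arith 45 Add (Reg 12) (Reg 45) ;; Store (Reg 45) (Const 1)) ;;
  Arith 40 Add (Reg 40) (Const 1)"

definition "MARK_loop = While (Less (Reg 40) (Reg 2)) MARK_body"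
definition "MARK = MOV 40 (Const 0) ;; MOV 41 (Const 4) ;; MARK_loop"
definition "FINISH = Cond (Equal (Reg 0) (Const 0)) Skip (MOV 0 (Const 1))"
definition "MAIN = SETUP ;; MARK ;; RANDOM ;; TABLE ;; FFT ;; ACCUMULATE ;; FINISH"

text \<open>\<open>e_least(2)\<close> and \<open>l_least\<close> say that the setup loops do not
  stop before \<open>e\<close> and \<open>l\<close>; the equations fix the memory regions one
  directly after the other, behind the input of 4 words and 3 per edge.\<close>

locale instance_machine = sized_machine +
  fixes E :: "wedge list"
  assumes n_pos: "0 < n"
    and e_least: "4 * (n * Suc t) < N" "\<And>k. k < e \<Longrightarrow> 2 ^ k \<le> 4 * (n * Suc t)"
    and l_least: "\<And>k. k < l \<Longrightarrow> 2 * 3 ^ k < e"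
    and layout_eq: "BS = length E * 3 + 4" "BM = BS + Suc e * Suc e" "BC = BM + n * n" "BJ = BC + n" "BA = BJ + n"
    and edges_valid: "\<And>i. i < length E \<Longrightarrow> fst (E ! i) < n \<and> fst (snd (E ! i)) < n \<and> fst (E ! i) \<noteq> fst (snd (E ! i))"
begin

text \<open>As an offset into the array this is the place of the coefficient of \<open>y ^ w\<close>
  in the polynomial of the ordered pair of ends, so the marked array is directly the input of the
  transform. Cells also index the random scalars.\<close>

definition cell :: "wedge \<Rightarrow> nat" where
  "cell x = (fst x * n + fst (snd x)) * N + snd (snd x)"

definition cells :: "nat set" where
  "cells = cell ` {x \<in> set E. snd (snd x) \<le> t}"

lemma t_less_N: "t < N" "n * t < N"
proof -
  have "Suc t \<le> n * Suc t" using n_pos by (cases n) simp_all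
  then show "t < N" using e_least(1) by linarith
  have "n * t \<le> n * Suc t" by (intro mult_left_mono) simp_all
  then show "n * t < N" using e_least(1) by linarith
qed

lemma cell_props:
  assumes "i < length E" "snd (snd (E ! i)) \<le> t"
  shows "cell (E ! i) < L" "cell (E ! i) div N div n = fst (E ! i)" "cell (E ! i) div N mod n = fst (snd (E ! i))"
    "cell (E ! i) mod N = snd (snd (E ! i))"
  using edges_valid[OF assms(1)] assms(2) t_less_N flat_index[of "fst (E ! i)" "fst (snd (E ! i))"]
    array_index[of "fst (E ! i) * n + fst (snd (E ! i))" "snd (snd (E ! i))"]
  by (auto simp: cell_def)

lemma DOUBLE_loop_spec:
  assumes "regs s 4 = 1" "regs s 5 = 0" "regs s 21 = 4 * (n * Suc t) + 1"
  shows "wp b DOUBLE_loop s (\<lambda>s' m. m \<le> e * 5 + 1 \<and> mem s' = mem s \<and> (\<forall>r<4. regs s' r = regs s r) \<and>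
    regs s' 4 = N \<and> regs s' 5 = e)"
  unfolding DOUBLE_loop_def
proof (rule wp_while_bound[where K = e and B = 3 and I = "\<lambda>k s'. mem s' = mem s \<and> (\<forall>r<4. regs s' r = regs s r) \<and>
    regs s' 4 = 2 ^ k \<and> regs s' 5 = k \<and> regs s' 21 = 4 * (n * Suc t) + 1"])
  fix k and s' :: ram_state
  assume k: "k < e" and I: "mem s' = mem s \<and> (\<forall>r<4. regs s' r = regs s r) \<and>
    regs s' 4 = 2 ^ k \<and> regs s' 5 = k \<and> regs s' 21 = 4 * (n * Suc t) + 1"
  show "cond_val b (Less (Reg 4) (Reg 21)) s'" using I e_least(2)[OF k] by simp
  have "(2 :: nat) ^ Suc k \<le> 2 ^ e" using k by (intro power_increasing) simp_all
  then have "(2 :: nat) ^ k + 2 ^ k < 2 ^ b" "k + 1 < 2 ^ b" using layout e_bound k unfolding N_def power_Suc by linarith+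
  then show "wp b DOUBLE_body s' (\<lambda>s2 m. (mem s2 = mem s \<and> (\<forall>r<4. regs s2 r = regs s r) \<and>
    regs s2 4 = 2 ^ Suc k \<and> regs s2 5 = Suc k \<and> regs s2 21 = 4 * (n * Suc t) + 1) \<and> m \<le> 3)"
    unfolding DOUBLE_body_def using I by (simp add: arith_simps)
qed (use assms e_least(1) in \<open>auto simp: N_def\<close>)

lemma TRIPLE_loop_spec:
  assumes "regs s 24 = 2" "regs s 23 = 2" "regs s 5 = e"
  shows "wp b TRIPLE_loop s (\<lambda>s' m. m \<le> l * 7 + 1 \<and> mem s' = mem s \<and> (\<forall>r<23. regs s' r = regs s r) \<and>
    regs s' 23 = 2 ^ 3 ^ l)"
  unfolding TRIPLE_loop_def
proof (rule wp_while_bound[where K = l and B = 5 and I = "\<lambda>k s'. mem s' = mem s \<and> (\<forall>r<23. regs s' r = regs s r) \<and>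
    regs s' 24 = 2 * 3 ^ k \<and> regs s' 23 = 2 ^ 3 ^ k"])
  fix k and s' :: ram_state
  assume k: "k < l" and I: "mem s' = mem s \<and> (\<forall>r<23. regs s' r = regs s r) \<and>
    regs s' 24 = 2 * 3 ^ k \<and> regs s' 23 = 2 ^ 3 ^ k"
  show "cond_val b (Less (Reg 24) (Reg 5)) s'" using I l_least[OF k] assms by simp
  define H Y where "H = (3 :: nat) ^ k" and "Y = (2 :: nat) ^ 3 ^ k"
  have "2 * 3 ^ Suc k \<le> d" unfolding d_def using k by (intro mult_left_mono power_increasing) simp_all
  then have H: "2 * H * 3 \<le> d" by (simp add: H_def)
  have "d < Q" by (simp add: Q_def)
  then have 1: "2 * H * 3 < 2 ^ b" using H big by linarith
  have "(3 :: nat) ^ Suc k \<le> d" using \<open>2 * 3 ^ Suc k \<le> d\<close> by simp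
  then have "(2 :: nat) ^ 3 ^ Suc k \<le> Q" unfolding Q_def by (intro power_increasing) simp_all
  moreover have Y3: "(2 :: nat) ^ 3 ^ Suc k = Y * Y * Y"
    by (simp add: Y_def power_mult[symmetric] power_add[symmetric])
  moreover have "Y * Y * 1 \<le> Y * Y * Y" by (intro mult_left_mono) (simp_all add: Y_def)
  ultimately have 2: "Y * Y < 2 ^ b" "Y * Y * Y < 2 ^ b" using big by linarith+
  have st: "2 * 3 ^ Suc k = 2 * H * 3" by (simp add: H_def)
  show "wp b TRIPLE_body s' (\<lambda>s2 m. (mem s2 = mem s \<and> (\<forall>r<23. regs s2 r = regs s r) \<and>
    regs s2 24 = 2 * 3 ^ Suc k \<and> regs s2 23 = 2 ^ 3 ^ Suc k) \<and> m \<le> 5)"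
    unfolding TRIPLE_body_def Y3 st using I[folded H_def Y_def] 1 2 by (simp add: arith_simps)
qed (use assms e in \<open>auto simp: d_def\<close>)

lemma SETUP_spec:
  assumes "regs s 1 = n" "regs s 2 = length E" "regs s 3 = t" "regs s 0 = 0"
  shows "wp b SETUP s (\<lambda>s' m. m \<le> e * 5 + l * 7 + 80 \<and> mem s' = mem s \<and> env s' \<and> regs s' 2 = length E)"
proof -
  define lim where "lim = 4 * (n * Suc t)"
  have lim: "lim < N" using e_least by (simp add: lim_def)
  have Nb: "4 * N < 2 ^ b" using layout by linarith
  have "Suc t \<le> n * Suc t" using n_pos by (cases n) simp_all
  then have ad: "t + 1 < 2 ^ b" "n * Suc t < 2 ^ b" "4 * (n * Suc t) < 2 ^ b" "4 * (n * Suc t) + 1 < 2 ^ b"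
    using lim Nb unfolding lim_def by linarith+
  have "2 mod 2 ^ b = (2 :: nat)" by (rule mod_less) (use big in linarith)
  then have two: "arith_val b Add 2 0 = 2" by (simp add: arith_val.simps(1))
  have QQ: "2 ^ 3 ^ l * 2 ^ 3 ^ l = Q" by (simp add: Q_def d_def mult_2 power_add)
  have lay: "Q < 2 ^ b" "(2 :: nat) ^ 3 ^ l + 1 < 2 ^ b" "e + 1 < 2 ^ b" "length E * 3 < 2 ^ b" "length E * 3 + 4 < 2 ^ b"
    "Suc e * Suc e < 2 ^ b" "BS + Suc e * Suc e < 2 ^ b" "n * n < 2 ^ b" "BM + n * n < 2 ^ b" "BC + n < 2 ^ b"
    "BJ + n < 2 ^ b" "n * n * N < 2 ^ b"
    using layout layout_eq big phi_low(2) e_bound n_bounds unfolding L_def by linarith+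
  define h e2 n2 where "h = (2 :: nat) ^ 3 ^ l" and "e2 = Suc e * Suc e" and "n2 = n * n"
  have av: "arith_val b Mul h h = Q" "arith_val b Add h 1 = h + 1" "arith_val b Add e 1 = Suc e"
    "arith_val b Mul (length E) 3 = length E * 3" "arith_val b Add (length E * 3) 4 = BS"
    "arith_val b Mul (Suc e) (Suc e) = e2" "arith_val b Add BS e2 = BM" "arith_val b Mul n n = n2"
    "arith_val b Add BM n2 = BC" "arith_val b Add BC n = BJ" "arith_val b Add BJ n = BA" "arith_val b Mul n2 N = L"
    using lay layout_eq QQ unfolding arith_val.simps L_def h_def e2_def n2_def
    by (simp_all only: mod_less Suc_eq_plus1)
  show ?thesis
    unfolding SETUP_def using assms ad two
    apply (simp add: arith_simps)
    apply (rule wp_mono[OF DOUBLE_loop_spec])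
       apply (simp_all add: arith_simps)
    apply (rule wp_mono[OF TRIPLE_loop_spec])
       apply (simp_all add: arith_simps)
    subgoal premises prems for s1 m1 s2 m2
      unfolding LAYOUT_def env_def h_def[symmetric] using prems[folded h_def] av
      by (simp add: arith_simps)
    done
qed

lemma MARK_spec:
  assumes env: "env s" and m: "regs s 2 = length E"
    and inp: "\<And>i. i < length E \<Longrightarrow> mem s (4 + i * 3) = fst (E ! i) \<and> mem s (5 + i * 3) = fst (snd (E ! i)) \<and>
      mem s (6 + i * 3) = snd (snd (E ! i))"
    and zero: "\<forall>c<L. mem s (BA + c) = 0"
  shows "wp b MARK s (\<lambda>s' m. m \<le> length E * 40 + 10 \<and> (\<forall>x<BA. mem s' x = mem s x) \<and> env s' \<and>
    (\<forall>c<L. mem s' (BA + c) = (if c \<in> cells then 1 else 0)))"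
proof -
  note env' = env[unfolded env_def]
  define C where "C k = {cell (E ! i) | i. i < k \<and> snd (snd (E ! i)) \<le> t}" for k
  define I where "I k s' \<longleftrightarrow> (\<forall>x<BA. mem s' x = mem s x) \<and> (\<forall>r<40. regs s' r = regs s r) \<and>
    regs s' 40 = k \<and> regs s' 41 = 4 + k * 3 \<and> (\<forall>c<L. mem s' (BA + c) = (if c \<in> C k then 1 else 0))" for k and s' :: ram_state
  have loop: "wp b MARK_loop s1 (\<lambda>s' m. m \<le> length E * 40 + 1 \<and> I (length E) s')" if s1: "I 0 s1" for s1
    unfolding MARK_loop_def
  proof (rule wp_while_bound[where K = "length E" and B = 38 and I = I])
    fix k s' assume k: "k < length E" and I: "I k s'"
    show "cond_val b (Less (Reg 40) (Reg 2)) s'" using I k m by (simp add: I_def)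
    define u v w where "u = fst (E ! k)" and "v = fst (snd (E ! k))" and "w = snd (snd (E ! k))"
    define p where "p = 4 + k * 3"
    have "Suc (Suc (Suc p)) \<le> BS" using k layout_eq(1) unfolding p_def by linarith
    then have lt: "Suc (Suc p) < BA" "Suc p < BA" "p < BA" "Suc (Suc (Suc p)) < 2 ^ b" "k + 1 < 2 ^ b"
      using layout unfolding p_def by linarith+
    have p: "5 + k * 3 = Suc p" "6 + k * 3 = Suc (Suc p)" "4 + Suc k * 3 = Suc (Suc (Suc p))"
      unfolding p_def mult_Suc by linarith+
    have I1: "\<forall>r<40. regs s' r = regs s r" "regs s' 40 = k" "regs s' 41 = p"
      "mem s' p = u" "mem s' (Suc p) = v" "mem s' (Suc (Suc p)) = w"
      using I inp[OF k, folded p_def, unfolded p] lt unfolding I_def p_def[symmetric] u_def v_def w_def by simp_all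
    have CS: "C (Suc k) = (if w \<le> t then insert (cell (E ! k)) (C k) else C k)"
      by (auto simp: C_def w_def less_Suc_eq)
    show "wp b MARK_body s' (\<lambda>s2 m. I (Suc k) s2 \<and> m \<le> 38)"
    proof (cases "w \<le> t")
      case True
      define c where "c = (u * n + v) * N + w"
      have c: "c = cell (E ! k)" "c < L" using cell_props[OF k] True by (auto simp: c_def cell_def u_def v_def w_def)
      have uv: "u * n + v < n * n" using edges_valid[OF k] flat_index by (simp add: u_def v_def)
      have ad: "u * n < 2 ^ b" "u * n + v < 2 ^ b" "(u * n + v) * N < 2 ^ b" "c < 2 ^ b" "BA + c < 2 ^ b"
        using c(2) uv n_bounds unfolding c_def by linarith+
      have "I (Suc k) s2" if "mem s2 = (mem s')(BA + c := 1)" "\<forall>r<40. regs s2 r = regs s r" "regs s2 40 = Suc k" "regs s2 41 = Suc (Suc (Suc p))" for s2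
        using that I True unfolding I_def p CS p_def[symmetric] by (auto simp: c)
      then show ?thesis
        unfolding MARK_body_def using I1 lt ad True env' by (simp add: arith_simps mem_set_mem_fun c_def[symmetric])
    next
      case False
      have "I (Suc k) s2" if "mem s2 = mem s'" "\<forall>r<40. regs s2 r = regs s r" "regs s2 40 = Suc k" "regs s2 41 = Suc (Suc (Suc p))" for s2
        using that I False unfolding I_def p CS p_def[symmetric] by auto
      then show ?thesis
        unfolding MARK_body_def using I1 lt False env' by (simp add: arith_simps)
    qed
  qed (use s1 m in \<open>auto simp: I_def\<close>)
  have Call: "C (length E) = cells"
  proof (intro equalityI subsetI)
    fix c assume "c \<in> C (length E)"
    then show "c \<in> cells" by (auto simp: C_def cells_def)
  next
    fix c assume "c \<in> cells"
    then obtain x where x: "x \<in> set E" "snd (snd x) \<le> t" "c = cell x" unfolding cells_def by blast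
    then obtain i where "i < length E" "x = E ! i" by (metis in_set_conv_nth)
    then show "c \<in> C (length E)" unfolding C_def using x by blast
  qed
  have i0: "I 0 (set_reg 41 4 (set_reg 40 0 s))" using zero by (simp add: I_def C_def)
  show ?thesis
    unfolding MARK_def using big
    apply (simp add: arith_simps)
    apply (rule wp_mono[OF loop[OF i0]])
    apply (use env' in \<open>simp add: I_def Call env_def\<close>)
    done
qed

definition edge_ends :: "nat \<Rightarrow> nat set" where
  "edge_ends c = {c div N div n, c div N mod n}"

text \<open>The monomials of the polynomial that is tested for zero: each matching of weight
  \<open>t\<close>, as a set of cells, is a set of variables.\<close>

definition families :: "nat set set" where
  "families = {C \<in> pm_sets edge_ends cells {..<n}. (\<Sum>c\<in>C. c mod N) = t}"

lemma cellsE: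
  assumes "c \<in> cells"
  obtains i where "i < length E" "snd (snd (E ! i)) \<le> t" "c = cell (E ! i)"
  using assms unfolding cells_def by (auto simp: in_set_conv_nth)

lemma cells_props:
  assumes "c \<in> cells"
  shows "c < L" "c mod N \<le> t" "c div N div n < n" "c div N mod n < n" "c div N div n \<noteq> c div N mod n" "card (edge_ends c) = 2"
proof -
  obtain i where i: "i < length E" "snd (snd (E ! i)) \<le> t" "c = cell (E ! i)" using cellsE[OF assms] .
  note p = cell_props[OF i(1,2)] and v = edges_valid[OF i(1)]
  show "c < L" "c mod N \<le> t" "c div N div n < n" "c div N mod n < n" "c div N div n \<noteq> c div N mod n"
    using p v i by simp_all
  then show "card (edge_ends c) = 2" by (simp add: edge_ends_def)
qed

lemma finite_cells: "finite cells"
  by (simp add: cells_def)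

lemma prod_monom: "finite A \<Longrightarrow> (\<Prod>c\<in>A. Polynomial.monom (x c) (w c)) = Polynomial.monom (\<Prod>c\<in>A. x c) (\<Sum>c\<in>A. w c)"
  for x :: "'c \<Rightarrow> 'b :: comm_ring_1"
  by (induction A rule: finite_induct) (simp_all add: mult_monom)

text \<open>\<open>f\<close> is the generating polynomial of the matchings by weight. Its values are
  hafnians once cells with the same ends are merged, and its degree is below the number of points,
  so the dual weights extract the coefficient of \<open>y ^ t\<close>.\<close>

lemma hafnian_sum_eq:
  fixes x :: "nat \<Rightarrow> 'a"
  assumes G: "\<And>i y. i < n * n \<Longrightarrow> g i y = (\<Sum>w<N. (if i * N + w \<in> cells then x (i * N + w) else 0) * y ^ w)"
  shows "(\<Sum>a<N. hafnian n (\<lambda>u v. g (u * n + v) (phi z a) + g (v * n + u) (phi z a)) {..<n} * dual_weight z e t (phi z a)) =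
    subspace_coeff z e 0 * (\<Sum>C\<in>families. \<Prod>c\<in>C. x c)"
proof -
  define f where "f = pm_sum edge_ends (\<lambda>c. Polynomial.monom (x c) (c mod N)) cells {..<n}"
  have ev: "poly f y = hafnian n (\<lambda>u v. g (u * n + v) y + g (v * n + u) y) {..<n}" for y
  proof -
    define B where "B u v = (\<Sum>c | c \<in> cells \<and> edge_ends c = {u, v}. x c * y ^ (c mod N))" for u v
    have "poly f y = pm_sum edge_ends (\<lambda>c. x c * y ^ (c mod N)) cells {..<n}"
      by (simp add: f_def pm_sum_def poly_sum poly_prod poly_monom)
    also have "\<dots> = hafnian n B {..<n}"
      by (rule pm_sum_eq_hafnian) (use finite_cells cells_props(6) in \<open>auto simp: B_def\<close>)
    also have "\<dots> = hafnian n (\<lambda>u v. g (u * n + v) y + g (v * n + u) y) {..<n}"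
    proof (rule hafnian_cong)
      fix u v assume uv: "u \<in> {..<n}" "v \<in> {..<n}"
      have row: "g (u * n + v) y = (\<Sum>c | c \<in> cells \<and> c div N = u * n + v. x c * y ^ (c mod N))"
        if "u < n" "v < n" for u v
      proof -
        let ?i = "u * n + v"
        have dm: "?i * N + c mod N = c" if "c div N = ?i" for c
          using that div_mult_mod_eq[of c N] by metis
        have N0: "0 < N" by (simp add: N_def)
        have "(\<Sum>w<N. (if ?i * N + w \<in> cells then x (?i * N + w) else 0) * y ^ w) =
          (\<Sum>w\<in>{w. w < N \<and> ?i * N + w \<in> cells}. x (?i * N + w) * y ^ w)"
          by (rule sum.mono_neutral_cong_right) auto
        also have "\<dots> = (\<Sum>c | c \<in> cells \<and> c div N = ?i. x c * y ^ (c mod N))"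
          by (rule sum.reindex_bij_witness[of _ "\<lambda>c. c mod N" "\<lambda>w. ?i * N + w"]) (auto simp: dm N0)
        finally show ?thesis using G[of ?i y] flat_index[OF that] by simp
      qed
      show "B u v = g (u * n + v) y + g (v * n + u) y"
      proof (cases "u = v")
        case True
        have "{c. c \<in> cells \<and> edge_ends c = {u, v}} = {}"
          using cells_props(6) True by fastforce
        then have "B u v = 0" by (simp only: B_def sum.empty)
        then show ?thesis using True by simp
      next
        case False
        have iff: "c div N = p * n + q \<longleftrightarrow> c div N div n = p \<and> c div N mod n = q" if "p < n" "q < n" for c p q
          using that by (auto simp: div_mult_mod_eq)
        \<comment> \<open>Cells with ends \<open>u\<close> and \<open>v\<close> split according to
          the order in which the ends are listed, matching the two summands of the matrix
          entry.\<close>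
        have "{c. c \<in> cells \<and> edge_ends c = {u, v}} =
          {c. c \<in> cells \<and> c div N = u * n + v} \<union> {c. c \<in> cells \<and> c div N = v * n + u}"
          using uv iff by (auto simp: edge_ends_def doubleton_eq_iff)
        moreover have "{c. c \<in> cells \<and> c div N = u * n + v} \<inter> {c. c \<in> cells \<and> c div N = v * n + u} = {}"
          using uv iff False by auto
        ultimately show ?thesis
          using uv finite_cells by (simp add: B_def row sum.union_disjoint)
      qed
    qed
    finally show ?thesis .
  qed
  have fm: "f = (\<Sum>C\<in>pm_sets edge_ends cells {..<n}. Polynomial.monom (\<Prod>c\<in>C. x c) (\<Sum>c\<in>C. c mod N))"
    unfolding f_def pm_sum_def
  proof (rule sum.cong[OF refl])
    fix C assume "C \<in> pm_sets edge_ends cells {..<n}"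
    then have "finite C" using finite_cells finite_subset unfolding pm_sets_def by blast
    then show "(\<Prod>c\<in>C. Polynomial.monom (x c) (c mod N)) = Polynomial.monom (\<Prod>c\<in>C. x c) (\<Sum>c\<in>C. c mod N)"
      by (rule prod_monom)
  qed
  \<comment> \<open>At most \<open>n\<close> cells of weight at most \<open>t\<close> each; this is
    where \<open>n * t < N\<close> comes from.\<close>
  have "Polynomial.degree f \<le> n * t"
    unfolding fm
  proof (rule degree_sum_le)
    show "finite (pm_sets edge_ends cells {..<n})" by (rule finite_pm_sets[OF finite_cells])
    fix C assume C: "C \<in> pm_sets edge_ends cells {..<n}"
    then have "C \<subseteq> cells" by (auto simp: pm_sets_def)
    then have "(\<Sum>c\<in>C. c mod N) \<le> (\<Sum>c\<in>C. t)" using cells_props(2) by (intro sum_mono) auto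
    also have "\<dots> = card C * t" by simp
    also have "\<dots> \<le> n * t"
      using pm_sets_card_le[OF C] by (intro mult_right_mono) (auto simp: edge_ends_def)
    finally show "Polynomial.degree (Polynomial.monom (\<Prod>c\<in>C. x c) (\<Sum>c\<in>C. c mod N)) \<le> n * t"
      using degree_monom_le order_trans by blast
  qed
  then have deg: "Polynomial.degree f < 2 ^ e" using t_less_N(2) unfolding N_def by linarith
  have co: "Polynomial.coeff f t = (\<Sum>C\<in>families. \<Prod>c\<in>C. x c)"
    unfolding fm coeff_sum families_def
    by (rule sum.mono_neutral_cong_right) (auto simp: finite_pm_sets[OF finite_cells])
  have inj: "inj_on (phi z) {..<2 ^ e}"
    using phi_inj_Q by (rule inj_on_subset) (use N_bounds in \<open>auto simp: N_def\<close>)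
  show ?thesis
    using coefficient_from_subspace_values[OF inj deg, of t] t_less_N(1) unfolding ev co by (simp add: N_def)
qed

end

lemma wp_Seq_bound:
  assumes "wp b P s (\<lambda>s1 k. R1 s1 \<and> k \<le> B)" "\<And>s1. R1 s1 \<Longrightarrow> wp b Q s1 (\<lambda>s2 k. R s2 \<and> k \<le> B')"
  shows "wp b (Seq P Q) s (\<lambda>s2 k. R s2 \<and> k \<le> B + 1 + B')"
  unfolding wp_Seq
proof (rule wp_mono[OF assms(1)])
  fix s1 n1 assume 1: "R1 s1 \<and> n1 \<le> B"
  then show "wp b Q s1 (\<lambda>s2 n2. R s2 \<and> Suc (n1 + n2) \<le> B + 1 + B')"
    by (intro wp_mono[OF assms(2)]) auto
qed

context instance_machine
begin

definition "time_main = (e * 5 + l * 7 + 80) + (length E * 40 + 10) + time_random + time_table + time_fft + time_sum + 20"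

lemma MAIN_spec:
  assumes regs: "regs s 1 = n" "regs s 2 = length E" "regs s 3 = t" "regs s 0 = 0"
    and inp: "\<And>i. i < length E \<Longrightarrow> mem s (4 + i * 3) = fst (E ! i) \<and> mem s (5 + i * 3) = fst (snd (E ! i)) \<and>
      mem s (6 + i * 3) = snd (snd (E ! i))"
    and zero: "\<And>a. BS \<le> a \<Longrightarrow> mem s a = 0"
  shows "halts_uniformly b MAIN s time_main (word_lists N L)
    (\<lambda>w s'. regs s' 0 = (if multilinear (phi z) families w = 0 then 0 else 1))"
proof -
  have W: "finite (word_lists N L)" "word_lists N L \<noteq> {}"
    using card_word_lists[of N L] by (auto simp: N_def)
  let ?R = "\<lambda>w s'. regs s' 0 = (if multilinear (phi z) families w = 0 then 0 else (1 :: nat))"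
  let ?T = "time_table + 1 + (time_fft + 1 + (time_sum + 1 + 3))"
  have rest: "wp b (TABLE ;; FFT ;; ACCUMULATE ;; FINISH) s1 (\<lambda>s2 k. ?R w s2 \<and> k \<le> ?T)"
    if w: "w \<in> word_lists N L" and env: "env s1" and z0: "\<forall>a. BS \<le> a \<and> a < BM \<longrightarrow> mem s1 a = 0"
      and arr: "\<forall>c<L. mem s1 (BA + c) = (if c \<in> cells then 1 else 0) * w ! c" for w s1
  proof -
    have wQ: "w ! c < N" if "c < L" for c
    proof -
      have "w ! c \<in> set w" using w that by (simp add: word_lists_def)
      then show ?thesis using w by (auto simp: word_lists_def)
    qed
    have Qs: "\<forall>c<L. mem s1 (BA + c) < Q"
    proof (intro allI impI)
      fix c assume "c < L"
      then show "mem s1 (BA + c) < Q" using arr wQ[of c] N_bounds by (cases "c \<in> cells") auto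
    qed
    define g where "g i y = ev (mem s1) (BA + i * N) N y" for i y
    have g: "g i y = (\<Sum>w'<N. (if i * N + w' \<in> cells then phi z (w ! (i * N + w')) else 0) * y ^ w')" if "i < n * n" for i y
      unfolding g_def ev_def using arr array_index[OF that] by (intro sum.cong) (auto simp: add.assoc)
    have fin: "wp b FINISH s4 (\<lambda>s5 k. ?R w s5 \<and> k \<le> 3)"
      if r0: "regs s4 0 < Q" "phi z (regs s4 0) = (\<Sum>a<N. hafnian n (point_matrix M a) {..<n} * dual_weight z e t (phi z a))"
        and M: "\<forall>a<L. M (BA + a) < Q \<and> phi z (M (BA + a)) = ev (mem s1) (BA + a div N * N) N (phi z (a mod N))" for s4 M
    proof -
      have entry: "phi z (M (BA + (i * N + a))) = g i (phi z a)" if "i < n * n" "a < N" for i a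
        using M array_index[OF that] that by (simp add: g_def)
      have "phi z (regs s4 0) = (\<Sum>a<N. hafnian n (\<lambda>u v. g (u * n + v) (phi z a) + g (v * n + u) (phi z a)) {..<n} * dual_weight z e t (phi z a))"
        unfolding r0(2)
        by (intro sum.cong refl arg_cong2[where f = times] hafnian_cong) (simp add: point_matrix_def entry flat_index)
      also have "\<dots> = subspace_coeff z e 0 * multilinear (phi z) families w"
        unfolding multilinear_def by (rule hafnian_sum_eq) (rule g)
      \<comment> \<open>The scaling factor \<open>subspace_coeff z e 0\<close> is nonzero, and a
        field word is 0 iff its value is.\<close>
      finally have "regs s4 0 = 0 \<longleftrightarrow> multilinear (phi z) families w = 0"
        using phi_eq_0_iff[OF r0(1)] subspace_coeff_0_neq_0[OF phi_inj_Q[unfolded Q_def] e(2)] by simp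
      then show ?thesis unfolding FINISH_def using big by (simp add: arith_simps)
    qed
    show ?thesis
    proof (rule wp_Seq_bound)
      let ?R1 = "\<lambda>s2. (\<forall>a. a < BS \<or> BM \<le> a \<longrightarrow> mem s2 a = mem s1 a) \<and> (\<forall>r<50. regs s2 r = regs s1 r) \<and> table (mem s2) e"
      show "wp b TABLE s1 (\<lambda>s2 k. ?R1 s2 \<and> k \<le> time_table)"
        by (rule wp_mono[OF TABLE_spec[OF env z0]]) blast
      fix s2 :: ram_state assume 2: "?R1 s2"
      have m2: "mem s2 (BA + c) = mem s1 (BA + c)" for c
      proof -
        have "BM \<le> BA + c" using layout by linarith
        then show ?thesis using 2 by blast
      qed
      have ev2: "ev (mem s2) (BA + i) N y = ev (mem s1) (BA + i) N y" for i y
        by (rule ev_cong) (simp add: m2 add.assoc)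
      have env2: "env s2" using 2 env by (simp add: env_def)
      have Qs2: "\<forall>a<L. mem s2 (BA + a) < Q" unfolding m2 by (rule Qs)
      have tab2: "table (mem s2) e" using 2 by blast
      show "wp b (FFT ;; ACCUMULATE ;; FINISH) s2 (\<lambda>s3 k. ?R w s3 \<and> k \<le> time_fft + 1 + (time_sum + 1 + 3))"
      proof (rule wp_Seq_bound)
        let ?R2 = "\<lambda>s3. (\<forall>a. a < BA \<or> BA + L \<le> a \<longrightarrow> mem s3 a = mem s2 a) \<and> (\<forall>r<40. regs s3 r = regs s2 r) \<and>
          (\<forall>a<L. mem s3 (BA + a) < Q \<and> phi z (mem s3 (BA + a)) = ev (mem s2) (BA + a div N * N) N (phi z (a mod N)))"
        show "wp b FFT s2 (\<lambda>s3 k. ?R2 s3 \<and> k \<le> time_fft)"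
          by (rule wp_mono[OF FFT_spec[OF env2 tab2 Qs2]]) blast
        fix s3 :: ram_state assume 3: "?R2 s3"
        have low: "mem s2 a = mem s3 a" if "a < BM" for a
        proof -
          have "a < BA" using that layout by linarith
          then have "mem s3 a = mem s2 a" using 3 by blast
          then show ?thesis ..
        qed
        have "table (mem s2) e = table (mem s3) e" by (rule table_cong[OF order_refl]) (rule low)
        then have tab3: "table (mem s3) e" using tab2 by (rule iffD1)
        have env3: "env s3" using 3 env2 by (simp add: env_def)
        have Qs3: "\<forall>a<L. mem s3 (BA + a) < Q" using 3 by blast
        show "wp b (ACCUMULATE ;; FINISH) s3 (\<lambda>s4 k. ?R w s4 \<and> k \<le> time_sum + 1 + 3)"
        proof (rule wp_Seq_bound)
          let ?R3 = "\<lambda>s4. regs s4 0 < Q \<and> phi z (regs s4 0) =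
            (\<Sum>a<N. hafnian n (point_matrix (mem s3) a) {..<n} * dual_weight z e t (phi z a))"
          show "wp b ACCUMULATE s3 (\<lambda>s4 k. ?R3 s4 \<and> k \<le> time_sum)"
            by (rule wp_mono[OF ACCUMULATE_spec[OF env3 tab3 Qs3]]) blast
          fix s4 :: ram_state assume 4: "?R3 s4"
          have "\<forall>a<L. mem s3 (BA + a) < Q \<and> phi z (mem s3 (BA + a)) = ev (mem s1) (BA + a div N * N) N (phi z (a mod N))"
            using 3 unfolding ev2 by blast
          then show "wp b FINISH s4 (\<lambda>s5 k. ?R w s5 \<and> k \<le> 3)"
            using fin[of s4 "mem s3"] 4 by blast
        qed
      qed
    qed
  qed
  have tail: "halts_uniformly b (RANDOM ;; TABLE ;; FFT ;; ACCUMULATE ;; FINISH) s1 (time_random + 1 + ?T) (word_lists N L) ?R"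
    if env: "env s1" and mem: "\<forall>x<BA. mem s1 x = mem s x" and mark: "\<forall>c<L. mem s1 (BA + c) = (if c \<in> cells then 1 else 0)" for s1
  proof (rule halts_uniformly_then_det[OF W RANDOM_spec[OF env]])
    show "\<forall>i<L. mem s1 (BA + i) \<le> 1" using mark by simp
    fix w and s2 :: ram_state assume w: "w \<in> word_lists N L"
      and 2: "(\<forall>x. x < BA \<or> BA + L \<le> x \<longrightarrow> mem s2 x = mem s1 x) \<and> (\<forall>r<40. regs s2 r = regs s1 r) \<and>
        (\<forall>i<L. mem s2 (BA + i) = mem s1 (BA + i) * w ! i)"
    show "wp b (TABLE ;; FFT ;; ACCUMULATE ;; FINISH) s2 (\<lambda>s2 k. ?R w s2 \<and> k \<le> ?T)"
    proof (rule rest[OF w])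
      show "env s2" using env 2 by (simp add: env_def)
      show "\<forall>a. BS \<le> a \<and> a < BM \<longrightarrow> mem s2 a = 0"
      proof (intro allI impI)
        fix a assume a: "BS \<le> a \<and> a < BM"
        then have "a < BA" using layout by linarith
        then show "mem s2 a = 0" using 2 mem zero a by simp
      qed
      show "\<forall>c<L. mem s2 (BA + c) = (if c \<in> cells then 1 else 0) * w ! c" using 2 mark by simp
    qed
  qed
  have BSBA: "BS \<le> BA" using layout by linarith
  have mark: "halts_uniformly b (MARK ;; RANDOM ;; TABLE ;; FFT ;; ACCUMULATE ;; FINISH) s1
      ((length E * 40 + 10) + 1 + (time_random + 1 + ?T)) (word_lists N L) ?R"
    if "mem s1 = mem s \<and> env s1 \<and> regs s1 2 = length E" for s1
  proof (rule halts_uniformly_Seq_det[OF W, where ?R1.0 = "\<lambda>s2. env s2 \<and> (\<forall>x<BA. mem s2 x = mem s x) \<and>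
      (\<forall>c<L. mem s2 (BA + c) = (if c \<in> cells then 1 else 0))"])
    show "wp b MARK s1 (\<lambda>s2 k. (env s2 \<and> (\<forall>x<BA. mem s2 x = mem s x) \<and>
      (\<forall>c<L. mem s2 (BA + c) = (if c \<in> cells then 1 else 0))) \<and> k \<le> length E * 40 + 10)"
      by (rule wp_mono[OF MARK_spec]) (use that inp zero BSBA in auto)
  qed (use tail in blast)
  have "halts_uniformly b MAIN s ((e * 5 + l * 7 + 80) + 1 + ((length E * 40 + 10) + 1 + (time_random + 1 + ?T))) (word_lists N L) ?R"
    unfolding MAIN_def
  proof (rule halts_uniformly_Seq_det[OF W, where ?R1.0 = "\<lambda>s1. mem s1 = mem s \<and> env s1 \<and> regs s1 2 = length E"])
    show "wp b SETUP s (\<lambda>s1 k. (mem s1 = mem s \<and> env s1 \<and> regs s1 2 = length E) \<and> k \<le> e * 5 + l * 7 + 80)"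
      by (rule wp_mono[OF SETUP_spec[OF regs]]) auto
  qed (use mark in blast)
  then show ?thesis by (rule halts_uniformly_mono) (simp_all add: time_main_def)
qed

end

section \<open>Running time, meaning of the families and error probability\<close>

context instance_machine
begin

text \<open>Deliberately coarse: \<open>W = n * Suc d\<close> dominates \<open>n\<close> and the
  logarithmic quantities alike, so every bound is a constant times a power of \<open>W\<close>, with
  a factor \<open>N\<close> for work done per point. The sixth power suffices because
  \<open>N\<close> itself contributes one more factor \<open>n\<close>.\<close>

lemma time_main_le: "time_main \<le> 3090 * (N * (n * Suc d) ^ 6) + 40 * length E"
proof -
  define W where "W = n * Suc d"
  define W2 W3 W4 W5 W6 where "W2 = W * W" and "W3 = W * W2" and "W4 = W * W3" and "W5 = W * W4" and "W6 = W * W5"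
  define M3 M5 M6 where "M3 = N * W3" and "M5 = N * W5" and "M6 = N * W6"
  have sc: "x * y \<le> k * (p * q)" if "x \<le> p" "y \<le> k * q" for x y k p q :: nat
    using mult_mono[OF that] by (simp add: mult.left_commute)
  have "1 * Suc d \<le> W" "n * 1 \<le> W" unfolding W_def using n_pos by (intro mult_mono; simp)+
  then have "Suc d \<le> W" "n \<le> W" by (simp_all only: mult_1 mult_1_right)
  then have le: "Suc e \<le> W" "e \<le> W" "d \<le> W" "n \<le> W" "1 \<le> W" using e by linarith+
  have "l < 3 ^ l" by (rule power_gt_expt) simp
  then have l: "l \<le> W" using le unfolding d_def by linarith
  have up: "p \<le> W * p" for p using mult_right_mono[OF le(5), of p] by simp
  have W: "W \<le> W2" "W2 \<le> W3" "W3 \<le> W4" "W4 \<le> W5" "W5 \<le> W6" "1 \<le> W2" "1 \<le> W3" "1 \<le> W4" "1 \<le> W5" "1 \<le> W6"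
    using up[of W] up[of W2] up[of W3] up[of W4] up[of W5] le(5)
    unfolding W2_def[symmetric] W3_def[symmetric] W4_def[symmetric] W5_def[symmetric] W6_def[symmetric] by linarith+
  have N1: "1 \<le> N" by (simp add: N_def)
  have upN: "p \<le> N * p" for p using mult_right_mono[OF N1, of p] by simp
  have M: "M3 \<le> M5" "M5 \<le> M6" "W6 \<le> M6"
    using W upN[of W6] by (simp_all add: M3_def M5_def M6_def)
  have nn: "n * n \<le> W2" unfolding W2_def using le by (intro mult_mono) simp_all
  have Lle: "L \<le> N * W2" unfolding L_def using nn by (simp add: mult.commute)
  have xor: "time_xor \<le> 20 * W" unfolding time_xor_def using le by linarith
  have mul: "time_mul \<le> 77 * W2" unfolding time_mul_def
    using sc[of d W "32 + 2 * time_xor" 72 W, folded W2_def] xor le W by linarith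
  have pow: "time_pow \<le> 191 * W3" unfolding time_pow_def
    using sc[of d W "32 + 2 * time_mul" 186 W2, folded W3_def] mul le W by linarith
  have seval: "time_seval \<le> 234 * W3" unfolding time_seval_def
    using sc[of "Suc e" W "2 * time_mul + time_xor + 40" 214 W2, folded W3_def] mul xor le W by linarith
  have row: "time_row \<le> 215 * W3" unfolding time_row_def
    using sc[of "Suc e" W "2 * time_mul + time_xor + 40" 214 W2, folded W3_def] mul xor le W by linarith
  have table: "time_table \<le> 499 * W4" unfolding time_table_def
    using sc[of e W "time_seval + time_row + 40" 489 W3, folded W4_def] seval row le W by linarith
  have inner: "time_inner \<le> 138 * W3" unfolding time_inner_def
    using sc[of e W "time_mul + time_xor + 40" 137 W2, folded W3_def] mul xor le W by linarith
  have block: "time_block \<le> 970 * W3" unfolding time_block_def using inner mul xor seval W by linarith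
  have M5: "N * W2 * W3 = M5" and M3: "N * W2 * W = M3"
    by (simp_all add: M5_def M3_def W5_def W4_def W3_def W2_def ac_simps)
  have WM5: "W * M5 = M6" by (simp add: M5_def M6_def W6_def ac_simps)
  have "L * (time_block + 2) \<le> 972 * M5"
    using sc[of L "N * W2" "time_block + 2" 972 W3, unfolded M5] block Lle W by linarith
  then have fft: "time_fft \<le> 994 * M6" unfolding time_fft_def
    using sc[of e W "L * (time_block + 2) + 12" 984 M5, unfolded WM5] le W M upN[of W5, folded M5_def] by linarith
  have random: "time_random \<le> 49 * M6" unfolding time_random_def
    using sc[of L "N * W2" "9 * e + 30" 39 W, unfolded M3] Lle le W M by linarith
  have mat: "time_mat \<le> 90 * W3" unfolding time_mat_def
    using sc[of "n * n" W2 "time_xor + 60" 80 W] nn xor le W unfolding W3_def mult.commute[of W W2] by linarith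
  have find: "time_find \<le> 40 * W" unfolding time_find_def using le by linarith
  have copy: "time_copy \<le> 118 * W3" unfolding time_copy_def
    using sc[of n W "time_mul + 40" 117 W2, folded W3_def] mul le W by linarith
  have WW4: "W2 * W2 = W4" by (simp add: W4_def W3_def W2_def ac_simps)
  have update: "time_update \<le> 275 * W4" unfolding time_update_def
    using sc[of "n * n" W2 "2 * time_mul + 2 * time_xor + 80" 274 W2, unfolded WW4] nn mul xor le W by linarith
  have elim: "time_elim \<le> 721 * W4" unfolding time_elim_def using mul pow copy update W by linarith
  have haf: "time_haf \<le> 801 * W5" unfolding time_haf_def
    using sc[of n W "time_find + time_elim + 20" 781 W4, folded W5_def] find elim le W by linarith
  have dual: "time_dual \<le> 368 * W4" unfolding time_dual_def
    using sc[of "Suc e" W "time_pow + time_mul + time_xor + 60" 348 W3, folded W4_def] pow mul xor le W by linarith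
  have "time_sum \<le> 1426 * M5" unfolding time_sum_def
    using sc[of N N "time_mat + time_haf + time_dual + time_mul + time_xor + 60" 1416 W5, folded M5_def]
      mat haf dual mul xor le W upN[of W5, folded M5_def] by linarith
  then have "time_main \<le> 3090 * M6 + 40 * length E"
    unfolding time_main_def using fft random table W M l le by linarith
  also have "M6 = N * (n * Suc d) ^ 6"
    by (simp add: M6_def W6_def W5_def W4_def W3_def W2_def W_def[symmetric] eval_nat_numeral)
  finally show ?thesis .
qed

text \<open>From cells to edges one representative edge per cell is chosen. Conversely a matching
  never uses two edges of the same cell, and all its weights are at most \<open>t\<close>, so
  passing to cells preserves ends and total weight.\<close>

lemma families_nonempty_iff:
  "families \<noteq> {} \<longleftrightarrow> (\<exists>M\<subseteq>{..<length E}. (\<forall>v<n. \<exists>!i. i \<in> M \<and> v \<in> ends (E ! i)) \<and> (\<Sum>i\<in>M. weight (E ! i)) = t)"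
    (is "_ \<longleftrightarrow> (\<exists>M\<subseteq>_. ?P M)")
proof
  have ends: "ends w = {fst w, fst (snd w)}" and weight: "weight w = snd (snd w)" for w
    by (cases w, simp add: ends_def weight_def)+
  have ee: "edge_ends (cell (E ! i)) = ends (E ! i)" "cell (E ! i) mod N = weight (E ! i)"
    if "i < length E" "weight (E ! i) \<le> t" for i
    using cell_props[OF that(1)] that(2) by (simp_all add: edge_ends_def ends weight)
  show "\<exists>M\<subseteq>{..<length E}. ?P M" if ne: "families \<noteq> {}"
  proof -
    obtain C where C: "C \<in> pm_sets edge_ends cells {..<n}" "(\<Sum>c\<in>C. c mod N) = t"
      using ne unfolding families_def by blast
    note C' = C(1)[unfolded pm_sets_def mem_Collect_eq]
    have C1: "C \<subseteq> cells" using C' by (rule conjunct1)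
    have C2: "\<exists>!c. c \<in> C \<and> v \<in> edge_ends c" if "v < n" for v
      using bspec[OF conjunct2[OF conjunct2[OF C']], of v] that by (simp only: lessThan_iff)
    have "\<forall>c\<in>C. \<exists>i. i < length E \<and> weight (E ! i) \<le> t \<and> c = cell (E ! i)"
    proof
      fix c assume "c \<in> C"
      then have "c \<in> cells" using C1 by blast
      then obtain i where "i < length E" "snd (snd (E ! i)) \<le> t" "c = cell (E ! i)" by (rule cellsE)
      then show "\<exists>i. i < length E \<and> weight (E ! i) \<le> t \<and> c = cell (E ! i)" unfolding weight by blast
    qed
    then obtain h where h: "\<And>c. c \<in> C \<Longrightarrow> h c < length E \<and> weight (E ! h c) \<le> t \<and> c = cell (E ! h c)" by metis
    have hc: "ends (E ! h c) = edge_ends c" "weight (E ! h c) = c mod N" if "c \<in> C" for c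
      using ee[of "h c"] h[OF that] by simp_all
    have inj: "inj_on h C"
    proof (rule inj_onI)
      fix a c assume "a \<in> C" "c \<in> C" "h a = h c"
      then show "a = c" using h[of a] h[of c] by metis
    qed
    have "(\<Sum>i\<in>h ` C. weight (E ! i)) = (\<Sum>c\<in>C. c mod N)"
      unfolding sum.reindex[OF inj] by (rule sum.cong) (simp_all add: hc(2))
    then have sum: "(\<Sum>i\<in>h ` C. weight (E ! i)) = t" using C(2) by (rule trans)
    have ex1: "\<exists>!i. i \<in> h ` C \<and> v \<in> ends (E ! i)" if v: "v < n" for v
    proof -
      obtain c where c: "c \<in> C" "v \<in> edge_ends c" "\<And>c'. c' \<in> C \<Longrightarrow> v \<in> edge_ends c' \<Longrightarrow> c' = c"
        using C2[OF v] by blast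
      show ?thesis
      proof (rule ex1I[of _ "h c"])
        show "h c \<in> h ` C \<and> v \<in> ends (E ! h c)" using c(1,2) hc(1) by simp
        fix i assume "i \<in> h ` C \<and> v \<in> ends (E ! i)"
        then obtain c' where c': "c' \<in> C" "i = h c'" "v \<in> ends (E ! h c')" by blast
        have "v \<in> edge_ends c'" using c'(3) unfolding hc(1)[OF c'(1)] .
        then have "c' = c" by (rule c(3)[OF c'(1)])
        then show "i = h c" using c'(2) by simp
      qed
    qed
    have sub: "h ` C \<subseteq> {..<length E}" using h by blast
    show ?thesis
    proof (intro exI[of _ "h ` C"] conjI allI impI)
      show "\<exists>!i. i \<in> h ` C \<and> v \<in> ends (E ! i)" if "v < n" for v using that by (rule ex1)
    qed (rule sub sum)+
  qed
  assume "\<exists>M\<subseteq>{..<length E}. ?P M"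
  then obtain M where M1: "M \<subseteq> {..<length E}" and M2: "\<forall>v<n. \<exists>!i. i \<in> M \<and> v \<in> ends (E ! i)"
    and M3: "(\<Sum>i\<in>M. weight (E ! i)) = t" by (elim exE conjE) (rule that)
  note M = M1 M2[rule_format] M3
  have fin: "finite M" using M(1) finite_subset by blast
  define h where "h i = cell (E ! i)" for i
  have i: "i < length E \<and> weight (E ! i) \<le> t" if "i \<in> M" for i
  proof -
    have "weight (E ! i) \<le> (\<Sum>i\<in>M. weight (E ! i))"
      by (rule member_le_sum[of i M "\<lambda>i. weight (E ! i)"]) (use fin that in auto)
    then show ?thesis using M1 M3 that by auto
  qed
  have hi: "edge_ends (h i) = ends (E ! i)" "h i mod N = weight (E ! i)" "h i \<in> cells" if "i \<in> M" for i
  proof -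
    show "edge_ends (h i) = ends (E ! i)" "h i mod N = weight (E ! i)"
      unfolding h_def using ee[of i] i[OF that] by blast+
    show "h i \<in> cells"
      unfolding h_def cells_def using i[OF that] unfolding weight by (intro imageI CollectI conjI nth_mem) simp_all
  qed
  \<comment> \<open>Two edges in one cell share an end vertex, which a perfect matching covers only
    once.\<close>
  have inj: "inj_on h M"
  proof (rule inj_onI)
    fix i j assume ij: "i \<in> M" "j \<in> M" "h i = h j"
    have "fst (E ! i) < n" using edges_valid i ij by blast
    moreover have "fst (E ! i) \<in> ends (E ! i)" "fst (E ! i) \<in> ends (E ! j)"
      using hi(1)[OF ij(1)] hi(1)[OF ij(2)] ij(3) by (simp_all add: ends)
    ultimately show "i = j" using M(2)[of "fst (E ! i)"] ij(1,2) by blast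
  qed
  have "(\<Sum>c\<in>h ` M. c mod N) = (\<Sum>i\<in>M. weight (E ! i))"
    unfolding sum.reindex[OF inj] by (rule sum.cong) (simp_all add: hi(2))
  then have sum: "(\<Sum>c\<in>h ` M. c mod N) = t" using M3 by (rule trans)
  have "h ` M \<in> pm_sets edge_ends cells {..<n}"
    unfolding pm_sets_def
  proof (intro CollectI conjI ballI)
    show "h ` M \<subseteq> cells" using hi by blast
    show "edge_ends c \<subseteq> {..<n}" if "c \<in> h ` M" for c
    proof -
      have "c \<in> cells" using that hi(3) by blast
      then show ?thesis using cells_props(3,4)[of c] by (simp add: edge_ends_def)
    qed
    fix v assume "v \<in> {..<n}"
    then obtain i where i: "i \<in> M" "v \<in> ends (E ! i)" "\<And>j. j \<in> M \<Longrightarrow> v \<in> ends (E ! j) \<Longrightarrow> j = i"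
      using M(2)[of v] by blast
    show "\<exists>!c. c \<in> h ` M \<and> v \<in> edge_ends c"
    proof (rule ex1I[of _ "h i"])
      show "h i \<in> h ` M \<and> v \<in> edge_ends (h i)" using i(1,2) hi(1) by simp
      fix c assume "c \<in> h ` M \<and> v \<in> edge_ends c"
      then obtain j where j: "j \<in> M" "c = h j" "v \<in> edge_ends (h j)" by blast
      have "j = i" using j(3) unfolding hi(1)[OF j(1)] by (rule i(3)[OF j(1)])
      then show "c = h i" using j(2) by simp
    qed
  qed
  then show "families \<noteq> {}" using sum unfolding families_def by blast
qed

text \<open>The error is one-sided: without a suitable matching the polynomial is 0 at every sample.
  Otherwise its degree is at most \<open>n\<close> and \<open>4 * n \<le> N\<close>, so at most a
  quarter of the samples are zeros.\<close>

lemma good_words: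
  defines "G \<equiv> {w \<in> word_lists N L. multilinear (phi z) families w = 0 \<longleftrightarrow> families = {}}"
  shows "2 * card (word_lists N L) \<le> 3 * card G"
proof (cases "families = {}")
  case True
  then have "G = word_lists N L" by (auto simp: G_def multilinear_def)
  then show ?thesis by simp
next
  case False
  define Z where "Z = {w \<in> word_lists N L. multilinear (phi z) families w = 0}"
  have "inj_on (phi z) {..<N}"
    using phi_inj_Q by (rule inj_on_subset) (use N_bounds in auto)
  moreover have "families \<subseteq> Pow {..<L}" using cells_props(1) by (auto simp: families_def pm_sets_def)
  moreover have "card C \<le> n" if "C \<in> families" for C
    using pm_sets_card_le[of C edge_ends cells "{..<n}"] that by (auto simp: families_def edge_ends_def)
  ultimately have "card Z * N \<le> n * N ^ L"
    unfolding Z_def using False by (intro schwartz_zippel_multilinear)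
  then have Z: "4 * card Z * N \<le> 4 * n * N ^ L" by simp
  have "n * 1 \<le> n * Suc t" by (intro mult_left_mono) simp_all
  then have "n \<le> n * Suc t" by (simp only: mult_1_right)
  then have "4 * n \<le> N" using e_least(1) by linarith
  then have "4 * n * N ^ L \<le> N * N ^ L" by (rule mult_right_mono) simp
  with Z have "N * (4 * card Z) \<le> N * N ^ L" by (simp only: mult.commute[of N "4 * card Z"])
  then have "4 * card Z \<le> N ^ L" by (simp only: mult_le_cancel1) (simp add: N_def)
  moreover have "G = word_lists N L - Z" "Z \<subseteq> word_lists N L" using False by (auto simp: G_def Z_def)
  then have "card G = N ^ L - card Z" by (simp add: card_Diff_subset finite_subset card_word_lists)
  ultimately show ?thesis unfolding card_word_lists by linarith
qed

end

lemma halts_uniformly_Cond: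
  assumes "halts_uniformly b (if cond_val b c s then P else Q) s B W R"
  shows "halts_uniformly b (Cond c P Q) s (Suc B) W R"
  using assms unfolding halts_uniformly_def halts_with_def by (simp add: bind_return_pmf)

lemma halts_uniformly_prob:
  assumes "halts_uniformly b P s B V R" "finite V" "V \<noteq> {}" "G \<subseteq> V" "2 * card V \<le> 3 * card G"
    and "\<And>w s'. w \<in> G \<Longrightarrow> R w s' \<Longrightarrow> regs s' 0 = a"
  shows "(\<forall>(Q, s') \<in> set_pmf (run b B (P, s)). Q = Skip) \<and>
    measure_pmf.prob (run b B (P, s)) {(Q, s'). regs s' 0 = a} \<ge> 2 / 3"
proof -
  obtain S where S: "run b B (P, s) = map_pmf (\<lambda>w. (Skip, S w)) (pmf_of_set V)" "\<And>w. w \<in> V \<Longrightarrow> R w (S w)"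
    using assms(1) unfolding halts_uniformly_def halts_with_def by (auto simp: map_pmf_comp)
  have VG: "V \<inter> G = G" using assms(4) by blast
  have cV: "0 < card V" using assms(2,3) by (simp add: card_gt_0_iff)
  have "2 * real (card V) \<le> 3 * real (card G)" using assms(5) by linarith
  then have "2 / 3 \<le> real (card G) / real (card V)" using cV by (simp add: field_simps)
  also have "\<dots> = measure_pmf.prob (pmf_of_set V) G"
    by (simp add: measure_pmf_of_set[OF assms(3,2)] VG)
  also have "\<dots> \<le> measure_pmf.prob (pmf_of_set V) ((\<lambda>w. (Skip, S w)) -` {(Q, s'). regs s' 0 = a})"
    using assms(4,6) S(2) by (intro measure_pmf.finite_measure_mono) auto
  finally show ?thesis unfolding S(1) by auto
qed

section \<open>Choice of the parameters and the decision procedure\<close>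

text \<open>Least values, as these are where the doubling and tripling loops stop; stated outside
  the locale because the time bound mentions them.\<close>

definition "exponent n t = (LEAST e. 4 * (n * Suc t) < (2 :: nat) ^ e)"
definition "level e = (LEAST l. e \<le> 2 * (3 :: nat) ^ l)"

lemma exponent_least:
  shows "4 * (n * Suc t) < 2 ^ exponent n t" "k < exponent n t \<Longrightarrow> 2 ^ k \<le> 4 * (n * Suc t)"
proof -
  show "4 * (n * Suc t) < 2 ^ exponent n t"
    unfolding exponent_def by (rule LeastI[of _ "4 * (n * Suc t)"]) (rule less_exp)
  show "2 ^ k \<le> 4 * (n * Suc t)" if "k < exponent n t"
    using not_less_Least[OF that[unfolded exponent_def]] by simp
qed

lemma level_least:
  shows "e \<le> 2 * 3 ^ level e" "k < level e \<Longrightarrow> 2 * 3 ^ k < e"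
proof -
  have "e < 3 ^ e" by (rule power_gt_expt) simp
  then have "e \<le> 2 * 3 ^ e" by linarith
  then show "e \<le> 2 * 3 ^ level e" unfolding level_def by (rule LeastI[of "\<lambda>l. e \<le> 2 * 3 ^ l" e])
  show "2 * 3 ^ k < e" if "k < level e"
    using not_less_Least[OF that[unfolded level_def]] by simp
qed

lemma exponent_bounds:
  assumes "0 < n"
  shows "0 < exponent n t" "2 ^ exponent n t \<le> 8 * (n * Suc t)"
proof -
  have "1 \<le> n * Suc t" using assms by simp
  then have "exponent n t \<noteq> 0" using exponent_least(1)[of n t] by (intro notI) simp
  then obtain k where "exponent n t = Suc k" by (cases "exponent n t") auto
  then show "0 < exponent n t" "2 ^ exponent n t \<le> 8 * (n * Suc t)"
    using exponent_least(2)[of k n t] unfolding power_Suc by simp_all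
qed

text \<open>By minimality the previous field degree was too small, so tripling overshoots by less
  than a factor 3; the degree stays logarithmic in the number of points.\<close>

lemma level_le:
  assumes "0 < e"
  shows "2 * 3 ^ level e \<le> 3 * e"
proof (cases "level e")
  case 0
  then show ?thesis using assms by simp
next
  case (Suc k)
  then show ?thesis using level_least(2)[of k e] by simp
qed

text \<open>Register 0 starts as 0, so \<open>Skip\<close> answers no. A negative target is never
  attained, and without vertices only the empty matching, of weight 0, remains; \<open>MAIN\<close>
  is entered with at least one vertex.\<close>

definition "DECIDE =
  Seq (Load 1 (Const 0) ;; Load 2 (Const 1) ;; Load 20 (Const 2) ;; Load 3 (Const 3))
    (Cond (Equal (Reg 20) (Const 1)) Skip
      (Cond (Equal (Reg 1) (Const 0)) (Cond (Equal (Reg 3) (Const 0)) (MOV 0 (Const 1)) Skip) MAIN))"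

definition time_bound :: "exact_matching_instance \<Rightarrow> nat" where
  "time_bound x = (let n = num_verts x; e = exponent n (nat (target x)) in
     3090 * (2 ^ e * (n * Suc (2 * 3 ^ level e)) ^ 6) + 40 * num_edges x + 60)"

lemma concat_triples:
  fixes es :: "wedge list"
  defines "c \<equiv> concat (map (\<lambda>(u, v, w). [u, v, w]) es)"
  shows "length c = length es * 3"
    and "i < length es \<Longrightarrow> c ! (i * 3) = fst (es ! i) \<and> c ! Suc (i * 3) = fst (snd (es ! i)) \<and>
      c ! Suc (Suc (i * 3)) = snd (snd (es ! i))"
proof -
  show "length c = length es * 3" unfolding c_def by (induction es) auto
  show "i < length es \<Longrightarrow> c ! (i * 3) = fst (es ! i) \<and> c ! Suc (i * 3) = fst (snd (es ! i)) \<and>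
      c ! Suc (Suc (i * 3)) = snd (snd (es ! i))" unfolding c_def
  proof (induction es arbitrary: i)
    case (Cons y es)
    obtain u v w where y: "y = (u, v, w)" by (cases y) auto
    show ?case
    proof (cases i)
      case (Suc j)
      have "Suc j * 3 = Suc (Suc (Suc (j * 3)))" unfolding mult_Suc by linarith
      then show ?thesis using Cons.IH[of j] Cons.prems Suc y by (simp del: mult_Suc)
    qed (simp add: y)
  qed simp
qed

lemma input_state_mem:
  shows "mem (input_state x) 0 = num_verts x" "mem (input_state x) (Suc 0) = num_edges x"
    "mem (input_state x) 2 = (if target x < 0 then 1 else 0)" "mem (input_state x) 3 = nat \<bar>target x\<bar>"
    and "i < num_edges x \<Longrightarrow> mem (input_state x) (4 + i * 3) = fst (edges x ! i) \<and>
      mem (input_state x) (5 + i * 3) = fst (snd (edges x ! i)) \<and> mem (input_state x) (6 + i * 3) = snd (snd (edges x ! i))"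
    and "num_edges x * 3 + 4 \<le> a \<Longrightarrow> mem (input_state x) a = 0"
    and "regs (input_state x) r = 0"
proof -
  let ?c = "concat (map (\<lambda>(u, v, w). [u, v, w]) (edges x))"
  have len: "length (input_words x) = num_edges x * 3 + 4"
    using concat_triples(1)[of "edges x"] by (simp add: input_words_def)
  have nth: "input_words x ! Suc (Suc (Suc (Suc k))) = ?c ! k" for k by (simp add: input_words_def)
  show "mem (input_state x) 0 = num_verts x" "mem (input_state x) (Suc 0) = num_edges x"
    "mem (input_state x) 2 = (if target x < 0 then 1 else 0)" "mem (input_state x) 3 = nat \<bar>target x\<bar>"
    using len by (simp_all add: input_state_def input_words_def numeral_2_eq_2 numeral_3_eq_3)
  show "mem (input_state x) a = 0" if "num_edges x * 3 + 4 \<le> a"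
    using that len by (simp add: input_state_def)
  show "regs (input_state x) r = 0" by (simp add: input_state_def)
  assume i: "i < num_edges x"
  have a: "4 + i * 3 = Suc (Suc (Suc (Suc (i * 3))))" "5 + i * 3 = Suc (Suc (Suc (Suc (Suc (i * 3)))))"
    "6 + i * 3 = Suc (Suc (Suc (Suc (Suc (Suc (i * 3))))))" by linarith+
  have "Suc (Suc (Suc (Suc (Suc (Suc (i * 3)))))) < length (input_words x)" unfolding len using i by linarith
  then show "mem (input_state x) (4 + i * 3) = fst (edges x ! i) \<and>
      mem (input_state x) (5 + i * 3) = fst (snd (edges x ! i)) \<and> mem (input_state x) (6 + i * 3) = snd (snd (edges x ! i))"
    unfolding a using concat_triples(2)[OF i] by (simp add: input_state_def nth)
qed

text \<open>Origin of the constant 20: with \<open>y\<close> two more than the largest input number,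
  \<open>N \<le> y ^ 5\<close>, hence \<open>4 * Q \<le> 4 * N ^ 3 \<le> y ^ 17\<close>, and the
  memory needs fewer than \<open>16 * y ^ 10 \<le> y ^ 14\<close> words. Constants are absorbed
  through \<open>2 \<le> y\<close>.\<close>

lemma instance_machine_exists:
  fixes z :: "'a :: field"
  assumes two: "(1 :: 'a) + 1 = 0" and n: "0 < n"
    and valid: "\<And>i. i < length E \<Longrightarrow> fst (E ! i) < n \<and> fst (snd (E ! i)) < n \<and> fst (E ! i) \<noteq> fst (snd (E ! i))"
    and word: "y ^ 20 \<le> 2 ^ b" "n + 2 \<le> y" "length E + 2 \<le> y" "t + 2 \<le> y"
    and e: "e = exponent n t" and l: "l = level e" and root: "z ^ (2 * 3 ^ l) + z ^ (3 ^ l) + 1 = 0"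
    and lay: "BS = length E * 3 + 4" "BM = BS + Suc e * Suc e" "BC = BM + n * n" "BJ = BC + n" "BA = BJ + n"
  shows "instance_machine z b n t e l BS BM BC BJ BA E"
proof -
  interpret m: machine z b n t e l BS BM BC BJ BA
    by unfold_locales (use two root in simp_all)
  have e0: "0 < e" using exponent_bounds[OF n] e by simp
  have y2: "2 \<le> y" using word by linarith
  have c: "2 ^ k \<le> y ^ k" for k using y2 by (rule power_mono) simp
  have pm: "y ^ i \<le> y ^ j" if "i \<le> j" for i j using that y2 by (intro power_increasing) simp_all
  have N: "m.N \<le> y ^ 5"
  proof -
    have "n * Suc t \<le> y * y" using word by (intro mult_mono) simp_all
    then have "m.N \<le> 8 * (y * y)" using exponent_bounds(2)[OF n, of t] unfolding m.N_def unfolding e by linarith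
    also have "\<dots> \<le> y ^ 3 * (y * y)" using c[of 3] by (intro mult_right_mono) simp_all
    also have "\<dots> = y ^ 5" by (simp add: eval_nat_numeral)
    finally show ?thesis .
  qed
  have d3: "m.d \<le> 3 * e" using level_le[OF e0] unfolding m.d_def unfolding l .
  have "m.Q \<le> 2 ^ (e * 3)" unfolding m.Q_def using d3 by (intro power_increasing) simp_all
  also have "\<dots> = m.N ^ 3" by (simp add: m.N_def power_mult)
  also have "\<dots> \<le> (y ^ 5) ^ 3" using N by (rule power_mono) simp
  also have "\<dots> = y ^ 15" by (simp flip: power_mult)
  finally have "4 * m.Q \<le> y ^ 2 * y ^ 15" using c[of 2] by (intro mult_mono) simp_all
  also have "\<dots> = y ^ 17" by (simp flip: power_add)
  also have "\<dots> \<le> 2 ^ b" using pm[of 17 20] word(1) by simp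
  finally have big: "4 * m.Q \<le> 2 ^ b" .
  have b7: "128 \<le> (2 :: nat) ^ b" using c[of 7] pm[of 7 20] word(1) by simp
  have room: "BA + m.L + 4 * m.N < 2 ^ b"
  proof -
    have eN: "Suc e \<le> m.N" unfolding m.N_def by (rule Suc_leI) (rule less_exp)
    have "Suc e * Suc e \<le> y ^ 5 * y ^ 5" using eN N by (intro mult_mono) simp_all
    also have "\<dots> = y ^ 10" by (simp flip: power_add)
    finally have 1: "Suc e * Suc e \<le> y ^ 10" .
    have nn: "n * n \<le> y ^ 2" unfolding power2_eq_square using word by (intro mult_mono) simp_all
    then have 2: "n * n \<le> y ^ 10" using pm[of 2 10] by simp
    have "m.L \<le> y ^ 2 * y ^ 5" unfolding m.L_def using nn N by (intro mult_mono) simp_all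
    also have "\<dots> = y ^ 7" by (simp flip: power_add)
    also have "\<dots> \<le> y ^ 10" by (rule pm) simp
    finally have 3: "m.L \<le> y ^ 10" .
    have 4: "m.N \<le> y ^ 10" "y \<le> y ^ 10" using N pm[of 5 10] pm[of 1 10] by simp_all
    have "16 * y ^ 10 \<le> y ^ 4 * y ^ 10" using c[of 4] by (intro mult_right_mono) simp_all
    also have "\<dots> = y ^ 14" by (simp flip: power_add)
    also have "\<dots> \<le> 2 ^ b" using pm[of 14 20] word(1) by simp
    finally have "16 * y ^ 10 \<le> 2 ^ b" .
    then show ?thesis using lay word 1 2 3 4 y2 by linarith
  qed
  have ed: "e \<le> m.d" using level_least(1)[of e] unfolding m.d_def unfolding l .
  have layout: "BS + Suc e * Suc e \<le> BM" "BM + n * n \<le> BC" "BC + n \<le> BJ" "BJ + n \<le> BA"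
    using lay by simp_all
  have e1: "4 * (n * Suc t) < m.N"
    using exponent_least(1)[of n t] unfolding m.N_def unfolding e .
  have e2: "2 ^ k \<le> 4 * (n * Suc t)" if "k < e" for k
    using that unfolding e by (rule exponent_least(2))
  have ll: "\<And>k. k < l \<Longrightarrow> 2 * 3 ^ k < e" using level_least(2)[of _ e] unfolding l by blast
  show ?thesis
    by unfold_locales (rule b7 big e0 ed layout room n e1 e2 ll lay valid; assumption?)+
qed

lemma DECIDE_correct:
  assumes valid: "valid_instance x" and adm: "admissible_word_length 20 x b"
  shows "(\<forall>(Q, s) \<in> set_pmf (run b (time_bound x) (DECIDE, input_state x)). Q = Skip) \<and>
    measure_pmf.prob (run b (time_bound x) (DECIDE, input_state x))
      {(Q, s). regs s 0 = (if has_exact_matching x then 1 else 0)} \<ge> 2 / 3"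
    (is "(\<forall>(Q, s) \<in> ?S. Q = Skip) \<and> ?p \<ge> 2 / 3")
proof -
  define n t E where "n = num_verts x" and "t = nat (target x)" and "E = edges x"
  define y where "y = max_number x + 2"
  have fin: "finite ({num_verts x, num_edges x, nat \<bar>target x\<bar>} \<union> weight ` set (edges x))" by simp
  have "n \<le> max_number x" "length E \<le> max_number x" "nat \<bar>target x\<bar> \<le> max_number x"
    unfolding max_number_def n_def E_def by (rule Max_ge[OF fin]; simp)+
  then have y: "n + 2 \<le> y" "length E + 2 \<le> y" "t + 2 \<le> y" by (auto simp: y_def t_def)
  have yb: "y ^ 20 \<le> 2 ^ b" using adm by (simp add: admissible_word_length_def y_def)
  have "(2 :: nat) ^ 20 \<le> y ^ 20" by (rule power_mono) (simp_all add: y_def)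
  then have b128: "128 \<le> (2 :: nat) ^ b" using yb by simp
  then have md: "Suc 0 mod 2 ^ b = Suc 0" "2 mod 2 ^ b = (2 :: nat)" "3 mod 2 ^ b = (3 :: nat)"
    by (intro mod_less; linarith)+
  have b0: "0 < b" using b128 by (cases b) simp_all
  have v: "fst (E ! i) < n \<and> fst (snd (E ! i)) < n \<and> fst (E ! i) \<noteq> fst (snd (E ! i))" if "i < length E" for i
  proof -
    obtain a c w where p: "E ! i = (a, c, w)" by (cases "E ! i") auto
    have "(a, c, w) \<in> set E" using nth_mem[OF that] by (simp only: p)
    then have "(a, c, w) \<in> set (edges x)" by (simp only: E_def)
    from bspec[OF valid[unfolded valid_instance_def] this] show ?thesis by (simp add: p n_def)
  qed
  show ?thesis
  proof (cases "target x < 0 \<or> n = 0")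
    case True
    have "wp b DECIDE (input_state x) (\<lambda>s' k. regs s' 0 = (if has_exact_matching x then 1 else 0) \<and> k \<le> 60)"
    proof (cases "target x < 0")
      case neg: True
      have no: "\<not> has_exact_matching x"
      proof
        assume "has_exact_matching x"
        then obtain M where "int (total_weight x M) = target x" unfolding has_exact_matching_def by blast
        then show False using neg by linarith
      qed
      have ov: "operand_val b (Const k) s = k" if "k < 128" for k s
        unfolding operand_val.simps by (rule mod_less) (use that b128 in linarith)
      define q where "q = nat \<bar>target x\<bar>"
      have m: "mem (input_state x) 2 = Suc 0" "mem (input_state x) 3 = q"
        using neg by (simp_all add: input_state_mem(3,4) q_def)
      show ?thesis
        unfolding DECIDE_def using no by (simp add: input_state_mem(1,2,7) m ov del: operand_val.simps(2))
    next
      case False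
      then have n0: "n = 0" using True by simp
      then have "E = []" using v[of 0] by (cases E) auto
      then have "has_exact_matching x \<longleftrightarrow> target x = 0"
        using n0 by (auto simp: has_exact_matching_def perfect_matching_def total_weight_def n_def E_def)
      then show ?thesis
        unfolding DECIDE_def using n0 False by (simp add: input_state_mem md arith_val.simps n_def b0)
    qed
    then have "halts_uniformly b DECIDE (input_state x) 60 {()} (\<lambda>_ s'. regs s' 0 = (if has_exact_matching x then 1 else 0))"
      by (rule halts_uniformly_det)
    then have "halts_uniformly b DECIDE (input_state x) (time_bound x) {()} (\<lambda>_ s'. regs s' 0 = (if has_exact_matching x then 1 else 0))"
      by (rule halts_uniformly_mono) (simp_all add: time_bound_def Let_def)
    then show ?thesis by (rule halts_uniformly_prob[where G = "{()}"]) simp_all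
  next
    case False
    define e where "e = exponent n t"
    define l where "l = level e"
    \<comment> \<open>The root is chosen per instance and lives in the proof; the program knows only
      \<open>l\<close>.\<close>
    obtain z :: "bit alg_closure" where z: "z ^ (2 * 3 ^ l) + z ^ (3 ^ l) + 1 = 0"
      using exists_root_trinomial[of "3 ^ l"] by auto
    interpret instance_machine z b n t e l "length E * 3 + 4" "length E * 3 + 4 + Suc e * Suc e"
      "length E * 3 + 4 + Suc e * Suc e + n * n" "length E * 3 + 4 + Suc e * Suc e + n * n + n"
      "length E * 3 + 4 + Suc e * Suc e + n * n + n + n" E
      by (rule instance_machine_exists[OF bit_alg_closure_two _ v yb y e_def l_def z]) (use False in simp_all)
    have ans: "families = {} \<longleftrightarrow> \<not> has_exact_matching x"
    proof -
      have t: "target x = int t" using False by (simp add: t_def)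
      have "has_exact_matching x \<longleftrightarrow> (\<exists>M\<subseteq>{..<length E}. (\<forall>v<n. \<exists>!i. i \<in> M \<and> v \<in> ends (E ! i)) \<and>
          (\<Sum>i\<in>M. weight (E ! i)) = t)"
        unfolding has_exact_matching_def perfect_matching_def total_weight_def t n_def E_def
        by (simp only: of_nat_eq_iff conj_assoc)
      then have "has_exact_matching x \<longleftrightarrow> families \<noteq> {}" unfolding families_nonempty_iff .
      then show ?thesis by blast
    qed
    let ?R = "\<lambda>w s'. regs s' 0 = (if multilinear (phi z) families w = 0 then 0 else (1 :: nat))"
    have W: "finite (word_lists N L)" "word_lists N L \<noteq> {}"
      using card_word_lists[of N L] by (auto simp: N_def)
    have "halts_uniformly b DECIDE (input_state x) (10 + 1 + Suc (Suc time_main)) (word_lists N L) ?R"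
      unfolding DECIDE_def
    proof (rule halts_uniformly_Seq_det[OF W, where ?R1.0 = "\<lambda>s. mem s = mem (input_state x) \<and>
        regs s 0 = 0 \<and> regs s 1 = n \<and> regs s 2 = length E \<and> regs s 3 = t \<and> regs s 20 = 0"])
      show "wp b (Load 1 (Const 0) ;; Load 2 (Const 1) ;; Load 20 (Const 2) ;; Load 3 (Const 3)) (input_state x)
        (\<lambda>s k. (mem s = mem (input_state x) \<and> regs s 0 = 0 \<and> regs s 1 = n \<and> regs s 2 = length E \<and>
          regs s 3 = t \<and> regs s 20 = 0) \<and> k \<le> 10)"
        using False by (simp add: input_state_mem n_def E_def t_def)
      fix s :: ram_state assume s: "mem s = mem (input_state x) \<and> regs s 0 = 0 \<and> regs s 1 = n \<and> regs s 2 = length E \<and>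
        regs s 3 = t \<and> regs s 20 = 0"
      have "halts_uniformly b MAIN s time_main (word_lists N L) ?R"
      proof (rule MAIN_spec)
        have ms: "mem s = mem (input_state x)" using s by blast
        show "regs s 1 = n" "regs s 2 = length E" "regs s 3 = t" "regs s 0 = 0" using s by blast+
        show "mem s (4 + i * 3) = fst (E ! i) \<and> mem s (5 + i * 3) = fst (snd (E ! i)) \<and>
          mem s (6 + i * 3) = snd (snd (E ! i))" if "i < length E" for i
          using that input_state_mem(5)[of i x] unfolding ms E_def by blast
        show "mem s a = 0" if "length E * 3 + 4 \<le> a" for a
          using that input_state_mem(6)[of x a] unfolding ms E_def by blast
      qed
      then show "halts_uniformly b (Cond (Equal (Reg 20) (Const 1)) Skip
          (Cond (Equal (Reg 1) (Const 0)) (Cond (Equal (Reg 3) (Const 0)) (MOV 0 (Const 1)) Skip) MAIN)) s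
          (Suc (Suc time_main)) (word_lists N L) ?R"
        using s False by (intro halts_uniformly_Cond) (auto intro!: halts_uniformly_Cond)
    qed
    moreover have "10 + 1 + Suc (Suc time_main) \<le> time_bound x"
      using time_main_le unfolding time_bound_def Let_def n_def[symmetric] t_def[symmetric] e_def[symmetric]
        l_def[symmetric] E_def[symmetric] N_def[symmetric] d_def[symmetric] by linarith
    ultimately have "halts_uniformly b DECIDE (input_state x) (time_bound x) (word_lists N L) ?R"
      by (rule halts_uniformly_mono)
    then show ?thesis
      by (rule halts_uniformly_prob[OF _ W _ good_words]) (auto simp: ans)
  qed
qed

section \<open>The asymptotic bound\<close>

text \<open>The number of points is at most \<open>16 * T * n\<close>, so \<open>e\<close> and with
  it the field degree are logarithmic in \<open>f\<close>, and their sixth power goes into the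
  polylogarithmic factor. \<open>max 1\<close> keeps the first summand positive for target 0, where
  the work still grows with \<open>n\<close>.\<close>

lemma time_bound_soft_O:
  "time_bound \<in> soft_O (\<lambda>x. real_of_int (max 1 (target x)) * real (num_verts x) ^ 8 + real (num_edges x))"
  unfolding soft_O_def
proof (intro CollectI exI allI)
  fix x
  define n m t where "n = num_verts x" and "m = num_edges x" and "t = nat (target x)"
  define T where "T = real_of_int (max 1 (target x))"
  define f where "f = T * real n ^ 8 + real m"
  define e where "e = exponent n t"
  define D where "D = Suc (2 * 3 ^ level e)"
  define Y where "Y = ln (f + 2)"
  have T1: "1 \<le> T" "real (Suc t) \<le> 2 * T" unfolding T_def t_def by (auto simp: max_def)
  have f0: "0 \<le> T * real n ^ 8" "0 \<le> f" using T1 by (simp_all add: f_def)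
  have ln2: "1 / 2 \<le> ln (2 :: real)" using ln2_ge_two_thirds by linarith
  have lnY: "ln 2 \<le> Y" unfolding Y_def using f0 by (intro ln_mono) simp_all
  then have "(1 / 2) ^ 6 \<le> Y ^ 6" using ln2 by (intro power_mono) linarith+
  \<comment> \<open>From \<open>1 / 2 \<le> ln 2 \<le> Y\<close>; the factor
    \<open>64 = 2 ^ 6\<close> lets terms without logarithms be bounded by the same
    expression.\<close>
  then have Y6: "1 \<le> 64 * Y ^ 6" by (simp add: power_one_over)
  have tail: "40 * real m + 60 \<le> 60 * (f + 1) * (64 * Y ^ 6)"
  proof -
    have "40 * real m + 60 \<le> 60 * (f + 1) * 1" using f0 by (simp add: f_def)
    also have "\<dots> \<le> 60 * (f + 1) * (64 * Y ^ 6)" using Y6 f0 by (intro mult_left_mono) simp_all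
    finally show ?thesis .
  qed
  have main: "3090 * (2 ^ e * (real n * real D) ^ 6) \<le> (49440 * 40 ^ 6) * (f + 1) * Y ^ 6"
  proof (cases "n = 0")
    case True
    then have "3090 * (2 ^ e * (real n * real D) ^ 6) = 0" by simp
    moreover have "0 \<le> (49440 * 40 ^ 6) * (f + 1) * Y ^ 6" using f0 by (intro mult_nonneg_nonneg) simp_all
    ultimately show ?thesis by (rule ord_eq_le_trans)
  next
    case False
    then have n1: "1 \<le> real n" by simp
    have e0: "0 < e" and "2 ^ e \<le> 8 * (n * Suc t)" using exponent_bounds[of n t] False by (simp_all add: e_def)
    then have "real (2 ^ e) \<le> real (8 * (n * Suc t))" by (simp only: of_nat_le_iff)
    then have "(2 :: real) ^ e \<le> 8 * (real n * real (Suc t))"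
      by (simp only: of_nat_mult of_nat_numeral of_nat_power)
    also have "\<dots> \<le> 8 * (real n * (2 * T))" using T1 by (intro mult_left_mono) simp_all
    finally have N: "(2 :: real) ^ e \<le> 16 * (T * real n)" by (simp add: mult.commute)
    have "T * real n ^ 1 \<le> T * real n ^ 8" using T1 n1 by (intro mult_left_mono power_increasing) simp_all
    then have "(2 :: real) ^ e \<le> 2 ^ 4 * (f + 2)" using N by (simp add: f_def)
    then have le: "(2 :: real) ^ e \<le> 2 ^ 4 * (f + 2)" .
    have "ln (16 :: real) = 4 * ln 2" using ln_realpow[of 2 4] by simp
    moreover from le have "ln ((2 :: real) ^ e) \<le> ln (2 ^ 4 * (f + 2))" by (intro ln_mono) simp_all
    moreover have "ln (2 ^ 4 * (f + 2)) = ln 16 + Y" unfolding Y_def using f0 by (subst ln_mult) simp_all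
    \<comment> \<open>\<open>ln 16 = 4 * ln 2\<close> is at most \<open>4 * Y\<close>; with
      \<open>1 / 2 \<le> ln 2\<close> this becomes \<open>e \<le> 10 * Y\<close>.\<close>
    ultimately have "real e * ln 2 \<le> 5 * Y" using lnY by (simp add: ln_realpow)
    moreover have "real e * (1 / 2) \<le> real e * ln 2" using ln2 by (intro mult_left_mono) simp_all
    ultimately have "real e \<le> 10 * Y" by linarith
    moreover have "D \<le> 4 * e" using level_le[OF e0] e0 unfolding D_def by linarith
    then have "real D \<le> real (4 * e)" by (simp only: of_nat_le_iff)
    then have "real D \<le> 4 * real e" by (simp only: of_nat_mult of_nat_numeral)
    ultimately have D: "real D \<le> 40 * Y" by linarith
    have D6: "real D ^ 6 \<le> (40 * Y) ^ 6" using D by (rule power_mono) simp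
    have n78: "real n ^ 7 \<le> real n ^ 8" using n1 by (intro power_increasing) simp_all
    have "3090 * (2 ^ e * (real n * real D) ^ 6) = 3090 * (2 ^ e * (real n ^ 6 * real D ^ 6))"
      by (simp add: power_mult_distrib)
    also have "\<dots> \<le> 3090 * ((16 * (T * real n)) * (real n ^ 6 * (40 * Y) ^ 6))"
      using N D6 by (intro mult_left_mono mult_mono) (use T1 in simp_all)
    also have "\<dots> = 49440 * 40 ^ 6 * (T * real n ^ 7) * Y ^ 6"
    proof -
      have n7: "real n ^ 7 = real n * real n ^ 6" using power_add[of "real n" 1 6] by simp
      have "3090 * ((16 * (u * v)) * (p * (k * q))) = 49440 * k * (u * (v * p)) * q" for u v p k q :: real
        by (simp add: algebra_simps)
      then show ?thesis unfolding n7 power_mult_distrib .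
    qed
    also have "\<dots> \<le> 49440 * 40 ^ 6 * (f + 1) * Y ^ 6"
    proof (intro mult_right_mono mult_left_mono)
      \<comment> \<open>Six factors \<open>n\<close> from the program and one from the number of
        points; one factor is given away.\<close>
      have "T * real n ^ 7 \<le> T * real n ^ 8" using n78 T1 by (intro mult_left_mono) simp_all
      then show "T * real n ^ 7 \<le> f + 1" by (simp add: f_def)
    qed (use Y6 in simp_all)
    finally show ?thesis .
  qed
  have "real (time_bound x) = 3090 * (2 ^ e * (real n * real D) ^ 6) + (40 * real m + 60)"
    unfolding time_bound_def Let_def n_def[symmetric] m_def[symmetric] t_def[symmetric] e_def[symmetric] D_def[symmetric]
    by simp
  also have "\<dots> \<le> (49440 * 40 ^ 6) * (f + 1) * Y ^ 6 + 60 * (f + 1) * (64 * Y ^ 6)"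
    using main tail by (rule add_mono)
  also have "\<dots> = (49440 * 40 ^ 6 + 3840) * (f + 1) * Y ^ 6"
  proof -
    have "k * g * q + 60 * g * (64 * q) = (k + 3840) * g * q" for k g q :: real by (simp add: algebra_simps)
    then show ?thesis .
  qed
  finally show "real (time_bound x) \<le> (49440 * 40 ^ 6 + 3840) *
      (real_of_int (max 1 (target x)) * real (num_verts x) ^ 8 + real (num_edges x) + 1) *
      ln (real_of_int (max 1 (target x)) * real (num_verts x) ^ 8 + real (num_edges x) + 2) ^ 6"
    by (simp only: f_def T_def n_def m_def Y_def)
qed

theorem theorem2:
  "\<exists>P c T.
     monte_carlo_decides_exact_matching P c T \<and>
     T \<in> soft_O (\<lambda>x. real_of_int (max 1 (target x)) * real (num_verts x) ^ 8 + real (num_edges x))"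
proof (intro exI conjI)
  show "monte_carlo_decides_exact_matching DECIDE 20 time_bound"
    unfolding monte_carlo_decides_exact_matching_def using DECIDE_correct by blast
qed (rule time_bound_soft_O)

end
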